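(* Let $\mathcal{WAP}_{\mathcal S}(\mathbb R^d)$, $\mathcal{SAP}_{\mathcal S}(\mathbb R^d)$ and $\mathcal{WAP}_{0,\mathcal S}(\mathbb R^d)$ denote the spaces of weakly, strongly and null weakly almost periodic tempered distributions on $\mathbb R^d$. Then \[ \mathcal{WAP}_{\mathcal S}(\mathbb R^d)=\mathcal{SAP}_{\mathcal S}(\mathbb R^d)\oplus \mathcal{WAP}_{0,\mathcal S}(\mathbb R^d), \] i.e. every $\psi\in\mathcal{WAP}_{\mathcal S}(\mathbb R^d)$ can be written uniquely as $\psi=\psi_{\mathsf s}+\psi_0$ with $\psi_{\mathsf s}\in \mathcal{SAP}_{\mathcal S}(\mathbb R^d)$ and $\psi_0\in\mathcal{WAP}_{0,\mathcal S}(\mathbb R^d)$. Moreover, for all $f\in\mathcal S(\mathbb R^d)$, \[ (\psi*f)_{\mathsf s}=\psi_{\mathsf s}*f,\qquad (\psi*f)_0=\psi_0*f, \] where on the left $(\psi*f)=(\psi*f)_{\mathsf s}+(\psi*f)_0$ is the Eberlein decomposition of the weakly almost periodic function $\psi*f$.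
   Context: $\mathcal S=\mathcal S(\mathbb R^d)$ is the Schwartz space and $\mathcal S'$ the space of tempered distributions. For $\psi\in\mathcal S'$ and $f\in\mathcal S$, $\psi*f(t):=\psi(T_tf_-)$, where $f_-(s)=f(-s)$ and $T_tf(x)=f(x-t)$. $WAP(\mathbb R^d)$, $SAP(\mathbb R^d)$, $WAP_0(\mathbb R^d)$ denote the spaces of weakly almost periodic, (Bohr/strongly) almost periodic and null weakly almost periodic functions (the latter: $g\in WAP(\mathbb R^d)$ with $\lim_{R\to\infty}\frac{1}{\mathrm{vol}(B_R)}\int_{B_R}|g|\,d\lambda=0$); every $g\in WAP(\mathbb R^d)$ has a unique Eberlein decomposition $g=g_{\mathsf s}+g_0$ with $g_{\mathsf s}\in SAP$, $g_0\in WAP_0$. A tempered distribution $\psi$ is called weakly / strongly / null weakly almost periodic if $\psi*f$ lies in $WAP(\mathbb R^d)$ / $SAP(\mathbb R^d)$ / $WAP_0(\mathbb R^d)$ for every $f\in\mathcal S$. *)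

theory Defs
  imports "HOL-Analysis.Analysis"
begin

definition dderiv :: "'a::euclidean_space \<Rightarrow> ('a \<Rightarrow> complex) \<Rightarrow> 'a \<Rightarrow> complex" where
  "dderiv v f x = frechet_derivative f (at x) v"

fun iter_dderiv :: "'a::euclidean_space list \<Rightarrow> ('a \<Rightarrow> complex) \<Rightarrow> 'a \<Rightarrow> complex" where
  "iter_dderiv [] f = f"
| "iter_dderiv (v # vs) f = dderiv v (iter_dderiv vs f)"

definition schwartz :: "('a::euclidean_space \<Rightarrow> complex) set" where
  "schwartz = {f. (\<forall>vs. set vs \<subseteq> Basis \<longrightarrow> (\<forall>x. iter_dderiv vs f differentiable (at x)))
      \<and> (\<forall>k::nat. \<forall>vs. set vs \<subseteq> Basis \<longrightarrow>
           (\<exists>C. \<forall>x. (1 + norm x) ^ k * norm (iter_dderiv vs f x) \<le> C))}"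

definition schwartz_seminorm :: "nat \<Rightarrow> 'a::euclidean_space list \<Rightarrow> ('a \<Rightarrow> complex) \<Rightarrow> real" where
  "schwartz_seminorm k vs f = (SUP x. (1 + norm x) ^ k * norm (iter_dderiv vs f x))"

text \<open>Tempered distributions: continuous complex-linear functionals on the Schwartz space
  (continuity w.r.t. the Frechet topology given by the seminorms).  Functionals are
  normalised to be 0 outside the Schwartz space, so that they are determined by their
  action on the Schwartz space.\<close>
definition tempered :: "(('a::euclidean_space \<Rightarrow> complex) \<Rightarrow> complex) \<Rightarrow> bool" where
  "tempered \<psi> \<longleftrightarrow>
     (\<forall>f. f \<notin> schwartz \<longrightarrow> \<psi> f = 0) \<and>
     (\<forall>f\<in>schwartz. \<forall>g\<in>schwartz. \<psi> (\<lambda>x. f x + g x) = \<psi> f + \<psi> g) \<and>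
     (\<forall>f\<in>schwartz. \<forall>c. \<psi> (\<lambda>x. c * f x) = c * \<psi> f) \<and>
     (\<exists>C N. \<forall>f\<in>schwartz. norm (\<psi> f) \<le>
         C * (\<Sum>k\<le>N. \<Sum>vs\<in>{vs. set vs \<subseteq> Basis \<and> length vs \<le> N}. schwartz_seminorm k vs f))"

definition dconv :: "(('a::euclidean_space \<Rightarrow> complex) \<Rightarrow> complex) \<Rightarrow> ('a \<Rightarrow> complex) \<Rightarrow> 'a \<Rightarrow> complex" where
  "dconv \<psi> f t = \<psi> (\<lambda>x. f (t - x))"

definition Cu :: "('a::euclidean_space \<Rightarrow>\<^sub>C complex) set" where
  "Cu = {h. uniformly_continuous_on UNIV (apply_bcontfun h)}"

definition weak_top :: "('a::euclidean_space \<Rightarrow>\<^sub>C complex) topology" where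
  "weak_top = topology_generated_by
      {{h. \<phi> h \<in> U} | (\<phi> :: ('a \<Rightarrow>\<^sub>C complex) \<Rightarrow> real) U. bounded_linear \<phi> \<and> open U}"

definition translates :: "('a::euclidean_space \<Rightarrow> complex) \<Rightarrow> ('a \<Rightarrow>\<^sub>C complex) set" where
  "translates g = {Bcontfun (\<lambda>x. g (x - t)) | t. True}"

definition is_Cu :: "('a::euclidean_space \<Rightarrow> complex) \<Rightarrow> bool" where
  "is_Cu g \<longleftrightarrow> continuous_on UNIV g \<and> bounded (range g) \<and> uniformly_continuous_on UNIV g"

definition WAP :: "('a::euclidean_space \<Rightarrow> complex) \<Rightarrow> bool" where
  "WAP g \<longleftrightarrow> is_Cu g \<and>
     compactin (subtopology weak_top Cu) ((subtopology weak_top Cu) closure_of translates g)"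

definition SAP :: "('a::euclidean_space \<Rightarrow> complex) \<Rightarrow> bool" where
  "SAP g \<longleftrightarrow> is_Cu g \<and> compact (closure (translates g))"

definition WAP0 :: "('a::euclidean_space \<Rightarrow> complex) \<Rightarrow> bool" where
  "WAP0 g \<longleftrightarrow> WAP g \<and>
     ((\<lambda>R::real. integral (ball 0 R) (\<lambda>x. norm (g x)) / measure lebesgue (ball (0::'a) R))
        \<longlongrightarrow> 0) at_top"

definition eberlein_s :: "('a::euclidean_space \<Rightarrow> complex) \<Rightarrow> 'a \<Rightarrow> complex" where
  "eberlein_s g = (THE h. SAP h \<and> WAP0 (\<lambda>x. g x - h x))"

definition eberlein_0 :: "('a::euclidean_space \<Rightarrow> complex) \<Rightarrow> 'a \<Rightarrow> complex" where
  "eberlein_0 g = (\<lambda>x. g x - eberlein_s g x)"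

definition WAP_S :: "(('a::euclidean_space \<Rightarrow> complex) \<Rightarrow> complex) set" where
  "WAP_S = {\<psi>. tempered \<psi> \<and> (\<forall>f\<in>schwartz. WAP (dconv \<psi> f))}"

definition SAP_S :: "(('a::euclidean_space \<Rightarrow> complex) \<Rightarrow> complex) set" where
  "SAP_S = {\<psi>. tempered \<psi> \<and> (\<forall>f\<in>schwartz. SAP (dconv \<psi> f))}"

definition WAP0_S :: "(('a::euclidean_space \<Rightarrow> complex) \<Rightarrow> complex) set" where
  "WAP0_S = {\<psi>. tempered \<psi> \<and> (\<forall>f\<in>schwartz. WAP0 (dconv \<psi> f))}"

end

theory Submission
  imports Defs
begin

text \<open>
Let \<open>g\<close> be weakly almost periodic. In the weak closure of its orbit choose a minimal closed
translation invariant set \<open>K\<close>. The orbit closure is norm separable, so by Baire's theorem some norm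
ball has nonempty weak interior in \<open>K\<close>, and minimality turns this into total boundedness: \<open>K\<close> is norm
compact and consists of almost periodic functions. If \<open>T\<^bsub>s(n)\<^esub> g\<close> converges weakly to \<open>k \<in> K\<close>, a norm
limit \<open>h\<close> of a subsequence of \<open>T\<^bsub>-s(n)\<^esub> k\<close> satisfies \<open>T\<^bsub>s(n)\<^esub> (g - h) \<rightarrow> 0\<close> weakly.

A function with a weakly null sequence of translates has absolute mean zero. Otherwise the sets where
these translates exceed some \<open>\<epsilon>\<close> all have mean bounded below, hence infinitely many of them have the finite
intersection property, and a limit of point evaluations contradicts weak convergence. So
\<open>g = h + (g - h)\<close> is the Eberlein decomposition, and \<open>\<parallel>h\<parallel> \<le> \<parallel>g\<parallel>\<close>.

For a distribution, \<open>\<psi>\<^sub>s(f) = (\<psi> * f\<^sub>-)\<^sub>s(0)\<close>. Continuity follows from \<open>\<bar>\<psi>\<^sub>s(f)\<bar> \<le> sup \<bar>\<psi> * f\<^sub>-\<bar>\<close> and a uniform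
boundedness principle for the translates of \<open>\<psi>\<close>.
\<close>

section \<open>A Hahn--Banach theorem and generalised limits\<close>

text \<open>The weak topology is tested by real functionals on all bounded continuous functions, and
  Hahn--Banach provides two kinds of them: one separating a point from a closed subspace, and
  generalised limits of bounded sequences. The latter do double duty. Averages over balls need not
  converge as the radius grows, so a generalised limit along suitable radii replaces them by a
  finitely additive mean. The points witnessing finite intersections need not converge either, so a
  generalised limit of evaluations at them is the functional that contradicts weak convergence.

  Uniform continuity makes orbits norm continuous, hence separable; this is what Baire's theorem
  needs. The element \<open>k\<close> is only some point of the orbit closure; pulling it back by
  the same translations gives the \<open>h\<close> whose translates asymptotically follow those of
  \<open>g\<close>.

  For distributions the obstacle is that continuity of \<psi> bounds \<psi> * f at t only with a
  constant growing polynomially in t, while the almost periodic part needs one bound for all t. That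
  each \<psi> * f is bounded is the extra input that makes such a bound available.\<close>

definition sublinear :: "('v::real_vector \<Rightarrow> real) \<Rightarrow> bool" where
  "sublinear p \<longleftrightarrow> (\<forall>x y. p (x + y) \<le> p x + p y) \<and> (\<forall>c x. 0 \<le> c \<longrightarrow> p (c *\<^sub>R x) \<le> c * p x)"

lemma sublinear_add: "sublinear p \<Longrightarrow> p (x + y) \<le> p x + p y"
  by (simp add: sublinear_def)

lemma sublinear_0: "sublinear p \<Longrightarrow> p 0 = 0"
  using sublinear_add[of p 0 0] spec[of "\<lambda>x. p (0 *\<^sub>R x) \<le> 0 * p x" 0]
  by (auto simp: sublinear_def dest!: spec[of _ 0])

lemma sublinear_minus: "sublinear p \<Longrightarrow> - p (- x) \<le> p x"
  using sublinear_add[of p x "- x"] sublinear_0[of p] by simp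

text \<open>Applying the inequality to \<open>inverse c\<close> as well turns it into an equality.
  The definition keeps one direction only, which is quicker to check for infima of
  functionals.\<close>

lemma sublinear_scale:
  assumes "sublinear p" "0 \<le> c" shows "p (c *\<^sub>R x) = c * p x"
proof (cases "c = 0")
  case False
  have "0 \<le> inverse c" using assms(2) by simp
  then have "p (inverse c *\<^sub>R (c *\<^sub>R x)) \<le> inverse c * p (c *\<^sub>R x)"
    using assms(1) unfolding sublinear_def by blast
  then have "c * p x \<le> p (c *\<^sub>R x)"
    using False assms(2) by (simp add: field_simps)
  moreover have "p (c *\<^sub>R x) \<le> c * p x"
    using assms by (simp add: sublinear_def)
  ultimately show ?thesis by simp
qed (simp add: sublinear_0[OF assms(1)])

text \<open>The infimum over \<open>t >= 0\<close> of \<open>p (x + t y) - t p y\<close> works: at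
  \<open>- y\<close> the choice \<open>t = 1\<close> gives \<open>p 0 - p y\<close>. It is finite
  because \<open>t p y = p (t y) <= p (x + t y) + p (- x)\<close>.\<close>

lemma sublinear_lower:
  assumes p: "sublinear p"
  obtains q where "sublinear q" "\<And>x. q x \<le> p x" "q (- y) \<le> - p y"
proof -
  define F where "F x t = p (x + t *\<^sub>R y) - t * p y" for x t
  define q where "q x = (INF t\<in>{0..}. F x t)" for x
  have lower: "- p (- x) \<le> F x t" if "0 \<le> t" for x t
    using sublinear_add[OF p, of "x + t *\<^sub>R y" "- x"] sublinear_scale[OF p that, of y] by (simp add: F_def)
  then have bdd: "bdd_below (F x ` {0..})" for x
    by (intro bdd_belowI2) auto
  have q_le: "q x \<le> F x t" if "0 \<le> t" for x t
    unfolding q_def using that by (intro cINF_lower bdd) auto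
  have q_ge: "z \<le> q x" if "\<And>t. 0 \<le> t \<Longrightarrow> z \<le> F x t" for x z
    unfolding q_def using that by (intro cINF_greatest) auto
  have add: "q (x + z) \<le> q x + q z" for x z
  proof -
    have "q (x + z) - F z t \<le> q x" if t: "0 \<le> t" for t
    proof (rule q_ge)
      \<comment> \<open>Parameters add: \<open>s\<close> for \<open>x\<close> and \<open>t\<close>
        for \<open>z\<close> make \<open>s + t\<close> a competitor for
        \<open>x + z\<close>.\<close>
      fix s :: real assume s: "0 \<le> s"
      have "q (x + z) \<le> F (x + z) (s + t)" using s t by (intro q_le) simp
      also have "\<dots> \<le> F x s + F z t"
        using sublinear_add[OF p, of "x + s *\<^sub>R y" "z + t *\<^sub>R y"]
        by (simp add: F_def algebra_simps)
      finally show "q (x + z) - F z t \<le> F x s" by simp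
    qed
    then have "q (x + z) - q x \<le> q z" by (intro q_ge) (simp add: algebra_simps)
    then show ?thesis by simp
  qed
  have scale: "q (c *\<^sub>R x) \<le> c * q x" if c: "0 \<le> c" for c x
  proof (cases "c = 0")
    case True
    then show ?thesis using q_le[of 0 0] by (simp add: F_def sublinear_0[OF p])
  next
    case False
    have "inverse c * q (c *\<^sub>R x) \<le> q x"
    proof (rule q_ge)
      fix t :: real assume t: "0 \<le> t"
      have "q (c *\<^sub>R x) \<le> F (c *\<^sub>R x) (c * t)" using c t by (intro q_le) simp
      also have "\<dots> = c * F x t"
        using sublinear_scale[OF p c, of "x + t *\<^sub>R y"] by (simp add: F_def algebra_simps)
      finally show "inverse c * q (c *\<^sub>R x) \<le> F x t"
        using c False by (simp add: field_simps)
    qed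
    then show ?thesis using c False by (simp add: field_simps)
  qed
  show thesis
  proof
    show "sublinear q" using add scale by (simp add: sublinear_def)
    show "q x \<le> p x" for x using q_le[of 0 x] by (simp add: F_def)
    show "q (- y) \<le> - p y" using q_le[of 1 "- y"] by (simp add: F_def sublinear_0[OF p])
  qed
qed

text \<open>Zorn's lemma for pointwise decrease. Everything sublinear below \<open>p\<close> is at
  least \<open>- p (- x)\<close> at \<open>x\<close>, so a chain has a finite pointwise infimum,
  which bounds it.\<close>

lemma minimal_sublinear:
  assumes p: "sublinear p"
  obtains q where "sublinear q" "\<And>x. q x \<le> p x"
    "\<And>r. sublinear r \<Longrightarrow> (\<And>x. r x \<le> q x) \<Longrightarrow> r = q"
proof -
  define A where "A = {q. sublinear q \<and> (\<forall>x. q x \<le> p x)}"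
  define P where "P = (\<lambda>a b :: 'a \<Rightarrow> real. \<forall>x. b x \<le> a x)"
  have "\<exists>m\<in>A. \<forall>a\<in>A. P m a \<longrightarrow> a = m"
  proof (rule predicate_Zorn)
    show "partial_order_on A (relation_of P A)"
      by (rule partial_order_on_relation_ofI) (auto simp: P_def fun_eq_iff intro: order_trans antisym)
  next
    fix C assume C: "C \<in> Chains (relation_of P A)"
    show "\<exists>u\<in>A. \<forall>a\<in>C. P a u"
    proof (cases "C = {}")
      case True
      then show ?thesis using p by (auto simp: A_def)
    next
      case False
      have CA: "C \<subseteq> A" and tot: "\<And>a b. a \<in> C \<Longrightarrow> b \<in> C \<Longrightarrow> P a b \<or> P b a"
        using C by (auto simp: Chains_def relation_of_def)
      define u where "u x = (INF q\<in>C. q x)" for x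
      have "- p (- x) \<le> q x" if "q \<in> C" for q x
      proof -
        have "sublinear q" "q (- x) \<le> p (- x)" using CA that by (auto simp: A_def)
        then show ?thesis using sublinear_minus[of q x] by simp
      qed
      then have bdd: "bdd_below ((\<lambda>q. q x) ` C)" for x by (intro bdd_belowI2) auto
      have u_le: "u x \<le> q x" if "q \<in> C" for q x
        unfolding u_def using that by (intro cINF_lower bdd)
      have u_ge: "z \<le> u x" if "\<And>q. q \<in> C \<Longrightarrow> z \<le> q x" for x z
        unfolding u_def using that False by (intro cINF_greatest)
      have "u (x + y) \<le> u x + u y" for x y
      proof -
        have "u (x + y) \<le> a x + b y" if ab: "a \<in> C" "b \<in> C" for a b
        proof -
          \<comment> \<open>Members of a chain are comparable, so the smaller of the two serves at
            both points and its subadditivity applies.\<close>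
          obtain m where m: "m \<in> C" "\<And>z. m z \<le> a z" "\<And>z. m z \<le> b z"
            using tot[OF ab] ab by (auto simp: P_def)
          have "u (x + y) \<le> m (x + y)" using m u_le by blast
          also have "\<dots> \<le> m x + m y" using m CA by (auto simp: A_def intro: sublinear_add)
          finally show ?thesis using m(2)[of x] m(3)[of y] by simp
        qed
        then have "u (x + y) - b y \<le> u x" if "b \<in> C" for b
          using that by (intro u_ge) (simp add: algebra_simps)
        then have "u (x + y) - u x \<le> u y" by (intro u_ge) (simp add: algebra_simps)
        then show ?thesis by simp
      qed
      moreover have "u (c *\<^sub>R x) \<le> c * u x" if c: "0 \<le> c" for c x
      proof (cases "c = 0")
        case True
        obtain q where "q \<in> C" using False by blast
        then show ?thesis using u_le[of q 0] True CA by (auto simp: A_def sublinear_0)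
      next
        case c0: False
        have "inverse c * u (c *\<^sub>R x) \<le> u x"
        proof (rule u_ge)
          fix q assume q: "q \<in> C"
          have "u (c *\<^sub>R x) \<le> q (c *\<^sub>R x)" using q u_le by blast
          also have "\<dots> = c * q x" using q CA c by (auto simp: A_def sublinear_scale)
          finally show "inverse c * u (c *\<^sub>R x) \<le> q x" using c c0 by (simp add: field_simps)
        qed
        then show ?thesis using c c0 by (simp add: field_simps)
      qed
      moreover have "u x \<le> p x" for x
      proof -
        obtain q where "q \<in> C" using False by blast
        then have "u x \<le> q x" "q x \<le> p x" using u_le CA by (auto simp: A_def)
        then show ?thesis by simp
      qed
      ultimately have "u \<in> A" by (simp add: A_def sublinear_def)
      then show ?thesis using u_le by (auto simp: P_def)
    qed
  qed
  then obtain m where m: "m \<in> A" "\<And>a. a \<in> A \<Longrightarrow> P m a \<Longrightarrow> a = m" by blast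
  show thesis
  proof (rule that)
    show "sublinear m" "\<And>x. m x \<le> p x" using m(1) by (auto simp: A_def)
    show "r = m" if "sublinear r" "\<And>x. r x \<le> m x" for r
      using m(1) that by (intro m(2)) (auto simp: A_def P_def intro: order_trans)
  qed
qed

text \<open>A minimal sublinear functional is linear, because it cannot be lowered by \<open>sublinear_lower\<close>.\<close>

theorem dominated_linear_functional:
  assumes p: "sublinear p"
  obtains \<phi> where "linear \<phi>" "\<And>x. \<phi> x \<le> p x" "\<phi> x0 = (p x0 :: real)"
proof -
  \<comment> \<open>Lowering \<open>p\<close> at \<open>x0\<close> beforehand fixes the value there:
    any odd \<open>q\<close> below \<open>p'\<close> satisfies
    \<open>- q x0 = q (- x0) <= - p x0\<close>.\<close>
  obtain p' where p': "sublinear p'" "\<And>x. p' x \<le> p x" "p' (- x0) \<le> - p x0"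
    using sublinear_lower[OF p] by blast
  obtain q where q: "sublinear q" "\<And>x. q x \<le> p' x"
    "\<And>r. sublinear r \<Longrightarrow> (\<And>x. r x \<le> q x) \<Longrightarrow> r = q"
    using minimal_sublinear[OF p'(1)] by blast
  have minus: "q (- y) = - q y" for y
  proof -
    obtain r where "sublinear r" "\<And>x. r x \<le> q x" "r (- y) \<le> - q y"
      using sublinear_lower[OF q(1)] by blast
    then have "q (- y) \<le> - q y" using q(3)[of r] by simp
    then show ?thesis using sublinear_minus[OF q(1), of "- y"] by simp
  qed
  have add: "q (x + y) = q x + q y" for x y
    using sublinear_add[OF q(1), of x y] sublinear_add[OF q(1), of "x + y" "- y"] minus[of y] by simp
  have scale: "q (c *\<^sub>R x) = c * q x" for c x
  proof (cases "0 \<le> c")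
    case False
    then have "q ((- c) *\<^sub>R x) = - c * q x" by (intro sublinear_scale[OF q(1)]) simp
    then show ?thesis using minus[of "c *\<^sub>R x"] by simp
  qed (simp add: sublinear_scale[OF q(1)])
  show thesis
  proof
    show "linear q" by (rule linearI) (simp_all add: add scale)
    show "q x \<le> p x" for x using q(2) p'(2) order_trans by blast
    have "- q x0 \<le> - p x0" using q(2)[of "- x0"] p'(3) minus[of x0] by simp
    then show "q x0 = p x0" using q(2)[of x0] p'(2)[of x0] by simp
  qed
qed

text \<open>The distance to a subspace is itself sublinear, vanishes on the subspace and is at most
  the norm, so it can play the dominating role. On \<open>S\<close> both \<open>\<phi> x\<close> and
  \<open>\<phi> (- x)\<close> are then at most zero.\<close>

corollary annihilating_functional:
  fixes S :: "'v::real_normed_vector set"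
  assumes S: "subspace S"
  obtains \<phi> where "linear \<phi>" "\<And>x. \<bar>\<phi> x\<bar> \<le> norm x" "\<And>x. x \<in> S \<Longrightarrow> \<phi> x = 0" "\<phi> x0 = infdist x0 S"
proof -
  have ne: "S \<noteq> {}" using S subspace_0 by auto
  have le: "infdist x S \<le> norm (x - s)" if "s \<in> S" for x s
    using infdist_le[OF that, of x] by (simp add: dist_norm)
  have ge: "z \<le> infdist x S" if "\<And>s. s \<in> S \<Longrightarrow> z \<le> norm (x - s)" for z x
    using that ne unfolding infdist_notempty[OF ne] by (intro cINF_greatest) (auto simp: dist_norm)
  have "sublinear (\<lambda>x. infdist x S)"
    unfolding sublinear_def
  proof (intro conjI allI impI)
    fix x y
    have "infdist (x + y) S \<le> norm (x - s) + norm (y - t)" if "s \<in> S" "t \<in> S" for s t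
      using le[OF subspace_add[OF S that], of "x + y"] norm_triangle_ineq[of "x - s" "y - t"]
      by (simp add: algebra_simps)
    then have "infdist (x + y) S - norm (y - t) \<le> infdist x S" if "t \<in> S" for t
      using that by (intro ge) (simp add: algebra_simps)
    then have "infdist (x + y) S - infdist x S \<le> infdist y S"
      by (intro ge) (simp add: algebra_simps)
    then show "infdist (x + y) S \<le> infdist x S + infdist y S" by simp
  next
    fix c :: real and x assume c: "0 \<le> c"
    show "infdist (c *\<^sub>R x) S \<le> c * infdist x S"
    proof (cases "c = 0")
      case True
      then show ?thesis using le[OF subspace_0[OF S], of 0] by simp
    next
      case False
      have "inverse c * infdist (c *\<^sub>R x) S \<le> infdist x S"
      proof (rule ge)
        fix s assume "s \<in> S"
        then have "infdist (c *\<^sub>R x) S \<le> norm (c *\<^sub>R x - c *\<^sub>R s)"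
          by (intro le subspace_scale[OF S])
        also have "\<dots> = c * norm (x - s)"
          using c by (simp flip: scaleR_diff_right)
        finally show "inverse c * infdist (c *\<^sub>R x) S \<le> norm (x - s)"
          using c False by (simp add: field_simps)
      qed
      then show ?thesis using c False by (simp add: field_simps)
    qed
  qed
  then obtain \<phi> where \<phi>: "linear \<phi>" "\<And>x. \<phi> x \<le> infdist x S" "\<phi> x0 = infdist x0 S"
    using dominated_linear_functional by blast
  show thesis
  proof
    have n: "\<phi> x \<le> norm x" for x
      using \<phi>(2)[of x] le[OF subspace_0[OF S], of x] by simp
    show "\<bar>\<phi> x\<bar> \<le> norm x" for x
      using n[of x] n[of "- x"] by (simp add: linear_neg[OF \<phi>(1)])
    show "\<phi> x = 0" if "x \<in> S" for x
      using \<phi>(2)[of x] \<phi>(2)[of "- x"] that subspace_neg[OF S that]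
      by (simp add: linear_neg[OF \<phi>(1)])
  qed fact+
qed

text \<open>\<open>L\<close> is a total function, so its laws are restricted to bounded sequences.
  \<open>L_ge\<close> asks for its bound only eventually: this makes \<open>L\<close> a functional
  of tails and lets finitely many exceptional indices be discarded.\<close>

locale generalised_limit =
  fixes L :: "(nat \<Rightarrow> real) \<Rightarrow> real"
  assumes L_add: "bounded (range x) \<Longrightarrow> bounded (range y) \<Longrightarrow> L (\<lambda>n. x n + y n) = L x + L y"
    and L_cmul: "bounded (range x) \<Longrightarrow> L (\<lambda>n. c * x n) = c * L x"
    and L_ge: "bounded (range x) \<Longrightarrow> (\<forall>\<^sub>F n in sequentially. c \<le> x n) \<Longrightarrow> c \<le> L x"
begin

lemma L_le: assumes "bounded (range x)" "\<And>n. x n \<le> c" shows "L x \<le> c"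
proof -
  obtain B where "\<And>n. \<bar>x n\<bar> \<le> B" using assms(1) by (auto simp: bounded_iff)
  then have "bounded (range (\<lambda>n. - 1 * x n))" by (intro boundedI[of _ B]) auto
  then have "- c \<le> L (\<lambda>n. - 1 * x n)" by (rule L_ge) (simp add: assms(2))
  then show ?thesis using L_cmul[OF assms(1), of "- 1"] by simp
qed

end

text \<open>The functional is obtained on \<open>\<ell>\<^sup>\<infinity>\<close> by annihilating the null sequences;
  having norm one and value one at the constant sequence forces positivity.\<close>

theorem ex_generalised_limit: "\<exists>L. generalised_limit L"
proof -
  define S where "S = {x :: nat \<Rightarrow>\<^sub>C real. apply_bcontfun x \<longlonglongrightarrow> 0}"
  have S: "subspace S"
  proof (rule subspaceI)
    show "0 \<in> S" by (simp add: S_def)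
    show "x + y \<in> S" if "x \<in> S" "y \<in> S" for x y
      using that tendsto_add[of x 0 sequentially y 0] by (simp add: S_def)
    show "c *\<^sub>R x \<in> S" if "x \<in> S" for c x
      using that tendsto_mult_right_zero[of x sequentially c] by (simp add: S_def)
  qed
  define e :: "nat \<Rightarrow>\<^sub>C real" where "e = const_bcontfun 1"
  obtain \<phi> where \<phi>: "linear \<phi>" "\<And>x. \<bar>\<phi> x\<bar> \<le> norm x" "\<And>x. x \<in> S \<Longrightarrow> \<phi> x = 0"
      "\<phi> e = infdist e S"
    using annihilating_functional[OF S] by blast
  have "1 \<le> norm (e - x)" if "x \<in> S" for x
  proof (rule LIMSEQ_le_const2)
    show "(\<lambda>n. norm (apply_bcontfun e n - x n)) \<longlonglongrightarrow> 1"
    proof -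
      have "(\<lambda>n. norm (1 - x n)) \<longlonglongrightarrow> norm (1 - 0 :: real)"
        using that by (intro tendsto_intros) (simp add: S_def)
      then show ?thesis by (simp add: e_def)
    qed
    show "\<exists>N. \<forall>n\<ge>N. norm (apply_bcontfun e n - x n) \<le> norm (e - x)"
      using norm_bounded[of "e - x"] by simp
  qed
  moreover have ne: "S \<noteq> {}" using S subspace_0 by auto
  ultimately have "1 \<le> \<phi> e"
    unfolding \<phi>(4) infdist_notempty[OF ne] by (intro cINF_greatest) (auto simp: dist_norm)
  moreover have "norm e \<le> 1" by (rule norm_bound) (simp add: e_def)
  ultimately have e1: "\<phi> e = 1" using \<phi>(2)[of e] by simp
  have pos: "0 \<le> \<phi> x" if x: "\<And>n. 0 \<le> apply_bcontfun x n" for x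
  proof -
    \<comment> \<open>With \<open>0 <= x n <= r\<close> the difference of the constant
      \<open>r\<close> and \<open>x\<close> has norm at most \<open>r\<close>, so
      \<open>r - \<phi> x <= r\<close>.\<close>
    define r where "r = norm x + 1"
    have r: "r > 0" unfolding r_def using norm_ge_zero[of x] by linarith
    have "norm (r *\<^sub>R e - x) \<le> r"
    proof (rule norm_bound)
      fix n
      have "\<bar>apply_bcontfun x n\<bar> \<le> r" using norm_bounded[of x n] by (simp add: r_def)
      then show "norm (apply_bcontfun (r *\<^sub>R e - x) n) \<le> r"
        using x[of n] by (simp add: e_def)
    qed
    then have "\<phi> (r *\<^sub>R e - x) \<le> r" using \<phi>(2)[of "r *\<^sub>R e - x"] by simp
    then show ?thesis by (simp add: linear_diff[OF \<phi>(1)] linear_scale[OF \<phi>(1)] e1)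
  qed
  define L where "L x = \<phi> (Bcontfun x)" for x
  have bc: "apply_bcontfun (Bcontfun x) = x" if "bounded (range x)" for x :: "nat \<Rightarrow> real"
    using that by (intro Bcontfun_inverse) (simp add: bcontfun_def)
  have "generalised_limit L"
  proof
    fix x y :: "nat \<Rightarrow> real" and c :: real assume x: "bounded (range x)"
    show "L (\<lambda>n. c * x n) = c * L x"
    proof -
      have "bounded (range (\<lambda>n. c * x n))"
        using bounded_scaling[OF x, of c] by (simp add: image_image)
      then have "Bcontfun (\<lambda>n. c * x n) = c *\<^sub>R Bcontfun x"
        using x by (intro bcontfun_eqI) (simp add: bc)
      then show ?thesis by (simp add: L_def linear_scale[OF \<phi>(1)])
    qed
    show "L (\<lambda>n. x n + y n) = L x + L y" if y: "bounded (range y)"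
    proof -
      have "Bcontfun (\<lambda>n. x n + y n) = Bcontfun x + Bcontfun y"
        using x y bounded_plus_comp[OF x y] by (intro bcontfun_eqI) (simp add: bc)
      then show ?thesis by (simp add: L_def linear_add[OF \<phi>(1)])
    qed
    show "c \<le> L x" if "\<forall>\<^sub>F n in sequentially. c \<le> x n"
    proof -
      \<comment> \<open>Truncation from below changes only finitely many terms, hence alters
        \<open>x\<close> by a null sequence, on which \<phi> vanishes; the lower bound now holds
        everywhere.\<close>
      define y where "y n = max (x n) c" for n
      obtain B where B: "\<And>n. \<bar>x n\<bar> \<le> B" using x by (auto simp: bounded_iff)
      have "norm (y n) \<le> B + \<bar>c\<bar>" for n using B[of n] by (auto simp: y_def)
      then have y: "bounded (range y)" by (intro boundedI) auto
      have "(\<lambda>n. y n - x n) \<longlonglongrightarrow> 0"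
      proof (rule tendsto_eventually)
        show "\<forall>\<^sub>F n in sequentially. y n - x n = 0"
          using that by eventually_elim (simp add: y_def)
      qed
      then have "Bcontfun y - Bcontfun x \<in> S" using x y by (simp add: S_def bc)
      then have "\<phi> (Bcontfun y) = \<phi> (Bcontfun x)"
        using \<phi>(3) by (metis (no_types) eq_iff_diff_eq_0 linear_diff[OF \<phi>(1)])
      moreover have "0 \<le> \<phi> (Bcontfun y - c *\<^sub>R e)"
        using y by (intro pos) (simp add: bc e_def y_def)
      ultimately show ?thesis
        by (simp add: L_def linear_diff[OF \<phi>(1)] linear_scale[OF \<phi>(1)] e1)
    qed
  qed
  then show ?thesis by blast
qed

section \<open>Translations and the weak topology\<close>

lemma apply_Bcontfun:
  assumes "continuous_on UNIV f" "bounded (range f)"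
  shows "apply_bcontfun (Bcontfun f) = f"
  using assms by (intro Bcontfun_inverse) (simp add: bcontfun_def)

definition shift :: "'a::euclidean_space \<Rightarrow> ('a \<Rightarrow>\<^sub>C complex) \<Rightarrow> 'a \<Rightarrow>\<^sub>C complex" where
  "shift t h = Bcontfun (\<lambda>x. apply_bcontfun h (x - t))"

text \<open>The normed space structure in use is real, so multiplication by a complex scalar enters
  as a bounded real-linear operator.\<close>

definition cmul :: "complex \<Rightarrow> ('a::euclidean_space \<Rightarrow>\<^sub>C complex) \<Rightarrow> 'a \<Rightarrow>\<^sub>C complex" where
  "cmul c h = Bcontfun (\<lambda>x. c * apply_bcontfun h x)"

lemma apply_shift [simp]: "apply_bcontfun (shift t h) x = apply_bcontfun h (x - t)"
proof -
  have "bounded (range (\<lambda>x. apply_bcontfun h (x - t)))"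
    by (rule bounded_subset[OF bounded_apply_bcontfun[of h]]) auto
  moreover have "continuous_on UNIV (\<lambda>x. apply_bcontfun h (x - t))"
    by (rule continuous_on_compose2[OF continuous_on_apply_bcontfun[of UNIV h]])
      (auto intro!: continuous_intros)
  ultimately show ?thesis by (simp add: shift_def apply_Bcontfun)
qed

lemma apply_cmul [simp]: "apply_bcontfun (cmul c h) x = c * apply_bcontfun h x"
proof -
  have "norm (c * apply_bcontfun h x) \<le> norm c * norm h" for x
    using norm_bounded[of h x] by (simp add: norm_mult mult_left_mono)
  then have "bounded (range (\<lambda>x. c * apply_bcontfun h x))" by (intro boundedI) auto
  moreover have "continuous_on UNIV (\<lambda>x. c * apply_bcontfun h x)"
    by (intro continuous_intros) auto
  ultimately show ?thesis by (simp add: cmul_def apply_Bcontfun)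
qed

lemma shift_shift [simp]: "shift s (shift t h) = shift (s + t) h"
  by (rule bcontfun_eqI) (simp add: algebra_simps)

lemma shift_0 [simp]: "shift 0 h = h"
  by (rule bcontfun_eqI) simp

lemma norm_shift [simp]: "norm (shift t h) = norm h"
proof (rule antisym)
  show "norm (shift t h) \<le> norm h" for t h by (rule norm_bound) (simp add: norm_bounded)
  from this[of "- t" "shift t h"] show "norm h \<le> norm (shift t h)" by simp
qed

lemma shift_diff: "shift t (h - k) = shift t h - shift t k"
  by (rule bcontfun_eqI) simp

lemma dist_shift [simp]: "dist (shift t h) (shift t k) = dist h k"
  by (simp add: dist_norm flip: shift_diff)

lemma bounded_linear_shift: "bounded_linear (shift t)"
  by (rule bounded_linear_intro[where K=1]) (auto intro!: bcontfun_eqI)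

lemma bounded_linear_cmul: "bounded_linear (cmul c)"
proof (rule bounded_linear_intro)
  show "norm (cmul c h) \<le> norm h * norm c" for h
    by (rule norm_bound) (simp add: norm_mult norm_bounded mult.commute mult_left_mono)
qed (auto intro!: bcontfun_eqI simp: algebra_simps)

lemma translates_shift:
  assumes "is_Cu g" shows "translates g = range (\<lambda>t. shift t (Bcontfun g))"
  using assms by (auto simp: translates_def shift_def is_Cu_def apply_Bcontfun)

lemma is_Cu_apply: "apply_bcontfun (Bcontfun g) = g" if "is_Cu g"
  using that by (simp add: is_Cu_def apply_Bcontfun)

lemma is_Cu_in_Cu: "Bcontfun g \<in> Cu" if "is_Cu g"
  using that by (simp add: Cu_def is_Cu_apply is_Cu_def)

lemma Cu_is_Cu: "is_Cu (apply_bcontfun h)" if "h \<in> Cu"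
  using that by (simp add: Cu_def is_Cu_def)

lemma translates_apply: "h \<in> Cu \<Longrightarrow> translates (apply_bcontfun h) = range (\<lambda>t. shift t h)"
  by (simp add: translates_shift Cu_is_Cu apply_bcontfun_inverse)

lemma uniformly_continuous_on_translate:
  fixes g :: "'a::real_normed_vector \<Rightarrow> 'b::metric_space"
  assumes "uniformly_continuous_on UNIV g"
  shows "uniformly_continuous_on UNIV (\<lambda>x. g (x + t))"
  using assms unfolding uniformly_continuous_on_def by (metis UNIV_I dist_add_cancel2)

lemma Cu_shift: "h \<in> Cu \<Longrightarrow> shift t h \<in> Cu"
  using uniformly_continuous_on_translate[of "apply_bcontfun h" "- t"]
  by (simp add: Cu_def apply_shift[abs_def])

lemma subspace_Cu: "subspace Cu"
  by (auto simp: Cu_def intro!: subspaceI uniformly_continuous_on_add uniformly_continuous_on_cmul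
      uniformly_continuous_on_const)

lemma Cu_cmul: "h \<in> Cu \<Longrightarrow> cmul c h \<in> Cu"
  using bounded_linear.uniformly_continuous_on[OF bounded_linear_mult_right, of UNIV "apply_bcontfun h" c]
  by (simp add: Cu_def apply_cmul[abs_def])

lemma closed_Cu: "closed Cu"
proof (unfold closed_sequential_limits, safe)
  fix f and l :: "'a \<Rightarrow>\<^sub>C complex"
  assume f: "\<forall>n. f n \<in> Cu" "f \<longlonglongrightarrow> l"
  have "uniformly_continuous_on UNIV (apply_bcontfun l)"
    unfolding uniformly_continuous_on_def
  proof (intro allI impI)
    fix e :: real assume e: "e > 0"
    then obtain n where n: "dist (f n) l < e / 3"
      using metric_LIMSEQ_D[OF f(2), of "e / 3"] by auto
    have "uniformly_continuous_on UNIV (apply_bcontfun (f n))" using f(1) by (simp add: Cu_def)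
    then obtain d where d: "d > 0" "\<And>x y. dist y x < d \<Longrightarrow> dist (apply_bcontfun (f n) y) (apply_bcontfun (f n) x) < e / 3"
      using e unfolding uniformly_continuous_on_def by (metis UNIV_I divide_pos_pos zero_less_numeral)
    have "dist (apply_bcontfun l y) (apply_bcontfun l x) < e" if "dist y x < d" for x y
    proof -
      have "dist (apply_bcontfun l y) (apply_bcontfun l x) \<le> dist (apply_bcontfun l y) (apply_bcontfun (f n) y)
        + (dist (apply_bcontfun (f n) y) (apply_bcontfun (f n) x) + dist (apply_bcontfun (f n) x) (apply_bcontfun l x))"
        by (rule order_trans[OF dist_triangle add_left_mono[OF dist_triangle]])
      moreover have "dist (apply_bcontfun l y) (apply_bcontfun (f n) y) < e / 3"
        "dist (apply_bcontfun (f n) x) (apply_bcontfun l x) < e / 3"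
        using dist_fun_lt_imp_dist_val_lt[OF n] by (simp_all add: dist_commute)
      ultimately show ?thesis using d(2)[OF that] by linarith
    qed
    then show "\<exists>d>0. \<forall>x\<in>UNIV. \<forall>x'\<in>UNIV. dist x' x < d \<longrightarrow> dist (apply_bcontfun l x') (apply_bcontfun l x) < e"
      using d(1) by blast
  qed
  then show "l \<in> Cu" by (simp add: Cu_def)
qed

lemma is_Cu_add: "is_Cu f \<Longrightarrow> is_Cu g \<Longrightarrow> is_Cu (\<lambda>x. f x + g x)"
  by (auto simp: is_Cu_def intro!: continuous_intros bounded_plus_comp uniformly_continuous_on_add)

lemma is_Cu_cmul: "is_Cu f \<Longrightarrow> is_Cu (\<lambda>x. c * f x)"
  using Cu_is_Cu[OF Cu_cmul[OF is_Cu_in_Cu, of f c]]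
  by (simp add: is_Cu_apply apply_cmul[abs_def])

lemma Bcontfun_add: "is_Cu f \<Longrightarrow> is_Cu g \<Longrightarrow> Bcontfun (\<lambda>x. f x + g x) = Bcontfun f + Bcontfun g"
  using is_Cu_add[of f g] by (intro bcontfun_eqI) (simp add: is_Cu_apply)

lemma Bcontfun_cmul: "is_Cu f \<Longrightarrow> Bcontfun (\<lambda>x. c * f x) = cmul c (Bcontfun f)"
  using is_Cu_cmul[of f c] by (intro bcontfun_eqI) (simp add: is_Cu_apply)

section \<open>The weak topology and characterisations of almost periodicity by compact sets\<close>

lemma topspace_weak_top [simp]: "topspace weak_top = UNIV"
proof -
  have "UNIV \<in> {{h. \<phi> h \<in> U} | (\<phi> :: ('a \<Rightarrow>\<^sub>C complex) \<Rightarrow> real) U. bounded_linear \<phi> \<and> open U}"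
    by (rule CollectI, rule exI[of _ "\<lambda>_. 0"], rule exI[of _ UNIV]) (auto intro: bounded_linear_zero)
  then show ?thesis by (auto simp: weak_top_def)
qed

lemma continuous_map_weak_functional:
  assumes "bounded_linear \<phi>" shows "continuous_map weak_top euclideanreal \<phi>"
proof -
  have "openin weak_top {h. \<phi> h \<in> U}" if "open U" for U
    unfolding weak_top_def using assms that by (intro topology_generated_by_Basis) blast
  then show ?thesis by (simp add: continuous_map)
qed

text \<open>The universal property of an initial topology: only preimages of the generating sets
  have to be open. Continuity of linear maps, of addition and of the identity from the norm topology
  all reduce to it.\<close>

lemma continuous_map_into_weak:
  assumes "\<And>\<phi> :: ('a::euclidean_space \<Rightarrow>\<^sub>C complex) \<Rightarrow> real. bounded_linear \<phi>
    \<Longrightarrow> continuous_map T euclideanreal (\<lambda>z. \<phi> (f z))"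
  shows "continuous_map T weak_top f"
  unfolding weak_top_def
proof (rule continuous_on_generated_topo)
  fix W assume "W \<in> {{h. \<phi> h \<in> U} | (\<phi> :: ('a \<Rightarrow>\<^sub>C complex) \<Rightarrow> real) U. bounded_linear \<phi> \<and> open U}"
  then obtain \<phi> :: "('a \<Rightarrow>\<^sub>C complex) \<Rightarrow> real" and U
    where W: "W = {h. \<phi> h \<in> U}" "bounded_linear \<phi>" "open U" by blast
  then show "openin T (f -` W \<inter> topspace T)"
    using openin_continuous_map_preimage[OF assms[OF W(2)], of U]
    by (simp add: vimage_def Int_def conj_commute)
next
  show "f ` topspace T \<subseteq> \<Union> {{h. \<phi> h \<in> U} | (\<phi> :: ('a \<Rightarrow>\<^sub>C complex) \<Rightarrow> real) U.
      bounded_linear \<phi> \<and> open U}"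
    using topspace_weak_top[where 'a='a] unfolding weak_top_def by simp
qed

lemma continuous_map_weak_linear:
  "bounded_linear f \<Longrightarrow> continuous_map weak_top weak_top f"
  by (intro continuous_map_into_weak continuous_map_weak_functional)
    (rule bounded_linear_compose)

lemma continuous_map_weak_add:
  "continuous_map (prod_topology weak_top weak_top) weak_top (\<lambda>z. fst z + snd z)"
proof (rule continuous_map_into_weak)
  fix \<phi> :: "('a \<Rightarrow>\<^sub>C complex) \<Rightarrow> real" assume \<phi>: "bounded_linear \<phi>"
  note c = continuous_map_weak_functional[OF \<phi>]
  have "continuous_map (prod_topology weak_top weak_top) euclideanreal (\<lambda>z. \<phi> (fst z) + \<phi> (snd z))"
    using continuous_map_compose[OF continuous_map_fst c] continuous_map_compose[OF continuous_map_snd c]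
    by (intro continuous_map_add) (simp_all add: o_def)
  then show "continuous_map (prod_topology weak_top weak_top) euclideanreal (\<lambda>z. \<phi> (fst z + snd z))"
    by (simp add: linear_add[OF bounded_linear.linear[OF \<phi>]])
qed

lemma continuous_map_norm_weak: "continuous_map euclidean weak_top (\<lambda>h. h)"
  by (intro continuous_map_into_weak)
    (simp add: linear_continuous_on)

lemma bounded_linear_apply: "bounded_linear (\<lambda>h :: 'a::euclidean_space \<Rightarrow>\<^sub>C complex. apply_bcontfun h x)"
  by (rule bounded_linear_intro[where K=1]) (auto simp: norm_bounded)

text \<open>Evaluation is complex valued, while the topology is generated by real functionals; real
  and imaginary part are such functionals.\<close>

lemma continuous_map_weak_apply: "continuous_map weak_top euclidean (\<lambda>h. apply_bcontfun h x)"
proof -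
  have re: "continuous_map weak_top euclideanreal (\<lambda>h. Re (apply_bcontfun h x))"
    and im: "continuous_map weak_top euclideanreal (\<lambda>h. Im (apply_bcontfun h x))"
    by (intro continuous_map_weak_functional bounded_linear_compose[OF bounded_linear_Re bounded_linear_apply]
        bounded_linear_compose[OF bounded_linear_Im bounded_linear_apply])+
  have c: "continuous_map euclideanreal euclidean (\<lambda>r. complex_of_real r)"
    "continuous_map euclideanreal euclidean (\<lambda>r. \<i> * complex_of_real r)"
    by (auto intro!: continuous_intros)
  have "continuous_map weak_top euclidean
      (\<lambda>h. of_real (Re (apply_bcontfun h x)) + \<i> * of_real (Im (apply_bcontfun h x)))"
    using continuous_map_add[OF continuous_map_compose[OF re c(1)] continuous_map_compose[OF im c(2)]]
    by (simp add: o_def)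
  then show ?thesis by (simp flip: complex_eq)
qed

text \<open>Evaluations are weakly continuous and separate functions, which embeds the space
  injectively into a Hausdorff product.\<close>

lemma Hausdorff_weak_top: "Hausdorff_space weak_top"
proof (rule Hausdorff_space_injective_preimage)
  show "Hausdorff_space (euclidean :: ('a \<Rightarrow> complex) topology)"
    unfolding euclidean_product_topology[symmetric] by (simp add: Hausdorff_space_product_topology)
  show "continuous_map weak_top euclidean (apply_bcontfun :: ('a \<Rightarrow>\<^sub>C complex) \<Rightarrow> _)"
    unfolding euclidean_product_topology[symmetric] continuous_map_componentwise_UNIV
    using continuous_map_weak_apply by blast
  show "inj_on (apply_bcontfun :: ('a \<Rightarrow>\<^sub>C complex) \<Rightarrow> _) (topspace weak_top)"
    by (simp add: inj_on_def apply_bcontfun_inject)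
qed

lemma closedin_weak_imp_closed: "closedin weak_top K \<Longrightarrow> closed K"
  using closedin_continuous_map_preimage[OF continuous_map_norm_weak] by simp

text \<open>A ball of the supremum norm is an intersection of conditions on single values, so it is
  closed already for pointwise convergence. Such balls are the closed pieces in the Baire argument
  and carry norm bounds over to weak closures.\<close>

lemma closedin_weak_cball: "closedin weak_top (cball h r)"
proof -
  have "cball h r = (\<Inter>x. {k. apply_bcontfun k x \<in> cball (apply_bcontfun h x) r})"
    by (auto intro!: dist_bound intro: order_trans[OF dist_bounded])
  moreover have "closedin weak_top {k. apply_bcontfun k x \<in> cball (apply_bcontfun h x) r}" for x
    using closedin_continuous_map_preimage[OF continuous_map_weak_apply, of "cball (apply_bcontfun h x) r" x]
    by simp
  ultimately show ?thesis by (simp only:) (rule closedin_INT, auto)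
qed

lemma compactin_weak_imp_closedin: "compactin weak_top X \<Longrightarrow> closedin weak_top X"
  by (rule compactin_imp_closedin[OF Hausdorff_weak_top])

text \<open>Weakly compact sets are weakly closed by the Hausdorff property, so any compact witness
  inside \<open>Cu\<close> traps the orbit closure. In this form, stability under sums and multiples
  only needs continuous images of compact sets.\<close>

lemma WAP_iff:
  "WAP g \<longleftrightarrow> is_Cu g \<and> (\<exists>X. compactin weak_top X \<and> X \<subseteq> Cu \<and> translates g \<subseteq> X)"
proof (cases "is_Cu g")
  case True
  define X where "X = subtopology weak_top Cu closure_of translates g"
  have tr: "translates g \<subseteq> Cu"
    using True by (auto simp: translates_shift intro: Cu_shift is_Cu_in_Cu)
  then have sub: "translates g \<subseteq> X"
    unfolding X_def by (intro closure_of_subset) simp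
  have "compactin (subtopology weak_top Cu) X"
    if Y: "compactin weak_top Y" "Y \<subseteq> Cu" "translates g \<subseteq> Y" for Y
  proof (rule closed_compactin)
    show "compactin (subtopology weak_top Cu) Y" using Y by (simp add: compactin_subtopology)
    have "closedin (subtopology weak_top Cu) Y"
      using compactin_weak_imp_closedin[OF Y(1)] Y(2) by (rule closedin_subset_topspace)
    then show "X \<subseteq> Y" unfolding X_def using Y(3) by (rule closure_of_minimal[rotated])
    show "closedin (subtopology weak_top Cu) X" by (simp add: X_def)
  qed
  then have "compactin weak_top X \<and> X \<subseteq> Cu"
    if "\<exists>Y. compactin weak_top Y \<and> Y \<subseteq> Cu \<and> translates g \<subseteq> Y"
    using that unfolding compactin_subtopology by blast
  moreover have "WAP g \<longleftrightarrow> compactin weak_top X \<and> X \<subseteq> Cu"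
    using True by (simp add: WAP_def X_def compactin_subtopology)
  ultimately show ?thesis using True sub by blast
qed (simp add: WAP_def)

lemma SAP_iff:
  "SAP g \<longleftrightarrow> is_Cu g \<and> (\<exists>X. compact X \<and> translates g \<subseteq> X)"
proof -
  have "compact (closure A)" if "compact X" "A \<subseteq> X" for A X :: "('a \<Rightarrow>\<^sub>C complex) set"
  proof -
    have "closure A \<subseteq> X" by (rule closure_minimal[OF that(2) compact_imp_closed[OF that(1)]])
    then show ?thesis using compact_Int_closed[OF that(1) closed_closure, of A] by (simp add: Int_absorb1)
  qed
  then show ?thesis unfolding SAP_def using closure_subset by blast
qed

text \<open>The identity from the norm to the weak topology is continuous and so maps the compact
  orbit closure to a compact set; it stays in \<open>Cu\<close> because \<open>Cu\<close> is norm
  closed.\<close>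

lemma SAP_imp_WAP: assumes "SAP g" shows "WAP g"
proof -
  have g: "is_Cu g" "compact (closure (translates g))" using assms by (auto simp: SAP_def)
  have "closure (translates g) \<subseteq> Cu"
    using g by (intro closure_minimal closed_Cu) (auto simp: translates_shift intro: Cu_shift is_Cu_in_Cu)
  moreover have "compactin weak_top (closure (translates g))"
    using image_compactin[OF _ continuous_map_norm_weak, of "closure (translates g)"] g(2) by simp
  ultimately show ?thesis using g(1) closure_subset by (auto simp: WAP_iff)
qed

lemma WAP_add: assumes "WAP f" "WAP g" shows "WAP (\<lambda>x. f x + g x)"
proof -
  obtain X Y where X: "compactin weak_top X" "X \<subseteq> Cu" "translates f \<subseteq> X"
    and Y: "compactin weak_top Y" "Y \<subseteq> Cu" "translates g \<subseteq> Y"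
    using assms by (auto simp: WAP_iff)
  have cu: "is_Cu f" "is_Cu g" using assms by (auto simp: WAP_iff)
  let ?Z = "(\<lambda>z. fst z + snd z) ` (X \<times> Y)"
  have "compactin weak_top ?Z"
    using X Y by (intro image_compactin[OF _ continuous_map_weak_add]) (simp add: compactin_Times)
  moreover have "?Z \<subseteq> Cu" using X(2) Y(2) by (auto intro!: subspace_add[OF subspace_Cu])
  moreover have "translates (\<lambda>x. f x + g x) \<subseteq> ?Z"
  proof -
    have "shift t (Bcontfun f + Bcontfun g) \<in> ?Z" for t
    proof -
      have "shift t (Bcontfun f) \<in> X" "shift t (Bcontfun g) \<in> Y"
        using X(3) Y(3) cu by (auto simp: translates_shift)
      then show ?thesis
        by (auto simp: linear_add[OF bounded_linear.linear[OF bounded_linear_shift]] intro!: rev_image_eqI)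
    qed
    then show ?thesis using cu by (auto simp: translates_shift is_Cu_add Bcontfun_add)
  qed
  ultimately show ?thesis using cu by (auto simp: WAP_iff is_Cu_add)
qed

lemma translates_cmul: "is_Cu f \<Longrightarrow> translates (\<lambda>x. c * f x) = cmul c ` translates f"
  by (auto simp: translates_shift is_Cu_cmul Bcontfun_cmul image_image
      intro!: image_cong arg_cong[where f=range] ext bcontfun_eqI)

lemma WAP_cmul: assumes "WAP f" shows "WAP (\<lambda>x. c * f x)"
proof -
  obtain X where X: "compactin weak_top X" "X \<subseteq> Cu" "translates f \<subseteq> X" and cu: "is_Cu f"
    using assms by (auto simp: WAP_iff)
  have "compactin weak_top (cmul c ` X)"
    by (intro image_compactin[OF X(1)] continuous_map_weak_linear bounded_linear_cmul)
  moreover have "cmul c ` X \<subseteq> Cu" using X Cu_cmul by auto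
  moreover have "translates (\<lambda>x. c * f x) \<subseteq> cmul c ` X"
    using X(3) by (auto simp: translates_cmul cu)
  ultimately show ?thesis using cu by (auto simp: WAP_iff is_Cu_cmul)
qed

lemma SAP_add: assumes "SAP f" "SAP g" shows "SAP (\<lambda>x. f x + g x)"
proof -
  obtain X Y where X: "compact X" "translates f \<subseteq> X"
    and Y: "compact Y" "translates g \<subseteq> Y"
    using assms by (auto simp: SAP_iff)
  have cu: "is_Cu f" "is_Cu g" using assms by (auto simp: SAP_iff)
  have "translates (\<lambda>x. f x + g x) \<subseteq> {x + y |x y. x \<in> X \<and> y \<in> Y}"
    using X(2) Y(2) cu
    by (auto simp: translates_shift is_Cu_add Bcontfun_add
        linear_add[OF bounded_linear.linear[OF bounded_linear_shift]] image_subset_iff)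
  then show ?thesis using cu compact_sums[OF X(1) Y(1)] by (auto simp: SAP_iff is_Cu_add)
qed

lemma SAP_cmul: assumes "SAP f" shows "SAP (\<lambda>x. c * f x)"
proof -
  obtain X where X: "compact X" "translates f \<subseteq> X" and cu: "is_Cu f"
    using assms by (auto simp: SAP_iff)
  have "compact (cmul c ` X)"
    by (intro compact_continuous_image[OF _ X(1)] linear_continuous_on bounded_linear_cmul)
  moreover have "translates (\<lambda>x. c * f x) \<subseteq> cmul c ` X"
    using X(2) by (auto simp: translates_cmul cu)
  ultimately show ?thesis using cu by (auto simp: SAP_iff is_Cu_cmul)
qed

lemma is_Cu_translate:
  assumes "is_Cu g" shows "is_Cu (\<lambda>x. g (x + t))"
proof -
  have "bounded (range (\<lambda>x. g (x + t)))"
    using assms by (auto simp: is_Cu_def intro: bounded_subset[of "range g"])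
  then show ?thesis
    using assms uniformly_continuous_on_translate[of g t] uniformly_continuous_imp_continuous
    by (auto simp: is_Cu_def)
qed

lemma translates_translate:
  assumes "is_Cu g" shows "translates (\<lambda>x. g (x + t)) = translates g"
proof -
  have "shift s (Bcontfun (\<lambda>x. g (x + t))) = shift (s - t) (Bcontfun g)" for s
    using assms by (intro bcontfun_eqI) (simp add: is_Cu_apply is_Cu_translate algebra_simps)
  moreover have "range (\<lambda>s. shift (s - t) (Bcontfun g)) = range (\<lambda>s. shift s (Bcontfun g))"
    by (auto intro: range_eqI[where x = "_ + t"])
  ultimately show ?thesis using assms by (simp add: translates_shift is_Cu_translate)
qed

lemma WAP_translate: "WAP g \<Longrightarrow> WAP (\<lambda>x. g (x + t))"
  by (simp add: WAP_iff is_Cu_translate translates_translate)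

lemma SAP_translate: "SAP g \<Longrightarrow> SAP (\<lambda>x. g (x + t))"
  by (simp add: SAP_iff is_Cu_translate translates_translate)

section \<open>Averages over balls\<close>

definition bcont :: "('a::euclidean_space \<Rightarrow> real) \<Rightarrow> bool" where
  "bcont u \<longleftrightarrow> continuous_on UNIV u \<and> bounded (range u)"

definition avg :: "real \<Rightarrow> ('a::euclidean_space \<Rightarrow> real) \<Rightarrow> real" where
  "avg R u = integral (ball 0 R) u / measure lebesgue (ball (0 :: 'a) R)"

lemma bcontI: "continuous_on UNIV u \<Longrightarrow> (\<And>x. \<bar>u x\<bar> \<le> C) \<Longrightarrow> bcont u"
  unfolding bcont_def by (intro conjI boundedI[of _ C]) auto

lemma bcont_continuous: "bcont u \<Longrightarrow> continuous_on UNIV u"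
  by (simp add: bcont_def)

lemma bcontE: assumes "bcont u" obtains C where "0 \<le> C" "\<And>x. \<bar>u x\<bar> \<le> C"
proof -
  obtain C where "\<forall>x. \<bar>u x\<bar> \<le> C" using assms by (auto simp: bcont_def bounded_iff)
  then show thesis using that[of C] by (meson abs_ge_zero order_trans)
qed

lemma bcont_const: "bcont (\<lambda>x. c)"
  by (rule bcontI[of _ "\<bar>c\<bar>"]) auto

lemma bcont_add: "bcont u \<Longrightarrow> bcont v \<Longrightarrow> bcont (\<lambda>x. u x + v x)"
  by (auto simp: bcont_def intro!: continuous_intros bounded_plus_comp)

lemma bcont_mult: assumes "bcont u" "bcont v" shows "bcont (\<lambda>x. u x * v x)"
proof -
  obtain C D where C: "0 \<le> C" "\<And>x. \<bar>u x\<bar> \<le> C" and D: "0 \<le> D" "\<And>x. \<bar>v x\<bar> \<le> D"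
    using bcontE[OF assms(1)] bcontE[OF assms(2)] by metis
  show ?thesis
  proof (rule bcontI)
    show "continuous_on UNIV (\<lambda>x. u x * v x)"
      using assms by (intro continuous_intros bcont_continuous)
    show "\<bar>u x * v x\<bar> \<le> C * D" for x
      using C D by (simp add: abs_mult mult_mono)
  qed
qed

lemma bcont_cmul: "bcont u \<Longrightarrow> bcont (\<lambda>x. c * u x)"
  by (intro bcont_mult bcont_const)

lemma bcont_max: assumes "bcont u" shows "bcont (\<lambda>x. max (u x) c)"
proof -
  obtain C where "0 \<le> C" "\<And>x. \<bar>u x\<bar> \<le> C" using assms bcontE by blast
  then have "\<bar>max (u x) c\<bar> \<le> C + \<bar>c\<bar>" for x
    using \<open>\<And>x. \<bar>u x\<bar> \<le> C\<close>[of x] \<open>0 \<le> C\<close> by linarith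
  moreover have "continuous_on UNIV (\<lambda>x. max (u x) c)"
    by (intro continuous_intros bcont_continuous assms)
  ultimately show ?thesis by (intro bcontI[of _ "C + \<bar>c\<bar>"])
qed

lemma bcont_shift: assumes "bcont u" shows "bcont (\<lambda>x. u (x - t))"
proof -
  have "bounded (range (\<lambda>x. u (x - t)))"
    using assms by (auto simp: bcont_def intro: bounded_subset[of "range u"])
  moreover have "continuous_on UNIV (\<lambda>x. u (x - t))"
    by (rule continuous_on_compose2[OF bcont_continuous[OF assms]]) (auto intro!: continuous_intros)
  ultimately show ?thesis by (simp add: bcont_def)
qed

lemma bcont_sum: "finite A \<Longrightarrow> (\<And>i. i \<in> A \<Longrightarrow> bcont (u i)) \<Longrightarrow> bcont (\<lambda>x. \<Sum>i\<in>A. u i x)"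
  by (induction A rule: finite_induct) (auto intro: bcont_const bcont_add)

lemma bcont_prod: "finite A \<Longrightarrow> (\<And>i. i \<in> A \<Longrightarrow> bcont (u i)) \<Longrightarrow> bcont (\<lambda>x. \<Prod>i\<in>A. u i x)"
  by (induction A rule: finite_induct) (auto intro: bcont_const bcont_mult)

lemma bcont_norm: "is_Cu g \<Longrightarrow> bcont (\<lambda>x. norm (g x))"
  by (auto simp: is_Cu_def bcont_def bounded_norm_comp intro!: continuous_intros)

lemma bcont_set_integrable:
  assumes "bcont u" shows "set_integrable lborel (ball a R) u"
proof -
  obtain C where "\<And>x. \<bar>u x\<bar> \<le> C" using assms bcontE by blast
  then show ?thesis unfolding set_integrable_def
    using borel_measurable_continuous_onI[OF bcont_continuous[OF assms]]
    by (intro integrableI_bounded_set_indicator[where B=C]) (auto simp flip: infinity_ennreal_def intro: emeasure_bounded_finite)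
qed

lemma bcont_integrable: "bcont u \<Longrightarrow> u integrable_on ball a R"
  by (rule set_borel_integral_eq_integral(1)[OF bcont_set_integrable])

text \<open>Translation invariance is taken from the Borel measure \<open>lborel\<close>, so the
  integral over the ball is moved there and back; \<open>bcont\<close> ensures integrability on
  balls throughout.\<close>

lemma integral_ball_shift:
  fixes u :: "'a::euclidean_space \<Rightarrow> real"
  assumes "bcont u"
  shows "integral (ball 0 R) (\<lambda>x. u (x - t)) = integral (ball (- t) R) u"
proof -
  have u: "u \<in> borel_measurable borel"
    by (intro borel_measurable_continuous_onI bcont_continuous assms)
  have "integral (ball 0 R) (\<lambda>x. u (x - t)) = (LINT x:ball 0 R|lborel. u (x - t))"
    using set_borel_integral_eq_integral(2)[OF bcont_set_integrable[OF bcont_shift[OF assms]]] by simp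
  also have "\<dots> = (LINT x|distr lborel borel ((+) t). indicator (ball 0 R) x *\<^sub>R u (x - t))"
    by (simp add: set_lebesgue_integral_def lborel_distr_plus)
  also have "\<dots> = (LINT x|lborel. indicator (ball 0 R) (t + x) *\<^sub>R u (t + x - t))"
  proof (rule integral_distr)
    have "(\<lambda>x. u (x - t)) \<in> borel_measurable borel"
      by (intro borel_measurable_continuous_onI bcont_continuous bcont_shift assms)
    then show "(\<lambda>x. indicator (ball 0 R) x *\<^sub>R u (x - t)) \<in> borel_measurable borel"
      by (intro borel_measurable_scaleR borel_measurable_indicator) auto
  qed simp
  also have "\<dots> = (LINT x:ball (- t) R|lborel. u x)"
    unfolding set_lebesgue_integral_def
    by (intro Bochner_Integration.integral_cong) (auto simp: indicator_def dist_norm algebra_simps norm_minus_commute)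
  also have "\<dots> = integral (ball (- t) R) u"
    by (rule set_borel_integral_eq_integral(2)[OF bcont_set_integrable[OF assms]])
  finally show ?thesis .
qed

lemma integral_ball_const:
  "integral (ball (a :: 'a::euclidean_space) R) (\<lambda>x. c :: real) = c * measure lebesgue (ball a R)"
proof -
  have "integral (ball a R) (\<lambda>x. c * 1) = c * integral (ball a R) (\<lambda>x. 1)"
    by (rule integral_mult_right)
  then show ?thesis using lmeasure_integral[of "ball a R"] by simp
qed

lemma measure_ball: "0 \<le> R \<Longrightarrow> measure lebesgue (ball (a :: 'a::euclidean_space) R)
    = unit_ball_vol (DIM('a)) * R ^ DIM('a)"
  using content_ball[of R a] by (simp add: measure_completion)

lemma measure_ball_pos: "0 < R \<Longrightarrow> 0 < measure lebesgue (ball (a :: 'a::euclidean_space) R)"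
  by (simp add: measure_ball)

lemma avg_add: "bcont u \<Longrightarrow> bcont v \<Longrightarrow> avg R (\<lambda>x. u x + v x) = avg R u + avg R v"
  by (simp add: avg_def integral_add bcont_integrable add_divide_distrib)

lemma avg_cmul: "avg R (\<lambda>x. c * u x) = c * avg R u"
  by (simp add: avg_def)

lemma avg_const: assumes "0 < R" shows "avg R (\<lambda>x :: 'a::euclidean_space. c) = c"
  using measure_ball_pos[OF assms, of "0 :: 'a"] by (simp add: avg_def integral_ball_const)

lemma avg_mono: "bcont u \<Longrightarrow> bcont v \<Longrightarrow> (\<And>x. u x \<le> v x) \<Longrightarrow> avg R u \<le> avg R v"
  by (auto simp: avg_def intro!: divide_right_mono integral_le bcont_integrable)

lemma avg_nonneg: "bcont u \<Longrightarrow> (\<And>x. 0 \<le> u x) \<Longrightarrow> 0 \<le> avg R u"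
  by (auto simp: avg_def intro!: divide_nonneg_nonneg integral_nonneg bcont_integrable)

lemma avg_sum: "finite A \<Longrightarrow> (\<And>i. i \<in> A \<Longrightarrow> bcont (u i)) \<Longrightarrow> avg R (\<lambda>x. \<Sum>i\<in>A. u i x) = (\<Sum>i\<in>A. avg R (u i))"
proof (induction A rule: finite_induct)
  case empty
  then show ?case by (simp add: avg_def)
qed (simp add: avg_add bcont_sum)

lemma avg_abs_le:
  fixes u :: "'a::euclidean_space \<Rightarrow> real"
  assumes "bcont u" "\<And>x. \<bar>u x\<bar> \<le> C" "0 < R" shows "\<bar>avg R u\<bar> \<le> C"
proof -
  have "u x \<le> C" "- C \<le> u x" for x using assms(2)[of x] by auto
  then have "avg R u \<le> avg R (\<lambda>x :: 'a. C)" "avg R (\<lambda>x :: 'a. - C) \<le> avg R u"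
    by (auto intro!: avg_mono assms(1) bcont_const)
  then show ?thesis by (simp add: avg_const assms(3))
qed

text \<open>The translated ball lies in the concentric ball of radius \<open>R + norm t\<close>. The
  extra shell contributes at most \<open>C\<close> times its volume, and its volume relative to the
  ball is the bracket, which vanishes as \<open>R\<close> grows with \<open>t\<close> fixed.\<close>

lemma avg_shift_le:
  fixes u :: "'a::euclidean_space \<Rightarrow> real"
  assumes u: "bcont u" "\<And>x. 0 \<le> u x" "\<And>x. u x \<le> C" and R: "0 < R"
  shows "avg R (\<lambda>x. u (x - t)) \<le> avg R u + C * ((1 + norm t / R) ^ DIM('a) - 1)"
proof -
  let ?n = "DIM('a)" and ?V = "\<lambda>R. measure lebesgue (ball (0 :: 'a) R)"
  let ?S = "R + norm t"
  have int: "v integrable_on ball a r" if "bcont v" for v :: "'a \<Rightarrow> real" and a r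
    using that by (rule bcont_integrable)
  have "integral (ball 0 R) (\<lambda>x. u (x - t)) = integral (ball (- t) R) u"
    by (rule integral_ball_shift[OF u(1)])
  also have "\<dots> \<le> integral (ball 0 ?S) u"
  proof (rule integral_subset_le)
    show "ball (- t) R \<subseteq> ball 0 ?S"
    proof
      fix x assume "x \<in> ball (- t) R"
      then have "norm (- t - x) < R" by (simp add: dist_norm)
      moreover have "norm x \<le> norm (- t - x) + norm t"
        using norm_triangle_ineq4[of "- t - x" "- t"] by simp
      ultimately show "x \<in> ball 0 ?S" by simp
    qed
  qed (use u int in auto)
  also have "\<dots> \<le> integral (ball 0 R) u + C * (?V ?S - ?V R)"
  proof -
    \<comment> \<open>Monotonicity of the integral of \<open>C - u >= 0\<close> in the domain bounds
      the integral of \<open>u\<close> over the shell from above.\<close>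
    have Cu: "bcont (\<lambda>x. C - u x)"
      using bcont_add[OF bcont_const[of C] bcont_cmul[OF u(1), of "-1"]] by simp
    have eq: "integral (ball 0 r) (\<lambda>x. C - u x) = C * ?V r - integral (ball 0 r) u" for r
      using integral_diff[OF int[OF bcont_const[of C]] int[OF u(1)], of 0 r]
      by (simp add: integral_ball_const)
    have "integral (ball 0 R) (\<lambda>x. C - u x) \<le> integral (ball 0 ?S) (\<lambda>x. C - u x)"
    proof (rule integral_subset_le)
      show "ball (0 :: 'a) R \<subseteq> ball 0 ?S" by (rule subset_ball) simp
    qed (use u(3) int Cu in auto)
    then show ?thesis by (simp add: eq algebra_simps)
  qed
  finally have "avg R (\<lambda>x. u (x - t)) \<le> (integral (ball 0 R) u + C * (?V ?S - ?V R)) / ?V R"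
    using measure_ball_pos[OF R, of "0 :: 'a"] by (simp add: avg_def divide_right_mono)
  also have "\<dots> = avg R u + C * (?V ?S / ?V R - 1)"
    using measure_ball_pos[OF R, of "0 :: 'a"] by (simp add: avg_def field_simps)
  also have "?V ?S / ?V R = (1 + norm t / R) ^ ?n"
  proof -
    have "?V ?S / ?V R = (?S / R) ^ ?n"
    proof -
      have "unit_ball_vol (real ?n) \<noteq> 0" using unit_ball_vol_pos[of "real ?n"] by linarith
      then show ?thesis using R by (simp add: content_ball power_divide)
    qed
    also have "?S / R = 1 + norm t / R" using R by (simp add: field_simps)
    finally show ?thesis .
  qed
  finally show ?thesis .
qed

lemma shift_error_tendsto: "((\<lambda>R. C * ((1 + norm t / R) ^ n - 1)) \<longlongrightarrow> (0 :: real)) at_top"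
proof -
  have "((\<lambda>R. C * ((1 + norm t / R) ^ n - 1)) \<longlongrightarrow> C * ((1 + 0) ^ n - 1)) at_top"
    by (intro tendsto_intros tendsto_divide_0[OF tendsto_const] filterlim_at_top_imp_at_infinity filterlim_ident)
  then show ?thesis by simp
qed

lemma avg_shift_tendsto_0:
  fixes u :: "'a::euclidean_space \<Rightarrow> real"
  assumes u: "bcont u" "\<And>x. 0 \<le> u x" and lim: "((\<lambda>R. avg R u) \<longlongrightarrow> 0) at_top"
  shows "((\<lambda>R. avg R (\<lambda>x. u (x - t))) \<longlongrightarrow> 0) at_top"
proof -
  obtain C where C: "\<And>x. \<bar>u x\<bar> \<le> C" using u(1) bcontE by blast
  show ?thesis
  proof (rule tendsto_sandwich[where f="\<lambda>_. 0"])
    show "((\<lambda>R. avg R u + C * ((1 + norm t / R) ^ DIM('a) - 1)) \<longlongrightarrow> 0) at_top"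
      using tendsto_add[OF lim shift_error_tendsto] by simp
    show "\<forall>\<^sub>F R in at_top. avg R (\<lambda>x. u (x - t)) \<le> avg R u + C * ((1 + norm t / R) ^ DIM('a) - 1)"
      using eventually_gt_at_top[of "0::real"]
    proof eventually_elim
      case (elim R)
      show ?case using C by (intro avg_shift_le u elim) (auto simp: abs_le_iff)
    qed
    show "\<forall>\<^sub>F R in at_top. 0 \<le> avg R (\<lambda>x. u (x - t))"
      using u(2) by (auto intro: always_eventually avg_nonneg bcont_shift u)
  qed simp
qed

lemma avg_tendsto_0_le:
  assumes "bcont u" "bcont v" "\<And>x. 0 \<le> u x" "\<And>x. u x \<le> v x" "((\<lambda>R. avg R v) \<longlongrightarrow> 0) at_top"
  shows "((\<lambda>R. avg R u) \<longlongrightarrow> 0) at_top"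
  using assms by (intro tendsto_sandwich[OF _ _ tendsto_const assms(5)] always_eventually allI)
    (auto intro: avg_nonneg avg_mono)

section \<open>Null weakly almost periodic functions and uniqueness of the decomposition\<close>

lemma WAP0_iff: "WAP0 g \<longleftrightarrow> WAP g \<and> ((\<lambda>R. avg R (\<lambda>x. norm (g x))) \<longlongrightarrow> 0) at_top"
  by (simp add: WAP0_def avg_def)

lemma WAP_is_Cu: "WAP g \<Longrightarrow> is_Cu g" by (simp add: WAP_def)

lemma WAP0_add: assumes "WAP0 f" "WAP0 g" shows "WAP0 (\<lambda>x. f x + g x)"
proof -
  have fg: "WAP f" "WAP g" and lim: "((\<lambda>R. avg R (\<lambda>x. norm (f x))) \<longlongrightarrow> 0) at_top"
    "((\<lambda>R. avg R (\<lambda>x. norm (g x))) \<longlongrightarrow> 0) at_top"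
    using assms by (auto simp: WAP0_iff)
  have b: "bcont (\<lambda>x. norm (f x))" "bcont (\<lambda>x. norm (g x))" "bcont (\<lambda>x. norm (f x + g x))"
    using fg by (auto intro!: bcont_norm WAP_is_Cu WAP_add)
  have "((\<lambda>R. avg R (\<lambda>x. norm (f x + g x))) \<longlongrightarrow> 0) at_top"
  proof (rule avg_tendsto_0_le[OF b(3) bcont_add[OF b(1,2)]])
    show "((\<lambda>R. avg R (\<lambda>x. norm (f x) + norm (g x))) \<longlongrightarrow> 0) at_top"
      using tendsto_add[OF lim] by (simp add: avg_add b)
  qed (auto intro: norm_triangle_ineq)
  then show ?thesis using fg by (simp add: WAP0_iff WAP_add)
qed

lemma WAP0_cmul: assumes "WAP0 f" shows "WAP0 (\<lambda>x. c * f x)"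
proof -
  have "((\<lambda>R. norm c * avg R (\<lambda>x. norm (f x))) \<longlongrightarrow> 0) at_top"
    using assms by (intro tendsto_mult_right_zero) (simp add: WAP0_iff)
  then show ?thesis using assms by (simp add: WAP0_iff WAP_cmul norm_mult avg_cmul)
qed

lemma WAP0_translate: assumes "WAP0 g" shows "WAP0 (\<lambda>x. g (x + t))"
  using assms avg_shift_tendsto_0[OF bcont_norm[of g], of "- t"]
  by (simp add: WAP0_iff WAP_translate WAP_is_Cu)

text \<open>Finitely many translates are \<open>e\<close>-dense in the orbit, so from every
  \<open>y\<close> one of finitely many displacements leads to a value close to \<open>g x\<close>.
  A finite sum of translates of the modulus is therefore at least \<open>e\<close> everywhere, yet
  its mean is zero.\<close>

lemma SAP_WAP0_imp_0:
  fixes g :: "'a::euclidean_space \<Rightarrow> complex"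
  assumes "SAP g" "WAP0 g" shows "g x = 0"
proof (rule ccontr)
  assume x: "g x \<noteq> 0"
  \<comment> \<open>Half the value, so that an approximation error below \<open>e\<close> still
    leaves modulus at least \<open>e\<close>.\<close>
  define e where "e = norm (g x) / 2"
  have e: "e > 0" using x by (simp add: e_def)
  have cu: "is_Cu g" and comp: "compact (closure (translates g))"
    using assms(1) by (auto simp: SAP_def)
  let ?G = "Bcontfun g"
  have "closure (translates g) \<subseteq> (\<Union>h\<in>translates g. ball h e)"
  proof
    fix h assume "h \<in> closure (translates g)"
    then obtain k where "k \<in> translates g" "dist k h < e" using e by (auto simp: closure_approachable)
    then show "h \<in> (\<Union>h\<in>translates g. ball h e)" by auto
  qed
  then obtain T where T: "T \<subseteq> translates g" "finite T" "closure (translates g) \<subseteq> (\<Union>h\<in>T. ball h e)"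
    using compactE_image[OF comp, of "translates g" "\<lambda>h. ball h e"] by auto
  then obtain F where F: "finite F" "T = (\<lambda>t. shift t ?G) ` F"
    using finite_subset_image[of T "\<lambda>t. shift t ?G" UNIV] by (auto simp: translates_shift cu)
  have big: "e \<le> (\<Sum>s\<in>F. norm (g (y + (x + s))))" for y
  proof -
    have "shift (- y) ?G \<in> closure (translates g)"
      using closure_subset by (force simp: translates_shift cu)
    then obtain s where s: "s \<in> F" "dist (shift s ?G) (shift (- y) ?G) < e" using T(3) F(2) by auto
    have "dist (shift s ?G) (shift (- y) ?G) = dist ?G (shift (- s - y) ?G)"
      using dist_shift[of "- s" "shift s ?G" "shift (- y) ?G"] by simp
    then have "dist (apply_bcontfun ?G x) (apply_bcontfun (shift (- s - y) ?G) x) < e"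
      using s(2) dist_bounded[of ?G x "shift (- s - y) ?G"] by linarith
    then have "norm (g x - g (y + (x + s))) < e"
      by (simp add: is_Cu_apply cu dist_norm algebra_simps)
    then have "e \<le> norm (g (y + (x + s)))"
      using norm_triangle_sub[of "g x" "g (y + (x + s))"] unfolding e_def by linarith
    also have "\<dots> \<le> (\<Sum>s\<in>F. norm (g (y + (x + s))))"
      using s(1) F(1) by (intro member_le_sum) auto
    finally show ?thesis .
  qed
  have bc: "bcont (\<lambda>y. norm (g (y + (x + s))))" for s
    by (intro bcont_norm is_Cu_translate cu)
  have "((\<lambda>R. \<Sum>s\<in>F. avg R (\<lambda>y. norm (g (y + (x + s))))) \<longlongrightarrow> (\<Sum>s\<in>F. 0)) at_top"
    using WAP0_translate[OF assms(2)] by (intro tendsto_sum) (auto simp: WAP0_iff)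
  moreover have "\<forall>\<^sub>F R in at_top. e \<le> (\<Sum>s\<in>F. avg R (\<lambda>y. norm (g (y + (x + s)))))"
    using eventually_gt_at_top[of "0::real"]
  proof eventually_elim
    case (elim R)
    have "avg R (\<lambda>y :: 'a. e) \<le> avg R (\<lambda>y. \<Sum>s\<in>F. norm (g (y + (x + s))))"
      by (intro avg_mono bcont_const bcont_sum F bc big)
    then show ?case by (simp add: avg_const elim avg_sum F bc)
  qed
  ultimately have "e \<le> (\<Sum>s\<in>F. 0)"
    by (intro tendsto_lowerbound) auto
  then show False using e by simp
qed

text \<open>The difference \<open>h - k = (g - k) - (g - h)\<close> is both almost periodic and
  null.\<close>

lemma eberlein_unique:
  assumes "SAP h" "WAP0 (\<lambda>x. g x - h x)" "SAP k" "WAP0 (\<lambda>x. g x - k x)"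
  shows "h = k"
proof
  fix x
  have "SAP (\<lambda>x. h x + - 1 * k x)" using assms by (intro SAP_add SAP_cmul)
  moreover have "WAP0 (\<lambda>x. (g x - k x) + - 1 * (g x - h x))" using assms by (intro WAP0_add WAP0_cmul)
  ultimately show "h x = k x" using SAP_WAP0_imp_0[of "\<lambda>x. h x - k x" x] by simp
qed

section \<open>Intersectivity for finitely additive averages\<close>

text \<open>A finitely additive probability mean, tested on continuous functions in place of sets.
  Products of functions with values in [0, 1] stand for intersections.\<close>

locale averaging =
  fixes M :: "('a::euclidean_space \<Rightarrow> real) \<Rightarrow> real"
  assumes M_add: "bcont u \<Longrightarrow> bcont v \<Longrightarrow> M (\<lambda>x. u x + v x) = M u + M v"
    and M_cmul: "bcont u \<Longrightarrow> M (\<lambda>x. c * u x) = c * M u"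
    and M_nonneg: "bcont u \<Longrightarrow> (\<And>x. 0 \<le> u x) \<Longrightarrow> 0 \<le> M u"
    and M_const: "M (\<lambda>x. c) = c"
begin

lemma M_diff: "bcont u \<Longrightarrow> bcont v \<Longrightarrow> M (\<lambda>x. u x - v x) = M u - M v"
  using M_add[of u "\<lambda>x. - 1 * v x"] M_cmul[of v "- 1"] bcont_cmul[of v "- 1"] by simp

lemma M_mono: "bcont u \<Longrightarrow> bcont v \<Longrightarrow> (\<And>x. u x \<le> v x) \<Longrightarrow> M u \<le> M v"
  using M_nonneg[of "\<lambda>x. v x - u x"] M_diff[of v u] bcont_add[of v "\<lambda>x. - 1 * u x"] bcont_cmul[of u "- 1"]
  by simp

lemma M_sum: "finite A \<Longrightarrow> (\<And>i. i \<in> A \<Longrightarrow> bcont (u i)) \<Longrightarrow> M (\<lambda>x. \<Sum>i\<in>A. u i x) = (\<Sum>i\<in>A. M (u i))"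
  by (induction A rule: finite_induct) (auto simp: M_const M_add bcont_sum)

text \<open>Nonnegativity of the variance: expand the mean of the square of
  \<open>w - M w\<close>.\<close>

lemma M_square: assumes "bcont w" shows "(M w)\<^sup>2 \<le> M (\<lambda>x. w x * w x)"
proof -
  let ?m = "M w"
  have b: "bcont (\<lambda>x. w x * w x)" "bcont (\<lambda>x. (- 2 * ?m) * w x)" "bcont (\<lambda>x. ?m * ?m)"
    "bcont (\<lambda>x. w x * w x + (- 2 * ?m) * w x)"
    by (intro bcont_add bcont_mult bcont_const assms)+
  have "0 \<le> M (\<lambda>x. (w x * w x + (- 2 * ?m) * w x) + ?m * ?m)"
  proof (rule M_nonneg)
    show "bcont (\<lambda>x. (w x * w x + (- 2 * ?m) * w x) + ?m * ?m)" by (intro bcont_add b)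
    show "0 \<le> (w x * w x + (- 2 * ?m) * w x) + ?m * ?m" for x
      using zero_le_square[of "w x - ?m"] by (simp add: algebra_simps)
  qed
  also have "\<dots> = M (\<lambda>x. w x * w x) + (- 2 * ?m) * ?m + ?m * ?m"
    by (simp only: M_add[OF b(4,3)] M_add[OF b(1,2)] M_cmul[OF assms] M_const)
  finally show ?thesis by (simp add: power2_eq_square)
qed

text \<open>If almost all pairs had small correlation, the second moment of a long sum would be
  smaller than the square of its mean.\<close>

lemma correlated_subfamily:
  fixes v :: "nat \<Rightarrow> 'a \<Rightarrow> real"
  assumes v: "\<And>n. bcont (v n)" "\<And>n x. 0 \<le> v n x" "\<And>n x. v n x \<le> 1"
    and p: "bcont p" "\<And>x. 0 \<le> p x" "\<And>x. p x \<le> 1"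
    and I: "infinite I" and a: "0 < a" "\<And>n. n \<in> I \<Longrightarrow> a \<le> M (\<lambda>x. p x * v n x)"
  obtains m J where "m \<in> I" "J \<subseteq> I - {m}" "infinite J"
    "\<And>n. n \<in> J \<Longrightarrow> a\<^sup>2 / 2 \<le> M (\<lambda>x. (p x * v m x) * v n x)"
proof (rule ccontr)
  assume no: "\<not> thesis"
  define c where "c m n = M (\<lambda>x. (p x * v m x) * v n x)" for m n
  note witness = that
  \<comment> \<open>The negated claim says that each index is well correlated with only finitely
    many others.\<close>
  have fin: "finite {n \<in> I - {m}. a\<^sup>2 / 2 \<le> c m n}" if "m \<in> I" for m
  proof (rule ccontr)
    assume "infinite {n \<in> I - {m}. a\<^sup>2 / 2 \<le> c m n}"
    then have thesis by (intro witness[OF that, of "{n \<in> I - {m}. a\<^sup>2 / 2 \<le> c m n}"]) (auto simp: c_def)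
    with no show False ..
  qed
  have c_sym: "c m n = c n m" for m n
    unfolding c_def by (simp add: mult.commute mult.left_commute)
  have bpv: "bcont (\<lambda>x. p x * v n x)" for n by (intro bcont_mult p v)
  have bpvv: "bcont (\<lambda>x. (p x * v m x) * v n x)" for m n by (intro bcont_mult p v)
  \<comment> \<open>Greedy choice: the indices chosen so far exclude finitely many candidates, and
    \<open>I\<close> is infinite.\<close>
  have "\<exists>F. finite F \<and> card F = N \<and> F \<subseteq> I \<and> (\<forall>m\<in>F. \<forall>n\<in>F. m \<noteq> n \<longrightarrow> c m n < a\<^sup>2 / 2)" for N
  proof (induction N)
    case 0
    show ?case by (rule exI[of _ "{}"]) simp
  next
    case (Suc N)
    then obtain F where F: "finite F" "card F = N" "F \<subseteq> I"
      "\<And>m n. m \<in> F \<Longrightarrow> n \<in> F \<Longrightarrow> m \<noteq> n \<Longrightarrow> c m n < a\<^sup>2 / 2" by blast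
    have "finite (F \<union> (\<Union>m\<in>F. {n \<in> I - {m}. a\<^sup>2 / 2 \<le> c m n}))"
      using F fin by auto
    then obtain n where n: "n \<in> I" "n \<notin> F \<union> (\<Union>m\<in>F. {n \<in> I - {m}. a\<^sup>2 / 2 \<le> c m n})"
      using I finite_subset[of I] by blast
    then have new: "c m n < a\<^sup>2 / 2" if "m \<in> F" for m using that by force
    show ?case
    proof (intro exI[of _ "insert n F"] conjI ballI impI)
      show "card (insert n F) = Suc N" using F n by simp
      fix m k assume "m \<in> insert n F" "k \<in> insert n F" "m \<noteq> k"
      then show "c m k < a\<^sup>2 / 2" using F(4) new c_sym by (metis insertE)
    qed (use F n in auto)
  qed
  \<comment> \<open>The comparison below reads \<open>N a^2 <= N a^2 / 2 + 1\<close>, that is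
    \<open>N a^2 <= 2\<close>; this \<open>N\<close> violates it.\<close>
  moreover obtain N :: nat where N: "2 / a\<^sup>2 < real N" using reals_Archimedean2 by blast
  ultimately obtain F where F: "finite F" "card F = N" "F \<subseteq> I"
    "\<And>m n. m \<in> F \<Longrightarrow> n \<in> F \<Longrightarrow> m \<noteq> n \<Longrightarrow> c m n < a\<^sup>2 / 2" by metis
  have N0: "0 < real N" 
    by (rule le_less_trans[OF _ N]) simp
  define w where "w x = (\<Sum>n\<in>F. p x * v n x)" for x
  have w: "bcont w" unfolding w_def by (intro bcont_sum F bpv)
  have "N * a \<le> M w"
  proof -
    have "M w = (\<Sum>n\<in>F. M (\<lambda>x. p x * v n x))" unfolding w_def by (intro M_sum F bpv)
    also have "\<dots> \<ge> (\<Sum>n\<in>F. a)" using a(2) F(3) by (intro sum_mono) auto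
    finally show ?thesis using F(2) by simp
  qed
  then have "(N * a)\<^sup>2 \<le> (M w)\<^sup>2" using a(1) by (intro power_mono) auto
  also have "\<dots> \<le> M (\<lambda>x. w x * w x)" by (rule M_square[OF w])
  also have "\<dots> \<le> M (\<lambda>x. \<Sum>m\<in>F. \<Sum>n\<in>F. (p x * v m x) * v n x)"
  proof (rule M_mono)
    show "w x * w x \<le> (\<Sum>m\<in>F. \<Sum>n\<in>F. (p x * v m x) * v n x)" for x
    proof -
      have "w x * w x = (\<Sum>m\<in>F. \<Sum>n\<in>F. (p x * v m x) * (p x * v n x))"
        by (simp add: w_def sum_product)
      \<comment> \<open>Each summand contains \<open>p x\<close> twice; one copy is dropped using
        \<open>p x <= 1\<close>.\<close>
      also have "\<dots> \<le> (\<Sum>m\<in>F. \<Sum>n\<in>F. (p x * v m x) * v n x)"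
        using p v by (intro sum_mono mult_left_mono mult_left_le_one_le) auto
      finally show ?thesis .
    qed
  qed (intro bcont_mult w bcont_sum F bpvv)+
  also have "\<dots> = (\<Sum>m\<in>F. \<Sum>n\<in>F. c m n)"
    unfolding c_def by (simp add: M_sum bcont_sum F(1) bpvv)
  \<comment> \<open>The \<open>N\<close> diagonal terms are only bounded by 1; being linear in
    \<open>N\<close>, they lose against the quadratic main term.\<close>
  also have "\<dots> \<le> (\<Sum>m\<in>F. \<Sum>n\<in>F. a\<^sup>2 / 2 + (if n = m then 1 else 0))"
  proof (intro sum_mono)
    fix m n assume mn: "m \<in> F" "n \<in> F"
    have "c n n \<le> M (\<lambda>x. 1)" unfolding c_def
      using p v by (intro M_mono bpvv bcont_const) (simp add: mult_le_one)
    then have "c n n \<le> a\<^sup>2 / 2 + 1" by (simp add: M_const add_increasing)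
    then show "c m n \<le> a\<^sup>2 / 2 + (if n = m then 1 else 0)" using F(4)[OF mn] by (auto intro: less_imp_le)
  qed
  also have "\<dots> = N * (N * (a\<^sup>2 / 2) + 1)"
    using F(1,2) by (simp add: sum.distrib)
  finally have "N * (N * a\<^sup>2) \<le> N * (N * (a\<^sup>2 / 2) + 1)"
    by (simp add: power2_eq_square algebra_simps)
  then have "N * a\<^sup>2 \<le> N * (a\<^sup>2 / 2) + 1" using N0 by (simp only: mult_le_cancel_left_pos)
  moreover have "2 < N * a\<^sup>2" using N a(1) by (simp add: field_simps)
  ultimately show False by simp
qed

text \<open>Iterate \<open>correlated_subfamily\<close> with \<open>p\<close> the product of the
  functions already selected. A product with positive mean is nonzero somewhere, and there all its
  factors are positive.\<close>

lemma intersective_subsequence: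
  fixes v :: "nat \<Rightarrow> 'a \<Rightarrow> real"
  assumes v: "\<And>n. bcont (v n)" "\<And>n x. 0 \<le> v n x" "\<And>n x. v n x \<le> 1"
    and a: "0 < a" "\<And>n. a \<le> M (v n)"
  shows "\<exists>r :: nat \<Rightarrow> nat. strict_mono r \<and> (\<forall>k. \<exists>x. \<forall>j\<le>k. 0 < v (r j) x)"
proof -
  \<comment> \<open>\<open>F\<close> holds the selected indices, \<open>I\<close> an infinite
    reservoir of candidates, and \<open>b\<close> a lower bound for the mean of the product extended
    by any single candidate. One selection replaces \<open>b\<close> by
    \<open>b^2 / 2\<close>.\<close>
  define P where "P = (\<lambda>(F, I, b). finite F \<and> F \<inter> I = {} \<and> infinite I \<and> 0 < b
    \<and> (\<forall>n\<in>I. b \<le> M (\<lambda>x. (\<Prod>i\<in>F. v i x) * v n x)))"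
  define Q where "Q = (\<lambda>(F, I :: nat set, b :: real) (F', I' :: nat set, b' :: real). F \<subset> (F' :: nat set))"
  have "\<exists>f. \<forall>n. P (f n) \<and> Q (f n) (f (Suc n))"
  proof (rule dependent_nat_choice)
    have "P ({}, UNIV, a)" using a by (simp add: P_def)
    then show "\<exists>s. P s" by blast
  next
    fix s :: "nat set \<times> nat set \<times> real" and k :: nat assume "P s"
    moreover obtain F I b where s: "s = (F, I, b)" by (metis surj_pair)
    ultimately have P: "finite F" "F \<inter> I = {}" "infinite I" "0 < b"
      "\<And>n. n \<in> I \<Longrightarrow> b \<le> M (\<lambda>x. (\<Prod>i\<in>F. v i x) * v n x)" by (auto simp: P_def)
    obtain m J where J: "m \<in> I" "J \<subseteq> I - {m}" "infinite J"
      "\<And>n. n \<in> J \<Longrightarrow> b\<^sup>2 / 2 \<le> M (\<lambda>x. ((\<Prod>i\<in>F. v i x) * v m x) * v n x)"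
    proof (rule correlated_subfamily[OF v _ _ _ P(3-5)])
      show "bcont (\<lambda>x. \<Prod>i\<in>F. v i x)" by (intro bcont_prod P v)
      show "0 \<le> (\<Prod>i\<in>F. v i x)" for x by (intro prod_nonneg v)
      show "(\<Prod>i\<in>F. v i x) \<le> 1" for x by (intro prod_le_1) (auto simp: v)
    qed auto
    have m: "m \<notin> F" using J(1) P(2) by auto
    have "P (insert m F, J, b\<^sup>2 / 2)"
      using P J m by (auto simp: P_def mult.commute)
    moreover have "Q s (insert m F, J, b\<^sup>2 / 2)" using m by (auto simp: Q_def s)
    ultimately show "\<exists>t. P t \<and> Q s t" by blast
  qed
  then obtain f where f: "\<And>n. P (f n)" "\<And>n. Q (f n) (f (Suc n))" by blast
  define G where "G n = fst (f n)" for n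
  have fin: "finite (G n)" for n using f(1)[of n] by (auto simp: P_def G_def split: prod.splits)
  have strict: "G n \<subset> G (Suc n)" for n using f(2)[of n] by (auto simp: Q_def G_def split: prod.splits)
  have pos: "\<exists>x. \<forall>i\<in>G n. 0 < v i x" for n
  proof (rule ccontr)
    assume no: "\<not> ?thesis"
    obtain F I b where s: "f n = (F, I, b)" by (metis surj_pair)
    then have P: "finite F" "infinite I" "0 < b"
      "\<And>n. n \<in> I \<Longrightarrow> b \<le> M (\<lambda>x. (\<Prod>i\<in>F. v i x) * v n x)" using f(1)[of n] by (auto simp: P_def)
    have "(\<Prod>i\<in>F. v i x) = 0" for x
    proof -
      obtain i where "i \<in> F" "\<not> 0 < v i x" using no by (auto simp: G_def s)
      then have "v i x = 0" using v(2)[of i x] by simp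
      then show ?thesis using P(1) \<open>i \<in> F\<close> by (meson prod_zero)
    qed
    moreover obtain k where "k \<in> I" using infinite_imp_nonempty[OF P(2)] by blast
    ultimately show False using P(4)[of k] P(3) by (simp add: M_const)
  qed
  define J where "J = (\<Union>n. G n)"
  have mono: "mono G" using strict by (intro incseq_SucI) auto
  have inf: "infinite J"
  proof
    assume fJ: "finite J"
    have "n \<le> card (G n)" for n
    proof (induction n)
      case (Suc n)
      then show ?case using psubset_card_mono[OF fin strict[of n]] by simp
    qed simp
    then have "Suc (card J) \<le> card (G (Suc (card J)))" by blast
    also have "\<dots> \<le> card J" by (intro card_mono fJ) (auto simp: J_def)
    finally show False by simp
  qed
  show ?thesis
  proof (rule exI[of _ "enumerate J"], rule conjI)
    show "strict_mono (enumerate J)" by (rule strict_mono_enumerate[OF inf])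
    show "\<forall>k. \<exists>x. \<forall>j\<le>k. 0 < v (enumerate J j) x"
    proof
      fix k :: nat
      have "\<forall>j. \<exists>n. enumerate J j \<in> G n" using enumerate_in_set[OF inf] by (auto simp: J_def)
      then obtain N where N: "\<And>j. enumerate J j \<in> G (N j)" by metis
      \<comment> \<open>The sets \<open>G n\<close> increase, so any initial piece of the
        enumeration lies in one of them and inherits its common point.\<close>
      have "enumerate J j \<in> G (Max (N ` {..k}))" if "j \<le> k" for j
        using N[of j] monoD[OF mono, of "N j" "Max (N ` {..k})"] that by auto
      then show "\<exists>x. \<forall>j\<le>k. 0 < v (enumerate J j) x" using pos[of "Max (N ` {..k})"] by blast
    qed
  qed
qed

end

text \<open>The contradiction comes from a real-linear functional, and the modulus is not linear.
  Hence one direction \<open>z\<close> at a time is treated, through the positive part of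
  \<open>Re (z H)\<close>.\<close>

lemma weakly_null_translates_part:
  fixes H :: "'a::euclidean_space \<Rightarrow>\<^sub>C complex" and t :: "nat \<Rightarrow> 'a"
  assumes weak: "\<And>\<phi> :: ('a \<Rightarrow>\<^sub>C complex) \<Rightarrow> real. bounded_linear \<phi> \<Longrightarrow> (\<lambda>n. \<phi> (shift (t n) H)) \<longlonglongrightarrow> 0"
    and z: "norm z \<le> 1"
  shows "((\<lambda>R. avg R (\<lambda>x. max (Re (z * apply_bcontfun H x)) 0)) \<longlongrightarrow> 0) at_top"
proof (rule ccontr)
  define u where "u x = Re (z * apply_bcontfun H x)" for x
  define up where "up x = max (u x) 0" for x
  assume "\<not> ?thesis"
  then have "\<not> ((\<lambda>R. avg R up) \<longlongrightarrow> 0) at_top" by (simp add: up_def[abs_def] u_def)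
  then obtain e where e: "e > 0" and ne: "\<not> (\<forall>\<^sub>F R in at_top. dist (avg R up) 0 < e)"
    by (auto simp: tendsto_iff)
  define C where "C = norm H + 1"
  have C: "C > 0" by (simp add: C_def add_nonneg_pos)
  have Re_le: "\<bar>Re (z * apply_bcontfun K x)\<bar> \<le> norm K" for K :: "'a \<Rightarrow>\<^sub>C complex" and x
  proof -
    have "\<bar>Re (z * apply_bcontfun K x)\<bar> \<le> norm z * norm (apply_bcontfun K x)"
      using abs_Re_le_cmod[of "z * apply_bcontfun K x"] by (simp add: norm_mult)
    also have "\<dots> \<le> 1 * norm (apply_bcontfun K x)" by (intro mult_right_mono z) simp
    finally show ?thesis using norm_bounded[of K x] by simp
  qed
  have u_le: "\<bar>u x\<bar> \<le> C" for x using Re_le[of H x] by (simp add: u_def C_def)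
  have bu: "bcont u"
    by (rule bcontI[OF _ u_le]) (auto simp: u_def[abs_def] intro!: continuous_intros)
  have bup: "bcont up" unfolding up_def[abs_def] by (rule bcont_max[OF bu])
  have up0: "0 \<le> up x" and upC: "up x \<le> C" for x using u_le[of x] C by (auto simp: up_def)
  \<comment> \<open>Failure of convergence gives arbitrarily large radii with average at least
    \<open>e\<close>; the summand 1 keeps them positive.\<close>
  have "\<exists>R. real j + 1 \<le> R \<and> e \<le> avg R up" for j
  proof (rule ccontr)
    assume no: "\<not> ?thesis"
    have "dist (avg R up) 0 < e" if "real j + 1 \<le> R" for R
    proof -
      have "avg R up < e" using no that by (metis not_le)
      then show ?thesis using avg_nonneg[OF bup up0, of R] by simp
    qed
    then show False using ne by (auto simp: eventually_at_top_linorder)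
  qed
  then obtain R where R: "\<And>j. real j + 1 \<le> R j" "\<And>j. e \<le> avg (R j) up" by metis
  have R0: "0 < R j" for j using R(1)[of j] by linarith
  have R_lim: "filterlim R at_top sequentially"
    by (rule filterlim_at_top_mono[OF filterlim_real_sequentially])
      (use R(1) in \<open>auto intro!: always_eventually order_trans[OF _ R(1)]\<close>)
  \<comment> \<open>A continuous substitute for the indicator of the set where the translate exceeds
    \<open>e / 2\<close>: positive exactly there, and scaled by \<open>C\<close> into
    [0, 1].\<close>
  define v where "v n x = inverse C * max (u (x - t n) - e / 2) 0" for n x
  have bv: "bcont (v n)" for n
    unfolding v_def[abs_def]
    using bcont_add[OF bcont_shift[OF bu] bcont_const[of "- (e / 2)"]]
    by (intro bcont_cmul bcont_max) simp
  have v0: "0 \<le> v n x" for n x using C by (simp add: v_def)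
  have v1: "v n x \<le> 1" for n x
    using C e u_le[of "x - t n"] by (simp add: v_def field_simps)
  obtain L where "generalised_limit L" using ex_generalised_limit by blast
  then interpret lim: generalised_limit L .
  \<comment> \<open>Averages along the bad radii, made convergent by the generalised limit.\<close>
  define M where "M w = L (\<lambda>j. avg (R j) w)" for w :: "'a \<Rightarrow> real"
  have bavg: "bounded (range (\<lambda>j. avg (R j) w))" if w: "bcont w" for w :: "'a \<Rightarrow> real"
  proof -
    obtain B where "\<And>x. \<bar>w x\<bar> \<le> B" using bcontE[OF w] by blast
    then have "\<bar>avg (R j) w\<bar> \<le> B" for j by (rule avg_abs_le[OF w _ R0])
    then show ?thesis by (auto intro!: boundedI[of _ B])
  qed
  interpret averaging M
  proof
    fix w :: "'a \<Rightarrow> real" and c assume w: "bcont w"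
    show "M (\<lambda>x. c * w x) = c * M w"
      unfolding M_def by (simp add: avg_cmul lim.L_cmul bavg w)
    show "M (\<lambda>x. w x + w' x) = M w + M w'" if "bcont w'" for w'
      unfolding M_def by (simp add: avg_add lim.L_add bavg w that)
    show "0 \<le> M w" if "\<And>x. 0 \<le> w x"
      unfolding M_def by (intro lim.L_ge bavg w always_eventually allI avg_nonneg that)
  next
    fix c :: real
    have "avg (R j) (\<lambda>x :: 'a. c) = c" for j by (rule avg_const[OF R0])
    moreover have "bounded (range (\<lambda>j :: nat. c))" by (intro boundedI[of _ "\<bar>c\<bar>"]) auto
    ultimately show "M (\<lambda>x. c) = c"
      unfolding M_def using lim.L_ge[of "\<lambda>_. c" c] lim.L_le[of "\<lambda>_. c" c] by simp
  qed
  have a: "inverse C * (e / 4) \<le> M (v n)" for n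
    unfolding M_def
  proof (intro lim.L_ge bavg bv)
    have "(\<lambda>j. C * ((1 + norm (- t n) / R j) ^ DIM('a) - 1)) \<longlonglongrightarrow> 0"
      by (rule filterlim_compose[OF shift_error_tendsto R_lim])
    then have "\<forall>\<^sub>F j in sequentially. C * ((1 + norm (- t n) / R j) ^ DIM('a) - 1) < e / 4"
      using e by (intro order_tendstoD(2)[of _ 0]) auto
    then show "\<forall>\<^sub>F j in sequentially. inverse C * (e / 4) \<le> avg (R j) (v n)"
    proof eventually_elim
      case (elim j)
      have b: "bcont (\<lambda>x. up (x - t n))" by (rule bcont_shift[OF bup])
      \<comment> \<open>The shift estimate is one-sided, so it is applied to the translate, shifted
        back by \<open>- t n\<close> to \<open>up\<close>; this yields a lower bound for the
        translate. Of \<open>e\<close>, the shift error costs \<open>e / 4\<close> and the threshold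
        \<open>e / 2\<close>, leaving \<open>e / 4\<close>.\<close>
      have "e \<le> avg (R j) (\<lambda>x. (\<lambda>y. up (y - t n)) (x - - t n))" using R(2)[of j] by simp
      also have "\<dots> \<le> avg (R j) (\<lambda>y. up (y - t n)) + C * ((1 + norm (- t n) / R j) ^ DIM('a) - 1)"
        by (intro avg_shift_le b up0 upC R0)
      finally have "e - e / 4 \<le> avg (R j) (\<lambda>y. up (y - t n))" using elim by simp
      also have "\<dots> \<le> avg (R j) (\<lambda>y. C * v n y + e / 2)"
      proof (rule avg_mono[OF b])
        show "bcont (\<lambda>y. C * v n y + e / 2)" by (intro bcont_add bcont_cmul bcont_const bv)
        show "up (y - t n) \<le> C * v n y + e / 2" for y
        proof -
          have "C * v n y = max (u (y - t n) - e / 2) 0" using C by (simp add: v_def)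
          then show ?thesis using e by (simp add: up_def)
        qed
      qed
      also have "\<dots> = C * avg (R j) (v n) + e / 2"
        by (simp add: avg_add bcont_cmul bcont_const bv avg_cmul avg_const R0)
      finally show ?case using C by (simp add: field_simps)
    qed
  qed
  have "0 < inverse C * (e / 4)" using C e by simp
  then obtain r :: "nat \<Rightarrow> nat" where r: "strict_mono r" "\<And>k. \<exists>x. \<forall>j\<le>k. 0 < v (r j) x"
    using intersective_subsequence[where v=v, OF bv v0 v1 _ a] by blast
  then obtain x where x: "\<And>j k. j \<le> k \<Longrightarrow> 0 < v (r j) (x k)" by metis
  have ux: "e / 2 \<le> Re (z * apply_bcontfun (shift (t (r j)) H) (x k))" if "j \<le> k" for j k
    using x[OF that] C by (simp add: v_def u_def max_def zero_less_mult_iff split: if_splits)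
  \<comment> \<open>A limit of evaluations at the common points \<open>x k\<close>. For fixed
    \<open>j\<close> all \<open>k >= j\<close> give at least \<open>e / 2\<close>, so \<phi> is at
    least \<open>e / 2\<close> on every selected translate.\<close>
  define \<phi> where "\<phi> K = L (\<lambda>k. Re (z * apply_bcontfun K (x k)))" for K
  have bK: "bounded (range (\<lambda>k. Re (z * apply_bcontfun K (x k))))" for K
    using Re_le by (intro boundedI[of _ "norm K"]) auto
  have "bounded_linear \<phi>"
  proof (rule bounded_linear_intro[where K=1])
    fix K K' :: "'a \<Rightarrow>\<^sub>C complex" and c :: real
    show "\<phi> (K + K') = \<phi> K + \<phi> K'"
      unfolding \<phi>_def using lim.L_add[OF bK[of K] bK[of K']] by (simp add: algebra_simps)
    have "Re (z * apply_bcontfun (c *\<^sub>R K) y) = c * Re (z * apply_bcontfun K y)" for y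
      by (simp add: scaleR_conv_of_real algebra_simps)
    then show "\<phi> (c *\<^sub>R K) = c *\<^sub>R \<phi> K"
      unfolding \<phi>_def using lim.L_cmul[OF bK[of K], of c] by (simp only: real_scaleR_def)
    have le: "- norm K \<le> Re (z * apply_bcontfun K y)" "Re (z * apply_bcontfun K y) \<le> norm K" for y
      using Re_le[of K y] by linarith+
    have "- norm K \<le> \<phi> K" unfolding \<phi>_def
      by (rule lim.L_ge[OF bK]) (intro always_eventually allI le)
    moreover have "\<phi> K \<le> norm K" unfolding \<phi>_def by (rule lim.L_le[OF bK le(2)])
    ultimately show "norm (\<phi> K) \<le> norm K * 1" by simp
  qed
  then have "(\<lambda>j. \<phi> (shift (t (r j)) H)) \<longlonglongrightarrow> 0"
    using LIMSEQ_subseq_LIMSEQ[OF weak r(1), of \<phi>] by (simp add: o_def)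
  moreover have "e / 2 \<le> \<phi> (shift (t (r j)) H)" for j
    unfolding \<phi>_def
    by (rule lim.L_ge[OF bK]) (use ux[of j] in \<open>unfold eventually_sequentially, blast\<close>)
  ultimately have "e / 2 \<le> 0" by (intro LIMSEQ_le_const) auto
  then show False using e by simp
qed

text \<open>The modulus is at most the sum of the absolute values of real and imaginary part, that
  is, of the positive parts in the four directions \<open>1\<close>, \<open>- 1\<close>,
  \<open>\<i>\<close>, \<open>- \<i>\<close>.\<close>

lemma weakly_null_translates:
  fixes H :: "'a::euclidean_space \<Rightarrow>\<^sub>C complex" and t :: "nat \<Rightarrow> 'a"
  assumes weak: "\<And>\<phi> :: ('a \<Rightarrow>\<^sub>C complex) \<Rightarrow> real. bounded_linear \<phi> \<Longrightarrow> (\<lambda>n. \<phi> (shift (t n) H)) \<longlonglongrightarrow> 0"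
  shows "((\<lambda>R. avg R (\<lambda>x. norm (apply_bcontfun H x))) \<longlongrightarrow> 0) at_top"
proof -
  define p where "p z x = max (Re (z * apply_bcontfun H x)) 0" for z x
  have bp: "bcont (p z)" if "norm z \<le> 1" for z
  proof -
    have "bcont (\<lambda>x. Re (z * apply_bcontfun H x))"
    proof (rule bcontI)
      show "\<bar>Re (z * apply_bcontfun H x)\<bar> \<le> norm z * norm H" for x
        using abs_Re_le_cmod[of "z * apply_bcontfun H x"] mult_left_mono[OF norm_bounded[of H x], of "norm z"]
        by (simp add: norm_mult)
    qed (auto intro!: continuous_intros)
    then show ?thesis unfolding p_def[abs_def] by (rule bcont_max)
  qed
  have lim: "((\<lambda>R. avg R (p z)) \<longlongrightarrow> 0) at_top" if "norm z \<le> 1" for z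
    unfolding p_def[abs_def] by (rule weakly_null_translates_part[where t=t]) (fact weak, fact that)
  note b = bp[of 1] bp[of "- 1"] bp[of \<i>] bp[of "- \<i>"]
  show ?thesis
  proof (rule avg_tendsto_0_le)
    show "bcont (\<lambda>x. norm (apply_bcontfun H x))"
      by (rule bcontI[of _ "norm H"]) (auto intro!: continuous_intros norm_bounded)
    show "bcont (\<lambda>x. (p 1 x + p (- 1) x) + (p \<i> x + p (- \<i>) x))"
      by (intro bcont_add bp) auto
    show "norm (apply_bcontfun H x) \<le> (p 1 x + p (- 1) x) + (p \<i> x + p (- \<i>) x)" for x
    proof -
      have "\<bar>r\<bar> = max r 0 + max (- r) 0" for r :: real by (simp add: max_def)
      then show ?thesis using cmod_le[of "apply_bcontfun H x"] by (simp add: p_def add.commute)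
    qed
    have "((\<lambda>R. (avg R (p 1) + avg R (p (- 1))) + (avg R (p \<i>) + avg R (p (- \<i>)))) \<longlongrightarrow> (0 + 0) + (0 + 0)) at_top"
      by (intro tendsto_add lim) auto
    then show "((\<lambda>R. avg R (\<lambda>x. (p 1 x + p (- 1) x) + (p \<i> x + p (- \<i>) x))) \<longlongrightarrow> 0) at_top"
      using b by (simp add: avg_add bcont_add)
  qed simp
qed

section \<open>The Eberlein decomposition of weakly almost periodic functions\<close>

text \<open>Uniform continuity of \<open>G\<close> is norm continuity of its orbit map.\<close>

lemma shift_continuous:
  assumes "G \<in> Cu" "0 < e"
  obtains d where "0 < d" "\<And>s t. dist s t < d \<Longrightarrow> dist (shift s G) (shift t G) \<le> e"
proof -
  have "uniformly_continuous_on UNIV (apply_bcontfun G)" using assms(1) by (simp add: Cu_def)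
  then obtain d where d: "0 < d"
    "\<And>x y. dist y x < d \<Longrightarrow> dist (apply_bcontfun G y) (apply_bcontfun G x) < e"
    using assms(2) unfolding uniformly_continuous_on_def by (metis UNIV_I)
  show thesis
  proof (rule that[OF d(1)])
    fix s t :: 'a assume "dist s t < d"
    then have "dist (x - s) (x - t) < d" for x by (simp add: dist_norm norm_minus_commute)
    then show "dist (shift s G) (shift t G) \<le> e"
      by (intro dist_bound) (simp add: d(2) less_imp_le)
  qed
qed

text \<open>Combinations are indexed by lists of pairs of a rational and an index: a countable type,
  with concatenation as addition. Real scalars return in the closure, by density of the
  rationals.\<close>

lemma closure_rational_combinations_subspace:
  fixes d :: "nat \<Rightarrow> 'v::real_normed_vector"
  defines "L \<equiv> range (\<lambda>l :: (rat \<times> nat) list. \<Sum>(r, n)\<leftarrow>l. of_rat r *\<^sub>R d n)"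
  shows "subspace (closure L)"
proof (rule subspaceI)
  define f where "f l = (\<Sum>(r, n)\<leftarrow>l. of_rat r *\<^sub>R d n)" for l :: "(rat \<times> nat) list"
  have L: "L = range f" by (simp add: L_def f_def[abs_def])
  have "f [] \<in> L" unfolding L by blast
  then show "0 \<in> closure L" using closure_subset by (auto simp: f_def)
  have add: "x + y \<in> L" if xy: "x \<in> L" "y \<in> L" for x y
  proof -
    obtain l k where "x = f l" "y = f k" using xy unfolding L by blast
    then have "x + y = f (l @ k)" by (simp add: f_def)
    then show ?thesis unfolding L by blast
  qed
  have scale: "of_rat c *\<^sub>R x \<in> L" if x: "x \<in> L" for c x
  proof -
    obtain l where l: "x = f l" using x unfolding L by blast
    have "of_rat c *\<^sub>R f l = f (map (\<lambda>(r, n). (c * r, n)) l)"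
      by (induction l) (auto simp: f_def scaleR_right_distrib of_rat_mult)
    then show ?thesis unfolding L l by blast
  qed
  show "x + y \<in> closure L" if "x \<in> closure L" "y \<in> closure L" for x y
  proof -
    obtain a b where "\<And>n. a n \<in> L" "a \<longlonglongrightarrow> x" "\<And>n. b n \<in> L" "b \<longlonglongrightarrow> y"
      using \<open>x \<in> closure L\<close> \<open>y \<in> closure L\<close> by (auto simp: closure_sequential)
    then show ?thesis
      using add tendsto_add[of a x sequentially b y] unfolding closure_sequential
      by (intro exI[of _ "\<lambda>n. a n + b n"]) simp
  qed
  show "c *\<^sub>R x \<in> closure L" if "x \<in> closure L" for c x
  proof -
    \<comment> \<open>The scalar is made real first with the vector still in \<open>L\<close>; only
      then does the vector pass to the closure.\<close>
    have "c *\<^sub>R y \<in> closure L" if y: "y \<in> L" for y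
    proof -
      have "closed ((\<lambda>c. c *\<^sub>R y) -` closure L)"
        by (intro continuous_closed_vimage) (auto intro!: continuous_intros)
      moreover have "\<rat> \<subseteq> (\<lambda>c. c *\<^sub>R y) -` closure L"
        using scale[OF y] closure_subset by (fastforce simp: Rats_def)
      ultimately have "closure \<rat> \<subseteq> (\<lambda>c. c *\<^sub>R y) -` closure L" by (intro closure_minimal)
      then show ?thesis using Rats_closure_real by auto
    qed
    then have "L \<subseteq> (\<lambda>x. c *\<^sub>R x) -` closure L" by auto
    moreover have "closed ((\<lambda>x. c *\<^sub>R x) -` closure L)"
      by (intro continuous_closed_vimage) (auto intro!: continuous_intros)
    ultimately have "closure L \<subseteq> (\<lambda>x. c *\<^sub>R x) -` closure L" by (intro closure_minimal)
    then show ?thesis using that by auto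
  qed
qed

text \<open>Translates along a countable dense set are norm dense in the orbit. Their closed span is
  separable, and it is weakly closed because a functional vanishing on it separates any outside
  point; so it contains the weak closure too.\<close>

lemma weak_orbit_closure_separable:
  fixes G :: "'a::euclidean_space \<Rightarrow>\<^sub>C complex"
  assumes G: "G \<in> Cu"
  obtains D where "countable D" "weak_top closure_of (range (\<lambda>t. shift t G)) \<subseteq> closure D"
proof -
  obtain Q :: "'a set" where Q: "countable Q" "\<And>U. open U \<Longrightarrow> U \<noteq> {} \<Longrightarrow> \<exists>q\<in>Q. q \<in> U"
    using countable_dense_exists by blast
  have Qne: "Q \<noteq> {}" using Q(2)[of UNIV] by auto
  define d where "d n = shift (from_nat_into Q n) G" for n
  define L where "L = range (\<lambda>l :: (rat \<times> nat) list. \<Sum>(r, n)\<leftarrow>l. of_rat r *\<^sub>R d n)"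
  have sub: "subspace (closure L)" unfolding L_def by (rule closure_rational_combinations_subspace)
  have dL: "d n \<in> L" for n unfolding L_def by (rule range_eqI[of _ _ "[(1, n)]"]) simp
  have orbit: "shift t G \<in> closure L" for t
  proof (unfold closure_approachable, intro allI impI)
    fix e :: real assume "0 < e"
    then obtain \<delta> where \<delta>: "0 < \<delta>" "\<And>s t. dist s t < \<delta> \<Longrightarrow> dist (shift s G) (shift t G) \<le> e / 2"
      using shift_continuous[OF G, of "e / 2"] by auto
    obtain q where q: "q \<in> Q" "q \<in> ball t \<delta>" using Q(2)[of "ball t \<delta>"] \<delta>(1) by auto
    obtain n where "from_nat_into Q n = q" using from_nat_into_surj[OF Q(1) q(1)] by blast
    then have "dist (d n) (shift t G) \<le> e / 2"
      unfolding d_def using q(2) by (intro \<delta>(2)) (simp add: dist_commute)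
    then show "\<exists>y\<in>L. dist y (shift t G) < e" using dL[of n] \<open>0 < e\<close> by force
  qed
  have "weak_top closure_of (range (\<lambda>t. shift t G)) \<subseteq> closure L"
  proof
    fix h assume h: "h \<in> weak_top closure_of (range (\<lambda>t. shift t G))"
    show "h \<in> closure L"
    proof (rule ccontr)
      assume "h \<notin> closure L"
      then have pos: "infdist h (closure L) > 0"
        using subspace_0[OF sub] by (intro infdist_pos_not_in_closed) auto
      obtain \<phi> where \<phi>: "linear \<phi>" "\<And>x. \<bar>\<phi> x\<bar> \<le> norm x" "\<And>x. x \<in> closure L \<Longrightarrow> \<phi> x = 0"
        "\<phi> h = infdist h (closure L)"
        using annihilating_functional[OF sub] by blast
      have "bounded_linear \<phi>"
        using \<phi>(2) by (intro bounded_linear_intro[where K=1])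
          (auto simp: linear_add[OF \<phi>(1)] linear_scale[OF \<phi>(1)])
      then have "closedin weak_top {h \<in> topspace weak_top. \<phi> h \<in> {0}}"
        by (intro closedin_continuous_map_preimage[OF continuous_map_weak_functional]) auto
      moreover have "range (\<lambda>t. shift t G) \<subseteq> {h \<in> topspace weak_top. \<phi> h \<in> {0}}"
        using orbit \<phi>(3) by auto
      ultimately have "\<phi> h = 0" using h closure_of_minimal by fastforce
      then show False using pos \<phi>(4) by simp
    qed
  qed
  moreover have "countable L" unfolding L_def by simp
  ultimately show thesis using that by blast
qed

section \<open>Minimal invariant sets in the weak orbit closure\<close>

definition shift_invariant :: "('a::euclidean_space \<Rightarrow>\<^sub>C complex) set \<Rightarrow> bool" where
  "shift_invariant K \<longleftrightarrow> (\<forall>t. shift t ` K \<subseteq> K)"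

lemma shift_invariantD: "shift_invariant K \<Longrightarrow> h \<in> K \<Longrightarrow> shift t h \<in> K"
  by (auto simp: shift_invariant_def)

text \<open>Zorn's lemma for reverse inclusion; weak compactness keeps the intersection of a chain
  nonempty.\<close>

lemma minimal_invariant_set:
  assumes X: "compactin weak_top X" "shift_invariant X" "X \<noteq> {}"
  obtains K where "K \<subseteq> X" "K \<noteq> {}" "closedin weak_top K" "shift_invariant K"
    "\<And>J. J \<subseteq> K \<Longrightarrow> J \<noteq> {} \<Longrightarrow> closedin weak_top J \<Longrightarrow> shift_invariant J \<Longrightarrow> J = K"
proof -
  define A where "A = {K. K \<subseteq> X \<and> K \<noteq> {} \<and> closedin weak_top K \<and> shift_invariant K}"
  define P where "P = (\<lambda>a b :: ('a \<Rightarrow>\<^sub>C complex) set. b \<subseteq> a)"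
  have "\<exists>m\<in>A. \<forall>a\<in>A. P m a \<longrightarrow> a = m"
  proof (rule predicate_Zorn)
    show "partial_order_on A (relation_of P A)"
      by (rule partial_order_on_relation_ofI) (auto simp: P_def)
  next
    fix C assume C: "C \<in> Chains (relation_of P A)"
    show "\<exists>u\<in>A. \<forall>a\<in>C. P a u"
    proof (cases "C = {}")
      case True
      then show ?thesis using X compactin_weak_imp_closedin by (auto simp: A_def)
    next
      case False
      have CA: "C \<subseteq> A" and tot: "\<And>a b. a \<in> C \<Longrightarrow> b \<in> C \<Longrightarrow> a \<subseteq> b \<or> b \<subseteq> a"
        using C by (auto simp: Chains_def relation_of_def P_def)
      \<comment> \<open>A finite part of a chain has a least member, which is nonempty; this is the
        finite intersection property.\<close>
      have min: "F \<noteq> {} \<longrightarrow> (\<exists>m\<in>C. m \<subseteq> \<Inter>F)" if "finite F" "F \<subseteq> C" for F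
        using that
      proof (induction F rule: finite_induct)
        case (insert a F)
        show ?case
        proof (cases "F = {}")
          case False
          then obtain m where "m \<in> C" "m \<subseteq> \<Inter>F" using insert by auto
          then show ?thesis using tot[of a m] insert.prems by auto
        qed (use insert.prems in auto)
      qed simp
      have "X \<inter> \<Inter>C \<noteq> {}"
      proof -
        have "X \<inter> \<Inter>F \<noteq> {}" if F: "finite F" "F \<subseteq> C" for F
        proof (cases "F = {}")
          case False
          then obtain m where "m \<in> C" "m \<subseteq> \<Inter>F" using min[OF F] by blast
          moreover have "m \<subseteq> X" "m \<noteq> {}" using CA \<open>m \<in> C\<close> by (auto simp: A_def)
          ultimately show ?thesis by blast
        qed (use X in simp)
        moreover have "closedin weak_top c" if "c \<in> C" for c using that CA by (auto simp: A_def)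
        moreover have "(\<forall>c\<in>C. closedin weak_top c) \<and> (\<forall>F. finite F \<and> F \<subseteq> C \<longrightarrow> X \<inter> \<Inter>F \<noteq> {})
            \<longrightarrow> X \<inter> \<Inter>C \<noteq> {}"
          using X(1) unfolding compactin_fip by (elim conjE allE)
        ultimately show ?thesis by simp
      qed
      moreover have "\<Inter>C \<subseteq> X" using CA False by (auto simp: A_def)
      moreover have "closedin weak_top (\<Inter>C)" using CA False by (intro closedin_Inter) (auto simp: A_def)
      moreover have "shift_invariant (\<Inter>C)"
      proof -
        have "shift_invariant c" if "c \<in> C" for c using that CA by (auto simp: A_def)
        then show ?thesis unfolding shift_invariant_def by blast
      qed
      ultimately show ?thesis by (intro bexI[of _ "\<Inter>C"]) (auto simp: A_def P_def)
    qed
  qed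
  then obtain m where m: "m \<in> A" "\<And>a. a \<in> A \<Longrightarrow> a \<subseteq> m \<Longrightarrow> a = m" by (auto simp: P_def)
  show thesis
    by (rule that[of m]) (use m in \<open>auto simp: A_def\<close>)
qed

text \<open>By Baire, some norm ball has nonempty relative weak interior in \<open>K\<close>; by minimality finitely many
  of its translates cover \<open>K\<close>.\<close>

lemma minimal_imp_norm_compact:
  assumes K: "compactin weak_top K" "K \<noteq> {}" "shift_invariant K"
    and min: "\<And>J. J \<subseteq> K \<Longrightarrow> J \<noteq> {} \<Longrightarrow> closedin weak_top J \<Longrightarrow> shift_invariant J \<Longrightarrow> J = K"
    and D: "countable D" "K \<subseteq> closure D"
  shows "compact K"
  unfolding compact_eq_totally_bounded
proof (intro conjI allI impI)
  have Kc: "closedin weak_top K" by (rule compactin_weak_imp_closedin[OF K(1)])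
  show "complete K" using closedin_weak_imp_closed[OF Kc] by (simp add: complete_eq_closed)
  fix e :: real assume e: "0 < e"
  let ?T = "subtopology weak_top K"
  have comp: "compact_space ?T" using K(1) by (simp add: compact_space_subtopology)
  have Haus: "Hausdorff_space ?T" by (rule Hausdorff_space_subtopology[OF Hausdorff_weak_top])
  have topK: "topspace ?T = K" by simp
  \<comment> \<open>Countably many weakly closed pieces of small norm radius cover \<open>K\<close>
    by separability; this is the cover fed to Baire's theorem.\<close>
  define \<G> where "\<G> = (\<lambda>l. K \<inter> cball l (e / 2)) ` D"
  have "K \<subseteq> \<Union>\<G>"
  proof
    fix h assume h: "h \<in> K"
    then obtain l where "l \<in> D" "dist l h < e / 2"
      using D(2) e by (meson closure_approachable half_gt_zero subsetD)
    then show "h \<in> \<Union>\<G>" using h by (auto simp: \<G>_def intro: less_imp_le)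
  qed
  then have "\<Union>\<G> = K" by (auto simp: \<G>_def)
  then have "?T interior_of \<Union>\<G> \<noteq> {}" using K(2) by (metis interior_of_topspace topK)
  moreover have "locally_compact_space ?T \<and> regular_space ?T"
    using comp Haus compact_Hausdorff_imp_regular_space compact_imp_locally_compact_space by blast
  moreover have "countable \<G>" using D(1) by (simp add: \<G>_def)
  moreover have "closedin ?T S" if "S \<in> \<G>" for S
    using that closedin_weak_cball by (auto simp: \<G>_def intro: closedin_subtopology_Int_closed)
  ultimately obtain S where S: "S \<in> \<G>" "?T interior_of S \<noteq> {}"
    using Baire_category_alt[of ?T \<G>] by blast
  then obtain l where l: "S \<subseteq> cball l (e / 2)" by (auto simp: \<G>_def)
  define U where "U = ?T interior_of S"
  have U: "openin ?T U" "U \<noteq> {}" "U \<subseteq> cball l (e / 2)" "U \<subseteq> K"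
    using S(2) l interior_of_subset[of ?T S] interior_of_subset_topspace[of ?T S] by (auto simp: U_def)
  define V where "V t = {h \<in> K. shift t h \<in> U}" for t
  have V: "openin ?T (V t)" for t
  proof -
    have "continuous_map ?T ?T (shift t)"
      using K(3) by (intro continuous_map_into_subtopology continuous_map_from_subtopology
          continuous_map_weak_linear bounded_linear_shift) (auto intro: shift_invariantD)
    from openin_continuous_map_preimage[OF this U(1)] show ?thesis by (simp add: V_def)
  qed
  have VK: "V t \<subseteq> K" for t by (auto simp: V_def)
  \<comment> \<open>The points whose orbit never enters \<open>U\<close>. They form a closed
    invariant proper subset, so by minimality there are none.\<close>
  define J where "J = K - (\<Union>t. V t)"
  have "closedin weak_top J"
  proof -
    have "openin ?T (\<Union>t. V t)" using V by (intro openin_Union) auto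
    from closedin_diff[OF closedin_topspace this] have "closedin ?T J"
      unfolding J_def topK .
    then show ?thesis using Kc closedin_trans_full by blast
  qed
  moreover have "shift_invariant J"
    unfolding shift_invariant_def
  proof safe
    fix t h assume h: "h \<in> J"
    then have "shift t h \<in> K" using K(3) by (auto simp: J_def intro: shift_invariantD)
    moreover have "shift t h \<notin> V s" for s
    proof
      assume "shift t h \<in> V s"
      then have "h \<in> V (s + t)" using h by (auto simp: V_def J_def)
      then show False using h by (auto simp: J_def)
    qed
    ultimately show "shift t h \<in> J" by (auto simp: J_def)
  qed
  moreover have "J \<noteq> K"
  proof -
    obtain h where "h \<in> U" using U(2) by blast
    then have "h \<in> V 0" using U(4) by (auto simp: V_def)
    then have "h \<in> K" "h \<notin> J" using VK by (auto simp: J_def)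
    then show ?thesis by blast
  qed
  ultimately have "J = {}" using min[of J] by (auto simp: J_def)
  then have "topspace ?T \<subseteq> \<Union> (range V)" by (auto simp: J_def)
  moreover have "\<And>W. W \<in> range V \<Longrightarrow> openin ?T W" using V by auto
  ultimately obtain \<F> where \<F>: "finite \<F>" "\<F> \<subseteq> range V" "topspace ?T \<subseteq> \<Union>\<F>"
    using comp unfolding compact_space_alt by metis
  obtain N where N: "finite N" "\<F> = V ` N" using finite_subset_image[OF \<F>(1,2)] by blast
  show "\<exists>k. finite k \<and> K \<subseteq> (\<Union>x\<in>k. ball x e)"
  proof (intro exI conjI)
    show "finite ((\<lambda>t. shift (- t) l) ` N)" using N(1) by simp
    show "K \<subseteq> (\<Union>x\<in>(\<lambda>t. shift (- t) l) ` N. ball x e)"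
    proof
      fix h assume "h \<in> K"
      then obtain t where t: "t \<in> N" "h \<in> V t" using \<F>(3) N(2) by auto
      then have "dist l (shift t h) \<le> e / 2" using U(3) by (auto simp: V_def)
      moreover have "dist (shift (- t) l) h = dist l (shift t h)"
        using dist_shift[of "- t" l "shift t h"] by simp
      ultimately have "h \<in> ball (shift (- t) l) e" using e by simp
      then show "h \<in> (\<Union>x\<in>(\<lambda>t. shift (- t) l) ` N. ball x e)" using t(1) by blast
    qed
  qed
qed

text \<open>On a weakly compact set the weak topology is metrizable, being determined by the values on a
  countable dense set.\<close>

lemma weak_closure_sequence:
  fixes G :: "'a::euclidean_space \<Rightarrow>\<^sub>C complex"
  assumes X: "compactin weak_top X" "range (\<lambda>t. shift t G) \<subseteq> X"
    and k: "k \<in> weak_top closure_of (range (\<lambda>t. shift t G))"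
  obtains s :: "nat \<Rightarrow> 'a" where
    "\<And>\<phi> :: ('a \<Rightarrow>\<^sub>C complex) \<Rightarrow> real. bounded_linear \<phi> \<Longrightarrow> (\<lambda>n. \<phi> (shift (s n) G)) \<longlonglongrightarrow> \<phi> k"
proof -
  obtain Q :: "'a set" where Q: "countable Q" "\<And>U. open U \<Longrightarrow> U \<noteq> {} \<Longrightarrow> \<exists>q\<in>Q. q \<in> U"
    using countable_dense_exists by blast
  \<comment> \<open>Restriction to a countable dense set, read as a sequence: a weakly continuous
    injection into a space where closures are described by sequences.\<close>
  define E :: "('a \<Rightarrow>\<^sub>C complex) \<Rightarrow> nat \<Rightarrow> complex"
    where "E h n = apply_bcontfun h (from_nat_into Q n)" for h n
  have E: "continuous_map weak_top euclidean E"
    unfolding euclidean_product_topology[symmetric] continuous_map_componentwise_UNIV E_def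
    using continuous_map_weak_apply by blast
  have E_inj: "h = h'" if "E h = E h'" for h h'
  proof (rule bcontfun_eqI, rule ccontr)
    fix x assume ne: "apply_bcontfun h x \<noteq> apply_bcontfun h' x"
    have "open {x. apply_bcontfun h x \<noteq> apply_bcontfun h' x}"
      by (intro open_Collect_neq) auto
    then obtain q where "q \<in> Q" "apply_bcontfun h q \<noteq> apply_bcontfun h' q" using Q(2) ne by blast
    moreover obtain n where "from_nat_into Q n = q" using from_nat_into_surj[OF Q(1) \<open>q \<in> Q\<close>] by blast
    ultimately show False using fun_cong[OF that, of n] by (simp add: E_def)
  qed
  have "E k \<in> closure (E ` range (\<lambda>t. shift t G))"
    using continuous_map_image_closure_subset[OF E] k by fastforce
  then obtain y where y: "\<And>n. y n \<in> E ` range (\<lambda>t. shift t G)" "y \<longlonglongrightarrow> E k"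
    unfolding closure_sequential by blast
  then have "\<forall>n. \<exists>t. y n = E (shift t G)" by blast
  then obtain s where s: "\<And>n. y n = E (shift (s n) G)" by metis
  show thesis
  proof (rule that)
    fix \<phi> :: "('a \<Rightarrow>\<^sub>C complex) \<Rightarrow> real" assume \<phi>: "bounded_linear \<phi>"
    show "(\<lambda>n. \<phi> (shift (s n) G)) \<longlonglongrightarrow> \<phi> k"
    proof (rule topological_tendstoI)
      fix S assume S: "open S" "\<phi> k \<in> S"
      \<comment> \<open>The compact part of \<open>X\<close> on which \<phi> misses
        \<open>S\<close>. Its image is closed and avoids \<open>E k\<close> by injectivity, so the
        approximating sequence eventually leaves it.\<close>
      define W where "W = X \<inter> {h \<in> topspace weak_top. \<phi> h \<in> - S}"
      have "compactin weak_top W"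
        unfolding W_def using S(1)
        by (intro compact_Int_closedin X(1) closedin_continuous_map_preimage[where Y=euclideanreal]
            continuous_map_weak_functional \<phi>) (auto simp: closed_closedin[symmetric])
      then have "compact (E ` W)" using image_compactin[OF _ E] by simp
      then have "open (- (E ` W))" by (simp add: compact_imp_closed open_Compl)
      moreover have "E k \<in> - (E ` W)" using E_inj S(2) by (auto simp: W_def)
      ultimately have "\<forall>\<^sub>F n in sequentially. y n \<in> - (E ` W)"
        using y(2) by (auto dest: topological_tendstoD)
      then show "\<forall>\<^sub>F n in sequentially. \<phi> (shift (s n) G) \<in> S"
      proof eventually_elim
        case (elim n)
        then have "shift (s n) G \<notin> W" unfolding s by blast
        then show ?case using X(2) by (auto simp: W_def)
      qed
    qed
  qed
qed

theorem eberlein_exists: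
  fixes g :: "'a::euclidean_space \<Rightarrow> complex"
  assumes "WAP g"
  obtains h where "SAP h" "WAP0 (\<lambda>x. g x - h x)"
    "\<And>B x. (\<And>y. norm (g y) \<le> B) \<Longrightarrow> norm (h x) \<le> B"
proof -
  define G where "G = Bcontfun g"
  have cu: "is_Cu g" using assms by (rule WAP_is_Cu)
  have G: "G \<in> Cu" "apply_bcontfun G = g" by (simp_all add: G_def is_Cu_in_Cu is_Cu_apply cu)
  define Orb where "Orb = range (\<lambda>t. shift t G)"
  obtain Y where Y: "compactin weak_top Y" "Y \<subseteq> Cu" "Orb \<subseteq> Y"
    using assms by (auto simp: WAP_iff Orb_def G_def translates_shift)
  define X where "X = weak_top closure_of Orb"
  have XY: "X \<subseteq> Y"
    unfolding X_def by (intro closure_of_minimal Y compactin_weak_imp_closedin)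
  have Xcl: "closedin weak_top X" by (simp add: X_def)
  have X: "compactin weak_top X" by (rule closed_compactin[OF Y(1) XY Xcl])
  have OX: "Orb \<subseteq> X" unfolding X_def by (intro closure_of_subset) simp
  have "shift_invariant X"
    unfolding shift_invariant_def
  proof
    fix t
    have "shift t ` Orb \<subseteq> Orb" by (auto simp: Orb_def)
    then show "shift t ` X \<subseteq> X"
      unfolding X_def
      using continuous_map_image_closure_subset[OF continuous_map_weak_linear[OF bounded_linear_shift], of t Orb]
        closure_of_mono[of "shift t ` Orb" Orb weak_top] by blast
  qed
  moreover have "X \<noteq> {}" using OX by (auto simp: Orb_def)
  ultimately obtain K where K: "K \<subseteq> X" "K \<noteq> {}" "closedin weak_top K" "shift_invariant K"
    "\<And>J. J \<subseteq> K \<Longrightarrow> J \<noteq> {} \<Longrightarrow> closedin weak_top J \<Longrightarrow> shift_invariant J \<Longrightarrow> J = K"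
    using minimal_invariant_set[OF X] by blast
  obtain D where D: "countable D" "X \<subseteq> closure D"
    using weak_orbit_closure_separable[OF G(1)] by (auto simp: X_def Orb_def)
  have comp: "compact K"
    by (rule minimal_imp_norm_compact[OF closed_compactin[OF X K(1,3)] K(2,4,5) D(1)])
      (use K(1) D(2) in auto)
  obtain k where k: "k \<in> K" using K(2) by blast
  then have "k \<in> weak_top closure_of (range (\<lambda>t. shift t G))" using K(1) by (auto simp: X_def Orb_def)
  then obtain s :: "nat \<Rightarrow> 'a" where s: "\<And>\<phi> :: ('a \<Rightarrow>\<^sub>C complex) \<Rightarrow> real. bounded_linear \<phi> \<Longrightarrow>
      (\<lambda>n. \<phi> (shift (s n) G)) \<longlonglongrightarrow> \<phi> k"
    using weak_closure_sequence[OF X OX[unfolded Orb_def]] by metis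
  have "\<forall>n. shift (- s n) k \<in> K" using K(4) k by (simp add: shift_invariantD)
  then obtain h r where h: "h \<in> K" "strict_mono r" "((\<lambda>n. shift (- s n) k) \<circ> r) \<longlonglongrightarrow> h"
    using comp unfolding compact_eq_seq_compact_metric seq_compact_def by metis
  have hCu: "h \<in> Cu" using h(1) K(1) XY Y(2) by blast
  \<comment> \<open>Translations are isometries, so norm convergence of the pulled back
    \<open>k\<close> to \<open>h\<close> can be pushed forward again. The translations vary with
    \<open>n\<close>, which is why norm compactness of \<open>K\<close> is used here.\<close>
  have "(\<lambda>n. shift (s (r n)) h) \<longlonglongrightarrow> k"
  proof -
    have "(\<lambda>n. dist (shift (- s (r n)) k) h) \<longlonglongrightarrow> 0" 
      using h(3) unfolding o_def by (rule tendsto_dist_iff[THEN iffD1])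
    moreover have "dist (shift (- s (r n)) k) h = dist (shift (s (r n)) h) k" for n
      using dist_shift[of "s (r n)" "shift (- s (r n)) k" h] by (simp add: dist_commute)
    ultimately show ?thesis by (subst tendsto_dist_iff) simp
  qed
  then have null: "(\<lambda>n. \<phi> (shift (s (r n)) (G - h))) \<longlonglongrightarrow> 0" if \<phi>: "bounded_linear \<phi>"
    for \<phi> :: "('a \<Rightarrow>\<^sub>C complex) \<Rightarrow> real"
  proof -
    have "(\<lambda>n. \<phi> (shift (s (r n)) G) - \<phi> (shift (s (r n)) h)) \<longlonglongrightarrow> \<phi> k - \<phi> k"
      using LIMSEQ_subseq_LIMSEQ[OF s[OF \<phi>] h(2)] bounded_linear.tendsto[OF \<phi> \<open>_ \<longlonglongrightarrow> k\<close>]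
      by (intro tendsto_diff) (simp_all add: o_def)
    then show ?thesis by (simp add: shift_diff linear_diff[OF bounded_linear.linear[OF \<phi>]])
  qed
  show thesis
  proof (rule that[of "apply_bcontfun h"])
    show SAP: "SAP (apply_bcontfun h)"
      using comp h(1) K(4) Cu_is_Cu[OF hCu]
      by (auto simp: SAP_iff translates_apply[OF hCu] intro!: exI[of _ K] shift_invariantD)
    have "WAP (\<lambda>x. g x + - 1 * apply_bcontfun h x)"
      by (intro WAP_add WAP_cmul SAP_imp_WAP SAP assms)
    moreover have "((\<lambda>R. avg R (\<lambda>x. norm (apply_bcontfun (G - h) x))) \<longlongrightarrow> 0) at_top"
      by (rule weakly_null_translates[where t="\<lambda>n. s (r n)"]) (rule null)
    ultimately show "WAP0 (\<lambda>x. g x - apply_bcontfun h x)" by (simp add: WAP0_iff G(2))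
    fix B x assume B: "\<And>y. norm (g y) \<le> B"
    \<comment> \<open>The ball is weakly closed, so a bound valid on the orbit reaches
      \<open>h\<close> in its weak closure.\<close>
    have "Orb \<subseteq> cball 0 B"
      using B by (auto simp: Orb_def G(2) intro!: norm_bound)
    then have "X \<subseteq> cball 0 B" unfolding X_def by (intro closure_of_minimal closedin_weak_cball)
    then have "norm h \<le> B" using h(1) K(1) by auto
    then show "norm (apply_bcontfun h x) \<le> B" using norm_bounded[of h x] by linarith
  qed
qed

section \<open>Schwartz functions\<close>

lemma dderivI: "(F has_derivative F') (at x) \<Longrightarrow> dderiv v F x = F' v"
  by (metis dderiv_def frechet_derivative_at)

lemma dderiv_has_derivative:
  "F differentiable at x \<Longrightarrow> (F has_derivative (\<lambda>v. dderiv v F x)) (at x)"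
  by (simp add: dderiv_def frechet_derivative_works)

lemma schwartz_diff: "f \<in> schwartz \<Longrightarrow> set vs \<subseteq> Basis \<Longrightarrow> iter_dderiv vs f differentiable at x"
  by (auto simp: schwartz_def)

lemma schwartz_has_derivative:
  "f \<in> schwartz \<Longrightarrow> set vs \<subseteq> Basis \<Longrightarrow>
    (iter_dderiv vs f has_derivative (\<lambda>v. iter_dderiv (v # vs) f x)) (at x)"
  by (simp add: dderiv_has_derivative schwartz_diff)

lemma schwartz_bound:
  assumes "f \<in> schwartz" "set vs \<subseteq> Basis"
  shows "\<exists>C. \<forall>x. (1 + norm x) ^ k * norm (iter_dderiv vs f x) \<le> C"
  using assms by (simp add: schwartz_def)

lemma schwartzI:
  assumes "\<And>vs x. set vs \<subseteq> Basis \<Longrightarrow> iter_dderiv vs f differentiable at x"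
    and "\<And>k vs x. set vs \<subseteq> Basis \<Longrightarrow> (1 + norm x) ^ k * norm (iter_dderiv vs f x) \<le> C k vs"
  shows "f \<in> schwartz"
  using assms unfolding schwartz_def by blast

text \<open>Membership in \<open>schwartz\<close> bounds the set under the supremum, so the real
  \<open>SUP\<close> really is an upper bound.\<close>

lemma schwartz_seminorm_ge:
  assumes "f \<in> schwartz" "set vs \<subseteq> Basis"
  shows "(1 + norm x) ^ k * norm (iter_dderiv vs f x) \<le> schwartz_seminorm k vs f"
proof -
  obtain C where "\<And>x. (1 + norm x) ^ k * norm (iter_dderiv vs f x) \<le> C"
    using schwartz_bound[OF assms, of k] by blast
  then have "bdd_above (range (\<lambda>x. (1 + norm x) ^ k * norm (iter_dderiv vs f x)))"
    by (rule bdd_aboveI2)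
  then show ?thesis unfolding schwartz_seminorm_def by (intro cSUP_upper) auto
qed

lemma schwartz_seminorm_nonneg:
  assumes "f \<in> schwartz" "set vs \<subseteq> Basis" shows "0 \<le> schwartz_seminorm k vs f"
  by (rule order_trans[OF _ schwartz_seminorm_ge[OF assms, of 0]]) simp

lemma schwartz_seminorm_le:
  "(\<And>x. (1 + norm x) ^ k * norm (iter_dderiv vs f x) \<le> C) \<Longrightarrow> schwartz_seminorm k vs f \<le> C"
  unfolding schwartz_seminorm_def by (rule cSUP_least) auto

lemma iter_dderiv_le_seminorm:
  assumes "f \<in> schwartz" "set vs \<subseteq> Basis"
  shows "norm (iter_dderiv vs f x) \<le> schwartz_seminorm 0 vs f"
  using schwartz_seminorm_ge[OF assms, of x 0] by simp

lemma iter_dderiv_add: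
  assumes "f \<in> schwartz" "g \<in> schwartz" "set vs \<subseteq> Basis"
  shows "iter_dderiv vs (\<lambda>x. f x + g x) = (\<lambda>x. iter_dderiv vs f x + iter_dderiv vs g x)"
  using assms(3)
proof (induction vs)
  case (Cons v vs)
  then have vs: "set vs \<subseteq> Basis" by simp
  show ?case
    using dderivI[OF has_derivative_add[OF schwartz_has_derivative[OF assms(1) vs] schwartz_has_derivative[OF assms(2) vs]]]
      Cons.IH[OF vs] by auto
qed simp

lemma iter_dderiv_cmul:
  assumes "f \<in> schwartz" "set vs \<subseteq> Basis"
  shows "iter_dderiv vs (\<lambda>x. c * f x) = (\<lambda>x. c * iter_dderiv vs f x)"
  using assms(2)
proof (induction vs)
  case (Cons v vs)
  then have vs: "set vs \<subseteq> Basis" by simp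
  show ?case
    using dderivI[OF has_derivative_mult_right[OF schwartz_has_derivative[OF assms(1) vs]]]
      Cons.IH[OF vs] by auto
qed simp

text \<open>Taking \<open>a = - 1\<close> and \<open>b = t\<close> gives the substitution
  \<open>t - x\<close> that defines \<open>dconv\<close>.\<close>

lemma iter_dderiv_affine:
  assumes "f \<in> schwartz" "set vs \<subseteq> Basis"
  shows "iter_dderiv vs (\<lambda>x. f (a *\<^sub>R x + b)) = (\<lambda>x. (a ^ length vs) *\<^sub>R iter_dderiv vs f (a *\<^sub>R x + b))"
  using assms(2)
proof (induction vs)
  case (Cons v vs)
  let ?F = "iter_dderiv vs f"
  have vs: "set vs \<subseteq> Basis" using Cons.prems by simp
  have "dderiv v (\<lambda>x. (a ^ length vs) *\<^sub>R ?F (a *\<^sub>R x + b)) x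
      = (a ^ length (v # vs)) *\<^sub>R iter_dderiv (v # vs) f (a *\<^sub>R x + b)" for x
  proof -
    have F: "(?F has_derivative (\<lambda>v. dderiv v ?F (a *\<^sub>R x + b))) (at (a *\<^sub>R x + b))"
      using schwartz_has_derivative[OF assms(1) vs] by simp
    have "((\<lambda>x. a *\<^sub>R x + b) has_derivative (\<lambda>h. a *\<^sub>R h)) (at x)"
      by (auto intro!: derivative_eq_intros)
    from has_derivative_compose[OF this F]
    have "((\<lambda>x. (a ^ length vs) *\<^sub>R ?F (a *\<^sub>R x + b)) has_derivative
        (\<lambda>h. (a ^ length vs) *\<^sub>R dderiv (a *\<^sub>R h) ?F (a *\<^sub>R x + b))) (at x)"
      by (rule has_derivative_scaleR_right)
    from dderivI[OF this]
    have "dderiv v (\<lambda>x. (a ^ length vs) *\<^sub>R ?F (a *\<^sub>R x + b)) x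
        = (a ^ length vs) *\<^sub>R dderiv (a *\<^sub>R v) ?F (a *\<^sub>R x + b)" .
    also have "dderiv (a *\<^sub>R v) ?F (a *\<^sub>R x + b) = a *\<^sub>R dderiv v ?F (a *\<^sub>R x + b)"
      by (rule linear_scale[OF has_derivative_linear[OF F]])
    finally show ?thesis by (simp add: mult.commute)
  qed
  then show ?case using Cons by auto
qed simp

lemma schwartz_add: assumes "f \<in> schwartz" "g \<in> schwartz" shows "(\<lambda>x. f x + g x) \<in> schwartz"
proof (rule schwartzI)
  fix vs :: "'a list" and x assume vs: "set vs \<subseteq> Basis"
  show "iter_dderiv vs (\<lambda>x. f x + g x) differentiable at x"
    unfolding iter_dderiv_add[OF assms vs] by (intro differentiable_add schwartz_diff assms vs)
next
  fix vs :: "'a list" and k x assume vs: "set vs \<subseteq> Basis"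
  have "(1 + norm x) ^ k * norm (iter_dderiv vs f x + iter_dderiv vs g x)
      \<le> (1 + norm x) ^ k * norm (iter_dderiv vs f x) + (1 + norm x) ^ k * norm (iter_dderiv vs g x)"
    unfolding distrib_left[symmetric] by (intro mult_left_mono norm_triangle_ineq) simp
  then show "(1 + norm x) ^ k * norm (iter_dderiv vs (\<lambda>x. f x + g x) x)
      \<le> schwartz_seminorm k vs f + schwartz_seminorm k vs g"
    unfolding iter_dderiv_add[OF assms vs]
    using schwartz_seminorm_ge[OF assms(1) vs, of x k] schwartz_seminorm_ge[OF assms(2) vs, of x k]
    by linarith
qed

lemma schwartz_cmul_aux:
  assumes "f \<in> schwartz" "set vs \<subseteq> Basis"
  shows "(1 + norm x) ^ k * norm (iter_dderiv vs (\<lambda>x. c * f x) x) \<le> norm c * schwartz_seminorm k vs f"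
proof -
  have "(1 + norm x) ^ k * norm (iter_dderiv vs (\<lambda>x. c * f x) x)
      = norm c * ((1 + norm x) ^ k * norm (iter_dderiv vs f x))"
    by (simp add: iter_dderiv_cmul[OF assms] norm_mult)
  also have "\<dots> \<le> norm c * schwartz_seminorm k vs f"
    by (intro mult_left_mono schwartz_seminorm_ge assms) simp
  finally show ?thesis .
qed

lemma schwartz_cmul: assumes "f \<in> schwartz" shows "(\<lambda>x. c * f x) \<in> schwartz"
proof (rule schwartzI[OF _ schwartz_cmul_aux[OF assms]])
  fix vs :: "'a list" and x assume vs: "set vs \<subseteq> Basis"
  show "iter_dderiv vs (\<lambda>x. c * f x) differentiable at x"
    unfolding iter_dderiv_cmul[OF assms vs] by (intro differentiable_mult schwartz_diff assms vs) simp
qed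

text \<open>Peetre's inequality in the form
  \<open>1 + norm x <= (1 + norm b) * (1 + norm (a x + b))\<close> trades the weight at
  \<open>x\<close> for the weight at the image point.\<close>

lemma schwartz_affine_aux:
  assumes "f \<in> schwartz" "set vs \<subseteq> Basis" "\<bar>a\<bar> = 1"
  shows "(1 + norm x) ^ k * norm (iter_dderiv vs (\<lambda>x. f (a *\<^sub>R x + b)) x)
    \<le> (1 + norm b) ^ k * schwartz_seminorm k vs f"
proof -
  let ?y = "a *\<^sub>R x + b"
  have "norm x \<le> norm ?y + norm b"
    using norm_triangle_ineq4[of ?y b] assms(3) by simp
  also have "\<dots> \<le> norm ?y + norm b + norm b * norm ?y" by simp
  finally have "1 + norm x \<le> (1 + norm b) * (1 + norm ?y)" by (simp add: algebra_simps)
  then have "(1 + norm x) ^ k \<le> (1 + norm b) ^ k * (1 + norm ?y) ^ k"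
    unfolding power_mult_distrib[symmetric] by (intro power_mono) auto
  then have "(1 + norm x) ^ k * norm (iter_dderiv vs f ?y)
      \<le> (1 + norm b) ^ k * ((1 + norm ?y) ^ k * norm (iter_dderiv vs f ?y))"
    by (metis mult.assoc mult_right_mono norm_ge_zero)
  also have "\<dots> \<le> (1 + norm b) ^ k * schwartz_seminorm k vs f"
    by (intro mult_left_mono schwartz_seminorm_ge assms) simp
  finally show ?thesis
    by (simp add: iter_dderiv_affine[OF assms(1,2)] power_abs assms(3))
qed

lemma schwartz_affine:
  assumes "f \<in> schwartz" "\<bar>a\<bar> = 1" shows "(\<lambda>x. f (a *\<^sub>R x + b)) \<in> schwartz"
proof (rule schwartzI[OF _ schwartz_affine_aux[OF assms(1) _ assms(2)]])
  fix vs :: "'a list" and x assume vs: "set vs \<subseteq> Basis"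
  have "(\<lambda>x. iter_dderiv vs f (a *\<^sub>R x + b)) differentiable at x"
    by (rule differentiable_compose[where f="iter_dderiv vs f"])
      (auto intro!: derivative_intros schwartz_diff assms vs)
  then show "iter_dderiv vs (\<lambda>x. f (a *\<^sub>R x + b)) differentiable at x"
    unfolding iter_dderiv_affine[OF assms(1) vs] by (rule differentiable_scaleR[OF differentiable_const])
qed

lemma schwartz_reflect: "f \<in> schwartz \<Longrightarrow> (\<lambda>x. f (t - x)) \<in> schwartz"
  using schwartz_affine[of f "- 1" t] by simp

lemma schwartz_reflect_iff: "(\<lambda>x. f (t - x)) \<in> schwartz \<longleftrightarrow> f \<in> schwartz"
  using schwartz_reflect[of "\<lambda>x. f (t - x)" t] schwartz_reflect[of f t] by auto

text \<open>Completeness of the Schwartz space, in the form of absolutely convergent series.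
  Termwise differentiation is justified by a summable bound on the derivative operators.\<close>

lemma schwartz_series:
  fixes f :: "nat \<Rightarrow> 'a::euclidean_space \<Rightarrow> complex"
  assumes f: "\<And>n. f n \<in> schwartz"
    and sum: "\<And>k vs. set vs \<subseteq> Basis \<Longrightarrow> summable (\<lambda>n. schwartz_seminorm k vs (f n))"
  shows "(\<lambda>x. \<Sum>n. f n x) \<in> schwartz"
    and "\<And>k vs. set vs \<subseteq> Basis \<Longrightarrow> schwartz_seminorm k vs (\<lambda>x. \<Sum>n. f n x) \<le> (\<Sum>n. schwartz_seminorm k vs (f n))"
    and "\<And>x. summable (\<lambda>n. f n x)"
proof -
  let ?F = "\<lambda>x. \<Sum>n. f n x"
  have summ: "summable (\<lambda>n. norm (iter_dderiv vs (f n) x))" if "set vs \<subseteq> Basis" for vs x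
    by (rule summable_comparison_test'[OF sum[OF that, of 0], of 0])
      (simp add: iter_dderiv_le_seminorm[OF f that])
  note summ' = summable_norm_cancel[OF summ]
  then show "summable (\<lambda>n. f n x)" for x using summ'[of "[]" x] by simp
  have deriv: "((\<lambda>x. \<Sum>n. iter_dderiv vs (f n) x) has_derivative
      (\<lambda>h. \<Sum>n. iter_dderiv (h # vs) (f n) x)) (at x)" if vs: "set vs \<subseteq> Basis" for vs x
  proof -
    \<comment> \<open>Seminorms control derivatives along basis vectors only; expanding a direction
      in coordinates makes \<open>s n\<close> a bound for the operator norm of the derivative,
      uniform in the point.\<close>
    define s where "s n = (\<Sum>b\<in>Basis. schwartz_seminorm 0 (b # vs) (f n))" for n
    have bvs: "set (b # vs) \<subseteq> Basis" if "b \<in> Basis" for b using vs that by simp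
    have s: "summable s" unfolding s_def by (intro summable_sum sum bvs)
    have bound: "norm (iter_dderiv (h # vs) (f n) x) \<le> s n * norm h" for n x h
    proof -
      have lin: "linear (\<lambda>h. iter_dderiv (h # vs) (f n) x)"
        using schwartz_has_derivative[OF f vs] has_derivative_linear by blast
      have "iter_dderiv (h # vs) (f n) x = (\<Sum>b\<in>Basis. (h \<bullet> b) *\<^sub>R iter_dderiv (b # vs) (f n) x)"
      proof -
        have "iter_dderiv ((\<Sum>b\<in>Basis. (h \<bullet> b) *\<^sub>R b) # vs) (f n) x
            = (\<Sum>b\<in>Basis. (h \<bullet> b) *\<^sub>R iter_dderiv (b # vs) (f n) x)"
          using linear_sum[OF lin, of "\<lambda>b. (h \<bullet> b) *\<^sub>R b" Basis] linear_scale[OF lin] by simp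
        then show ?thesis by (simp only: euclidean_representation)
      qed
      also have "norm \<dots> \<le> (\<Sum>b\<in>Basis. norm h * schwartz_seminorm 0 (b # vs) (f n))"
      proof (rule sum_norm_le)
        fix b :: 'a assume b: "b \<in> Basis"
        show "norm ((h \<bullet> b) *\<^sub>R iter_dderiv (b # vs) (f n) x) \<le> norm h * schwartz_seminorm 0 (b # vs) (f n)"
          unfolding norm_scaleR
          by (intro mult_mono Basis_le_norm b iter_dderiv_le_seminorm f bvs) auto
      qed
      also have "\<dots> = s n * norm h" by (simp add: s_def sum_distrib_left mult.commute)
      finally show ?thesis .
    qed
    have hsum: "summable (\<lambda>n. iter_dderiv (h # vs) (f n) x)" for h x
      using bound by (intro summable_comparison_test[OF _ summable_mult2[OF s, of "norm h"]]) blast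
    have "\<exists>g. \<forall>x\<in>UNIV. (\<lambda>n. iter_dderiv vs (f n) x) sums g x
        \<and> (g has_derivative (\<lambda>h. \<Sum>n. iter_dderiv (h # vs) (f n) x)) (at x within UNIV)"
    proof (rule has_derivative_series)
      fix e :: real assume e: "0 < e"
      have "\<forall>\<^sub>F n in sequentially. (\<Sum>i. s (i + n)) < e"
        using order_tendstoD(2)[OF suminf_exist_split2[OF s] e] .
      then show "\<forall>\<^sub>F n in sequentially. \<forall>x\<in>UNIV. \<forall>h. norm ((\<Sum>i<n. iter_dderiv (h # vs) (f i) x)
          - (\<Sum>n. iter_dderiv (h # vs) (f n) x)) \<le> e * norm h"
      proof eventually_elim
        case (elim n)
        show ?case
        proof (intro ballI allI)
          fix x h
          let ?a = "\<lambda>i. iter_dderiv (h # vs) (f i) x"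
          have sn: "summable (\<lambda>i. s (i + n) * norm h)"
            by (intro summable_mult2 summable_ignore_initial_segment s)
          have "norm ((\<Sum>i<n. ?a i) - suminf ?a) = norm (\<Sum>i. ?a (i + n))"
            using suminf_split_initial_segment[OF hsum[of h x], of n]
            by (simp add: norm_minus_commute del: iter_dderiv.simps)
          also have "\<dots> \<le> (\<Sum>i. s (i + n) * norm h)"
            by (rule norm_suminf_le[OF bound sn])
          also have "\<dots> = (\<Sum>i. s (i + n)) * norm h"
            by (rule suminf_mult2[symmetric]) (intro summable_ignore_initial_segment s)
          also have "\<dots> \<le> e * norm h" using elim by (intro mult_right_mono) auto
          finally show "norm ((\<Sum>i<n. ?a i) - suminf ?a) \<le> e * norm h" .
        qed
      qed
    next
      show "(\<lambda>n. iter_dderiv vs (f n) 0) sums (\<Sum>n. iter_dderiv vs (f n) 0)"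
        by (rule summable_sums[OF summ'[OF vs]])
    qed (use schwartz_has_derivative[OF f vs] in auto)
    then obtain g where g: "\<And>x. (\<lambda>n. iter_dderiv vs (f n) x) sums g x"
      "\<And>x. (g has_derivative (\<lambda>h. \<Sum>n. iter_dderiv (h # vs) (f n) x)) (at x)" by blast
    have "(\<lambda>x. \<Sum>n. iter_dderiv vs (f n) x) = g" using g(1) by (intro ext sums_unique[symmetric])
    then show ?thesis using g(2) by simp
  qed
  have iter: "iter_dderiv vs ?F = (\<lambda>x. \<Sum>n. iter_dderiv vs (f n) x)" if "set vs \<subseteq> Basis" for vs
    using that
  proof (induction vs)
    case (Cons v vs)
    have "iter_dderiv (v # vs) ?F x = (\<Sum>n. iter_dderiv (v # vs) (f n) x)" for x
      using Cons dderivI[OF deriv[of vs x], of v] by simp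
    then show ?case by blast
  qed simp
  have bound: "(1 + norm x) ^ k * norm (iter_dderiv vs ?F x) \<le> (\<Sum>n. schwartz_seminorm k vs (f n))"
    if vs: "set vs \<subseteq> Basis" for k vs x
  proof -
    have "(1 + norm x) ^ k * norm (iter_dderiv vs ?F x)
        \<le> (1 + norm x) ^ k * (\<Sum>n. norm (iter_dderiv vs (f n) x))"
      unfolding iter[OF vs] by (intro mult_left_mono summable_norm summ vs) simp
    also have "\<dots> = (\<Sum>n. (1 + norm x) ^ k * norm (iter_dderiv vs (f n) x))"
      by (rule suminf_mult[symmetric, OF summ[OF vs]])
    also have "\<dots> \<le> (\<Sum>n. schwartz_seminorm k vs (f n))"
      by (intro suminf_le schwartz_seminorm_ge f vs sum summable_mult summ)
    finally show ?thesis .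
  qed
  show "?F \<in> schwartz"
  proof (rule schwartzI[OF _ bound])
    fix vs :: "'a list" and x assume vs: "set vs \<subseteq> Basis"
    show "iter_dderiv vs ?F differentiable at x"
      unfolding iter[OF vs] using deriv[OF vs] by (rule differentiableI)
  qed
  show "schwartz_seminorm k vs ?F \<le> (\<Sum>n. schwartz_seminorm k vs (f n))" if "set vs \<subseteq> Basis" for k vs
    by (rule schwartz_seminorm_le[OF bound[OF that]])
qed

section \<open>Uniform boundedness for tempered distributions\<close>

text \<open>The sum in the continuity condition of \<open>tempered\<close>. It increases with
  \<open>N\<close>, so bounds of different order can be compared at the larger one.\<close>

definition schwartz_norm :: "nat \<Rightarrow> ('a::euclidean_space \<Rightarrow> complex) \<Rightarrow> real" where
  "schwartz_norm N f = (\<Sum>k\<le>N. \<Sum>vs\<in>{vs. set vs \<subseteq> Basis \<and> length vs \<le> N}. schwartz_seminorm k vs f)"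

lemma finite_multi_indices: "finite {vs :: 'a::euclidean_space list. set vs \<subseteq> Basis \<and> length vs \<le> N}"
  by (rule finite_lists_length_le) simp

lemma schwartz_norm_nonneg: "f \<in> schwartz \<Longrightarrow> 0 \<le> schwartz_norm N f"
  unfolding schwartz_norm_def by (auto intro!: sum_nonneg schwartz_seminorm_nonneg)

lemma schwartz_norm_mono:
  assumes f: "f \<in> schwartz" and "M \<le> N" shows "schwartz_norm M f \<le> schwartz_norm N f"
proof -
  have "schwartz_norm M f
      \<le> (\<Sum>k\<le>M. \<Sum>vs\<in>{vs. set vs \<subseteq> Basis \<and> length vs \<le> N}. schwartz_seminorm k vs f)"
    unfolding schwartz_norm_def using assms
    by (intro sum_mono sum_mono2 finite_multi_indices) (auto intro: schwartz_seminorm_nonneg)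
  also have "\<dots> \<le> schwartz_norm N f"
    unfolding schwartz_norm_def using assms
    by (intro sum_mono2) (auto intro!: sum_nonneg schwartz_seminorm_nonneg)
  finally show ?thesis .
qed

lemma schwartz_seminorm_le_norm:
  assumes f: "f \<in> schwartz" and "k \<le> N" "set vs \<subseteq> Basis" "length vs \<le> N"
  shows "schwartz_seminorm k vs f \<le> schwartz_norm N f"
proof -
  have "schwartz_seminorm k vs f \<le> (\<Sum>vs\<in>{vs. set vs \<subseteq> Basis \<and> length vs \<le> N}. schwartz_seminorm k vs f)"
    using assms by (intro member_le_sum finite_multi_indices) (auto intro: schwartz_seminorm_nonneg)
  also have "\<dots> \<le> schwartz_norm N f"
    unfolding schwartz_norm_def using assms
    by (intro member_le_sum[of k "{..N}"]) (auto intro!: sum_nonneg schwartz_seminorm_nonneg)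
  finally show ?thesis .
qed

lemma schwartz_norm_cmul:
  assumes f: "f \<in> schwartz" shows "schwartz_norm N (\<lambda>x. c * f x) \<le> norm c * schwartz_norm N f"
  unfolding schwartz_norm_def sum_distrib_left
  by (intro sum_mono schwartz_seminorm_le schwartz_cmul_aux[OF f]) simp

lemma schwartz_norm_reflect:
  fixes f :: "'a::euclidean_space \<Rightarrow> complex"
  assumes f: "f \<in> schwartz"
  shows "schwartz_norm N (\<lambda>x. f (t - x)) \<le> (1 + norm t) ^ N * schwartz_norm N f"
  unfolding schwartz_norm_def sum_distrib_left
proof (intro sum_mono schwartz_seminorm_le)
  fix k x and vs :: "'a list" assume k: "k \<in> {..N}" and vs: "vs \<in> {vs. set vs \<subseteq> Basis \<and> length vs \<le> N}"
  have "(1 + norm x) ^ k * norm (iter_dderiv vs (\<lambda>x. f (t - x)) x) \<le> (1 + norm t) ^ k * schwartz_seminorm k vs f"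
    using schwartz_affine_aux[OF f, of vs "- 1" x k t] vs by simp
  also have "\<dots> \<le> (1 + norm t) ^ N * schwartz_seminorm k vs f"
    using k vs by (intro mult_right_mono power_increasing schwartz_seminorm_nonneg f) auto
  finally show "(1 + norm x) ^ k * norm (iter_dderiv vs (\<lambda>x. f (t - x)) x) \<le> (1 + norm t) ^ N * schwartz_seminorm k vs f" .
qed

lemma schwartz_norm_series:
  assumes f: "\<And>n. f n \<in> schwartz"
    and sum: "\<And>k vs. set vs \<subseteq> Basis \<Longrightarrow> summable (\<lambda>n. schwartz_seminorm k vs (f n))"
  shows "schwartz_norm N (\<lambda>x. \<Sum>n. f n x) \<le> (\<Sum>n. schwartz_norm N (f n))"
    and "summable (\<lambda>n. schwartz_norm N (f n))"
proof -
  let ?I = "{vs. set vs \<subseteq> Basis \<and> length vs \<le> N}"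
  have "schwartz_norm N (\<lambda>x. \<Sum>n. f n x) \<le> (\<Sum>k\<le>N. \<Sum>vs\<in>?I. \<Sum>n. schwartz_seminorm k vs (f n))"
    unfolding schwartz_norm_def by (intro sum_mono schwartz_series(2) f sum) auto
  also have "\<dots> = (\<Sum>k\<le>N. \<Sum>n. \<Sum>vs\<in>?I. schwartz_seminorm k vs (f n))"
    by (intro sum.cong refl suminf_sum[symmetric] sum) auto
  also have "\<dots> = (\<Sum>n. schwartz_norm N (f n))"
    unfolding schwartz_norm_def by (intro suminf_sum[symmetric] summable_sum sum) auto
  finally show "schwartz_norm N (\<lambda>x. \<Sum>n. f n x) \<le> (\<Sum>n. schwartz_norm N (f n))" .
  show "summable (\<lambda>n. schwartz_norm N (f n))"
    unfolding schwartz_norm_def by (intro summable_sum sum) auto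
qed

section \<open>Tempered distributions as a vector space, and their boundedness principle\<close>

lemma tempered_iff:
  "tempered \<psi> \<longleftrightarrow> (\<forall>f. f \<notin> schwartz \<longrightarrow> \<psi> f = 0) \<and>
     (\<forall>f\<in>schwartz. \<forall>g\<in>schwartz. \<psi> (\<lambda>x. f x + g x) = \<psi> f + \<psi> g) \<and>
     (\<forall>f\<in>schwartz. \<forall>c. \<psi> (\<lambda>x. c * f x) = c * \<psi> f) \<and>
     (\<exists>C N. \<forall>f\<in>schwartz. norm (\<psi> f) \<le> C * schwartz_norm N f)"
  unfolding tempered_def schwartz_norm_def ..

lemma tempered_outside: "tempered \<psi> \<Longrightarrow> f \<notin> schwartz \<Longrightarrow> \<psi> f = 0"
  by (simp add: tempered_iff)

lemma tempered_add:
  "tempered \<psi> \<Longrightarrow> f \<in> schwartz \<Longrightarrow> g \<in> schwartz \<Longrightarrow> \<psi> (\<lambda>x. f x + g x) = \<psi> f + \<psi> g"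
  by (simp add: tempered_iff)

lemma tempered_cmul: "tempered \<psi> \<Longrightarrow> f \<in> schwartz \<Longrightarrow> \<psi> (\<lambda>x. c * f x) = c * \<psi> f"
  by (simp add: tempered_iff)

lemma tempered_bound:
  assumes "tempered \<psi>"
  obtains C N where "0 \<le> C" "\<And>f. f \<in> schwartz \<Longrightarrow> norm (\<psi> f) \<le> C * schwartz_norm N f"
proof -
  obtain C N where C: "\<And>f. f \<in> schwartz \<Longrightarrow> norm (\<psi> f) \<le> C * schwartz_norm N f"
    using assms unfolding tempered_iff by blast
  have "norm (\<psi> f) \<le> \<bar>C\<bar> * schwartz_norm N f" if f: "f \<in> schwartz" for f
    using C[OF f] mult_right_mono[OF abs_ge_self[of C] schwartz_norm_nonneg[OF f, of N]] by linarith
  then show thesis by (rule that[OF abs_ge_zero])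
qed

lemma tempered_linear_combination:
  assumes \<psi>: "tempered \<psi>" "tempered \<eta>" shows "tempered (\<lambda>f. \<psi> f + c * \<eta> f)"
proof -
  obtain C N D M where C: "0 \<le> C" "\<And>f. f \<in> schwartz \<Longrightarrow> norm (\<psi> f) \<le> C * schwartz_norm N f"
    and D: "0 \<le> D" "\<And>f. f \<in> schwartz \<Longrightarrow> norm (\<eta> f) \<le> D * schwartz_norm M f"
    using tempered_bound[OF \<psi>(1)] tempered_bound[OF \<psi>(2)] by metis
  have "norm (\<psi> f + c * \<eta> f) \<le> (C + norm c * D) * schwartz_norm (max N M) f" if f: "f \<in> schwartz" for f
  proof -
    have "norm (\<psi> f + c * \<eta> f) \<le> norm (\<psi> f) + norm c * norm (\<eta> f)"
      using norm_triangle_ineq[of "\<psi> f" "c * \<eta> f"] by (simp add: norm_mult)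
    also have "\<dots> \<le> C * schwartz_norm N f + norm c * (D * schwartz_norm M f)"
      by (intro add_mono mult_left_mono C D f) simp
    also have "\<dots> \<le> C * schwartz_norm (max N M) f + norm c * (D * schwartz_norm (max N M) f)"
      by (intro add_mono mult_left_mono schwartz_norm_mono C D f) simp_all
    finally show ?thesis by (simp add: algebra_simps)
  qed
  then have "\<exists>C N. \<forall>f\<in>schwartz. norm (\<psi> f + c * \<eta> f) \<le> C * schwartz_norm N f" by blast
  then show ?thesis
    using \<psi> unfolding tempered_iff by (auto simp: algebra_simps)
qed

text \<open>The constant found here carries a factor \<open>(1 + norm t) ^ N\<close>; removing this
  dependence on \<open>t\<close> is the task of uniform boundedness.\<close>

lemma tempered_dconv:
  assumes "tempered \<psi>" shows "tempered (\<lambda>f. dconv \<psi> f t)"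
proof -
  obtain C N where C: "0 \<le> C" "\<And>f. f \<in> schwartz \<Longrightarrow> norm (\<psi> f) \<le> C * schwartz_norm N f"
    using tempered_bound[OF assms] by blast
  have "norm (dconv \<psi> f t) \<le> (C * (1 + norm t) ^ N) * schwartz_norm N f" if f: "f \<in> schwartz" for f
  proof -
    have "norm (dconv \<psi> f t) \<le> C * schwartz_norm N (\<lambda>x. f (t - x))"
      unfolding dconv_def by (intro C schwartz_reflect f)
    also have "\<dots> \<le> C * ((1 + norm t) ^ N * schwartz_norm N f)"
      by (intro mult_left_mono schwartz_norm_reflect f C)
    finally show ?thesis by (simp add: mult.assoc)
  qed
  then have "\<exists>C N. \<forall>f\<in>schwartz. norm (dconv \<psi> f t) \<le> C * schwartz_norm N f" by blast
  then show ?thesis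
    unfolding tempered_iff
    by (auto simp: dconv_def schwartz_reflect_iff schwartz_reflect tempered_outside[OF assms]
        tempered_add[OF assms] tempered_cmul[OF assms])
qed

text \<open>Gliding hump: were the conclusion false, a rapidly convergent series of Schwartz functions could be
  built on which the family is unbounded.\<close>

theorem tempered_uniform_boundedness:
  fixes \<Lambda> :: "'i \<Rightarrow> ('a::euclidean_space \<Rightarrow> complex) \<Rightarrow> complex"
  assumes temp: "\<And>i. tempered (\<Lambda> i)"
    and bdd: "\<And>f. f \<in> schwartz \<Longrightarrow> \<exists>B. \<forall>i. norm (\<Lambda> i f) \<le> B"
  shows "\<exists>C N. \<forall>i. \<forall>f\<in>schwartz. norm (\<Lambda> i f) \<le> C * schwartz_norm N f"
proof (rule ccontr)
  assume no: "\<not> ?thesis"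
  have hump: "\<exists>i. \<exists>f\<in>schwartz. schwartz_norm N f \<le> e \<and> M \<le> norm (\<Lambda> i f)"
    if e: "0 < e" and M: "0 < M" for N and e M :: real
  proof -
    have "\<not> (\<forall>i. \<forall>f\<in>schwartz. norm (\<Lambda> i f) \<le> (M / e) * schwartz_norm N f)"
      using no by blast
    then obtain i f where f: "f \<in> schwartz" "(M / e) * schwartz_norm N f < norm (\<Lambda> i f)"
      by (auto simp: not_le)
    define a where "a = norm (\<Lambda> i f)"
    have a: "0 < a"
    proof -
      have "0 \<le> (M / e) * schwartz_norm N f" using e M schwartz_norm_nonneg[OF f(1)] by simp
      then show ?thesis using f(2) unfolding a_def by linarith
    qed
    \<comment> \<open>Rescaling puts the functional's value at exactly \<open>M\<close>; violating
      the bound with constant \<open>M / e\<close> then forces the seminorm down to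
      \<open>e\<close>.\<close>
    define b where "b = M / a"
    have b: "0 < b" "b * a = M" using a M by (simp_all add: b_def)
    define g where "g x = of_real b * f x" for x
    have g: "g \<in> schwartz" unfolding g_def[abs_def] by (rule schwartz_cmul[OF f(1)])
    have "schwartz_norm N g \<le> b * schwartz_norm N f"
      using schwartz_norm_cmul[OF f(1), of N "of_real b"] b by (simp add: g_def[abs_def])
    also have "\<dots> \<le> e" using f(2) a e M by (simp add: b_def a_def[symmetric] field_simps)
    finally have "schwartz_norm N g \<le> e" .
    moreover have "norm (\<Lambda> i g) = M"
      unfolding g_def[abs_def] tempered_cmul[OF temp f(1)] using b by (simp add: a_def norm_mult)
    ultimately show ?thesis using g by auto
  qed
  have "\<forall>i. \<exists>C N. 0 \<le> C \<and> (\<forall>f\<in>schwartz. norm (\<Lambda> i f) \<le> C * schwartz_norm N f)"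
    using tempered_bound[OF temp] by metis
  then obtain K \<nu> where K: "\<And>i. 0 \<le> K i" "\<And>i f. f \<in> schwartz \<Longrightarrow> norm (\<Lambda> i f) \<le> K i * schwartz_norm (\<nu> i) f"
    by metis
  obtain B where B: "\<And>f i. f \<in> schwartz \<Longrightarrow> norm (\<Lambda> i f) \<le> B f" using bdd by metis
  have B0: "0 \<le> B f" if "f \<in> schwartz" for f using B[OF that] norm_ge_zero order_trans by blast
  \<comment> \<open>The state records the latest hump \<open>f\<close>, the partial sum
    \<open>g\<close>, the index \<open>i\<close> of the functional that detects the hump, and bounds
    \<open>c\<close>, \<open>m\<close> for its continuity constant and order, increased along the
    recursion.\<close>
  define P where "P = (\<lambda>(n :: nat) (f :: 'a \<Rightarrow> complex, g :: 'a \<Rightarrow> complex, i, c, m). f \<in> schwartz \<and> g \<in> schwartz \<and> K i \<le> c \<and> \<nu> i \<le> m \<and> n \<le> m)"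
  \<comment> \<open>A new hump is small for the constants of all earlier functionals but large for
    its own. In its size, \<open>B g\<close> absorbs the partial sum, 2 absorbs the later humps, and
    \<open>n\<close> survives.\<close>
  define Q where "Q = (\<lambda>(n :: nat) (f :: 'a \<Rightarrow> complex, g :: 'a \<Rightarrow> complex, i :: 'i, c, m :: nat)
      (f' :: 'a \<Rightarrow> complex, g', i', c' :: real, m').
    g' = (\<lambda>x. g x + f' x) \<and> c \<le> c' \<and> m \<le> m' \<and> schwartz_norm m f' \<le> (1 / 2) ^ n / (1 + c)
    \<and> B g + n + 2 \<le> norm (\<Lambda> i' f'))"
  have "\<exists>s. \<forall>n. P n (s n) \<and> Q n (s n) (s (Suc n))"
  proof (rule dependent_nat_choice)
    have "(\<lambda>x. 0) \<in> (schwartz :: ('a \<Rightarrow> complex) set)"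
    proof -
      obtain f :: "'a \<Rightarrow> complex" where "f \<in> schwartz" using hump[of 1 1] by auto
      from schwartz_cmul[OF this, of 0] show ?thesis by simp
    qed
    then have "P 0 (\<lambda>x. 0, \<lambda>x. 0, i, K i, \<nu> i)" for i by (simp add: P_def)
    then show "\<exists>s. P 0 s" by blast
  next
    fix s :: "('a \<Rightarrow> complex) \<times> ('a \<Rightarrow> complex) \<times> 'i \<times> real \<times> nat" and n :: nat
    assume "P n s"
    moreover obtain f g i c m where s: "s = (f, g, i, c, m)" by (metis surj_pair)
    ultimately have P: "g \<in> schwartz" "K i \<le> c" "n \<le> m" by (auto simp: P_def)
    have c: "0 \<le> c" using K(1)[of i] P(2) by linarith
    obtain i' f' where f': "f' \<in> schwartz" "schwartz_norm m f' \<le> (1 / 2) ^ n / (1 + c)"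
      "B g + n + 2 \<le> norm (\<Lambda> i' f')"
      using hump[of "(1 / 2) ^ n / (1 + c)" "B g + n + 2" m] B0[OF P(1)] c by auto
    have "P (Suc n) (f', \<lambda>x. g x + f' x, i', max c (K i'), max (Suc m) (\<nu> i'))"
      using P f' by (auto simp: P_def intro: schwartz_add)
    moreover have "Q n s (f', \<lambda>x. g x + f' x, i', max c (K i'), max (Suc m) (\<nu> i'))"
      using f' by (simp add: Q_def s le_max_iff_disj)
    ultimately show "\<exists>t. P (Suc n) t \<and> Q n s t" by blast
  qed
  then obtain s where s: "\<And>n. P n (s n)" "\<And>n. Q n (s n) (s (Suc n))" by blast
  define f where "f n = fst (s n)" for n
  define g where "g n = fst (snd (s n))" for n
  define i where "i n = fst (snd (snd (s n)))" for n
  define c where "c n = fst (snd (snd (snd (s n))))" for n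
  define m where "m n = snd (snd (snd (snd (s n))))" for n
  have s_eq: "s n = (f n, g n, i n, c n, m n)" for n by (simp add: f_def g_def i_def c_def m_def)
  have f: "f n \<in> schwartz" and g: "g n \<in> schwartz" and Kc: "K (i n) \<le> c n" and \<nu>m: "\<nu> (i n) \<le> m n"
    and nm: "n \<le> m n" for n
    using s(1)[of n] by (auto simp: P_def s_eq)
  have g_Suc: "g (Suc n) = (\<lambda>x. g n x + f (Suc n) x)" and c_Suc: "c n \<le> c (Suc n)" and m_Suc: "m n \<le> m (Suc n)"
    and small: "schwartz_norm (m n) (f (Suc n)) \<le> (1 / 2) ^ n / (1 + c n)"
    and large: "B (g n) + n + 2 \<le> norm (\<Lambda> (i (Suc n)) (f (Suc n)))" for n
    using s(2)[of n] by (auto simp: Q_def s_eq)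
  have c0: "0 \<le> c n" for n using K(1) Kc order_trans by blast
  have c_mono: "mono c" and m_mono: "mono m" using c_Suc m_Suc by (auto intro: incseq_SucI)
  have small': "schwartz_norm k (f (Suc n)) \<le> (1 / 2) ^ n" if "k \<le> n" for k n
  proof -
    have "schwartz_norm k (f (Suc n)) \<le> schwartz_norm (m n) (f (Suc n))"
      using that nm[of n] by (intro schwartz_norm_mono f) simp
    also have "\<dots> \<le> (1 / 2) ^ n / (1 + c n)" by (rule small)
    also have "\<dots> \<le> (1 / 2) ^ n" using divide_left_mono[of 1 "1 + c n" "(1 / 2) ^ n"] c0[of n] by simp
    finally show ?thesis .
  qed
  define F where "F p x = (\<Sum>n. f (n + p) x)" for p x
  have summ: "summable (\<lambda>n. schwartz_seminorm k vs (f (n + p)))" if vs: "set vs \<subseteq> Basis" for k vs p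
  proof -
    have "summable (\<lambda>n. schwartz_seminorm k vs (f (n + 1)))"
    proof (rule summable_comparison_test'[of "\<lambda>n. (1 / 2) ^ n" "max k (length vs)"])
      fix n assume n: "max k (length vs) \<le> n"
      have "schwartz_seminorm k vs (f (n + 1)) \<le> schwartz_norm (max k (length vs)) (f (Suc n))"
        using schwartz_seminorm_le_norm[OF f, of k "max k (length vs)" vs "Suc n"] vs by simp
      then show "norm (schwartz_seminorm k vs (f (n + 1))) \<le> (1 / 2) ^ n"
        using small'[OF n] schwartz_seminorm_nonneg[OF f vs] by simp
    qed (simp add: summable_geometric)
    then show ?thesis
      by (simp only: summable_iff_shift[of "\<lambda>n. schwartz_seminorm k vs (f n)"])
  qed
  have F: "F p \<in> schwartz" for p
    unfolding F_def[abs_def] by (intro schwartz_series(1) f summ)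
  have tail: "norm (\<Lambda> (i n) (F (Suc n))) \<le> 2" for n
  proof -
    have "norm (\<Lambda> (i n) (F (Suc n))) \<le> K (i n) * schwartz_norm (\<nu> (i n)) (F (Suc n))"
      by (rule K(2)[OF F])
    also have "\<dots> \<le> c n * (\<Sum>j. schwartz_norm (m n) (f (j + Suc n)))"
    proof (intro mult_mono Kc)
      have "schwartz_norm (\<nu> (i n)) (F (Suc n)) \<le> schwartz_norm (m n) (F (Suc n))"
        by (intro schwartz_norm_mono F \<nu>m)
      also have "\<dots> \<le> (\<Sum>j. schwartz_norm (m n) (f (j + Suc n)))"
        unfolding F_def[abs_def] by (intro schwartz_norm_series(1) f summ)
      finally show "schwartz_norm (\<nu> (i n)) (F (Suc n)) \<le> (\<Sum>j. schwartz_norm (m n) (f (j + Suc n)))" .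
    qed (auto intro: c0 schwartz_norm_nonneg F)
    also have "\<dots> = (\<Sum>j. c n * schwartz_norm (m n) (f (j + Suc n)))"
      by (intro suminf_mult[symmetric] schwartz_norm_series(2) f summ)
    also have "\<dots> \<le> (\<Sum>j. (1 / 2) ^ j)"
    proof (intro suminf_le summable_mult schwartz_norm_series(2) f summ)
      fix j
      have "schwartz_norm (m n) (f (j + Suc n)) \<le> schwartz_norm (m (j + n)) (f (Suc (j + n)))"
        using schwartz_norm_mono[OF f monoD[OF m_mono, of n "j + n"], of "Suc (j + n)"] by simp
      also have "\<dots> \<le> (1 / 2) ^ (j + n) / (1 + c (j + n))" by (rule small)
      finally have "c n * schwartz_norm (m n) (f (j + Suc n)) \<le> c n * ((1 / 2) ^ (j + n) / (1 + c (j + n)))"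
        by (intro mult_left_mono c0)
      \<comment> \<open>Monotonicity of \<open>c\<close> lets the denominator chosen for a later
        hump cancel the earlier constant \<open>c n\<close>.\<close>
      also have "\<dots> \<le> (1 + c (j + n)) * ((1 / 2) ^ (j + n) / (1 + c (j + n)))"
        using c0[of "j + n"] monoD[OF c_mono, of n "j + n"] by (intro mult_right_mono) auto
      also have "\<dots> = (1 / 2) ^ (j + n)" using c0[of "j + n"] by simp
      also have "\<dots> \<le> (1 / 2) ^ j" by (intro power_decreasing) auto
      finally show "c n * schwartz_norm (m n) (f (j + Suc n)) \<le> (1 / 2) ^ j" .
    qed (simp_all add: summable_geometric)
    also have "\<dots> = 2" by (simp add: suminf_geometric)
    finally show ?thesis .
  qed
  \<comment> \<open>The recursion fixes only that \<open>g 0\<close> is a Schwartz function, and the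
    humps with controlled size start at index 1; hence \<open>g 0\<close> plus the series from 1
    on.\<close>
  define H where "H x = g 0 x + F 1 x" for x
  have H: "H \<in> schwartz" unfolding H_def[abs_def] by (intro schwartz_add g F)
  have H_split: "H x = g n x + F (Suc n) x" for n x
  proof (induction n)
    case (Suc n)
    have "summable (\<lambda>j. f (j + Suc n) x)" by (intro schwartz_series(3) f summ)
    from suminf_split_initial_segment[OF this, of 1]
    have "F (Suc n) x = F (Suc (Suc n)) x + f (Suc n) x" by (simp add: F_def)
    then show ?case using Suc by (simp add: g_Suc)
  qed (simp add: H_def)
  have "real n \<le> norm (\<Lambda> (i (Suc n)) H)" for n
  proof -
    let ?L = "\<Lambda> (i (Suc n))"
    have "H = (\<lambda>x. (g n x + f (Suc n) x) + F (Suc (Suc n)) x)"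
      using H_split[of _ "Suc n"] by (simp add: g_Suc fun_eq_iff)
    then have "?L H = ?L (g n) + ?L (f (Suc n)) + ?L (F (Suc (Suc n)))"
      by (simp add: tempered_add[OF temp] schwartz_add f g F)
    then have "norm (?L (f (Suc n))) \<le> norm (?L H) + norm (?L (g n)) + norm (?L (F (Suc (Suc n))))"
      using norm_triangle_ineq4[of "?L H - ?L (g n)" "?L (F (Suc (Suc n)))"] norm_triangle_ineq4[of "?L H" "?L (g n)"]
      by simp
    then show ?thesis using large[of n] B[OF g, of "i (Suc n)" n] tail[of "Suc n"] by linarith
  qed
  then have "real n \<le> B H" for n by (rule order_trans) (rule B[OF H])
  moreover obtain n where "B H < real n" using reals_Archimedean2 by blast
  ultimately show False by (meson not_le)
qed

section \<open>The decomposition of weakly almost periodic distributions\<close>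

lemma eberlein_s_eqI:
  assumes "SAP h" "WAP0 (\<lambda>x. g x - h x)" shows "eberlein_s g = h"
  unfolding eberlein_s_def using assms by (intro the_equality) (auto intro: eberlein_unique)

lemma eberlein_s_props:
  assumes "WAP g"
  shows SAP_eberlein_s: "SAP (eberlein_s g)"
    and WAP0_eberlein_0: "WAP0 (\<lambda>x. g x - eberlein_s g x)"
    and eberlein_s_bound: "(\<And>y. norm (g y) \<le> B) \<Longrightarrow> norm (eberlein_s g x) \<le> B"
proof -
  obtain h where h: "SAP h" "WAP0 (\<lambda>x. g x - h x)"
    "\<And>B x. (\<And>y. norm (g y) \<le> B) \<Longrightarrow> norm (h x) \<le> B"
    using eberlein_exists[OF assms] by blast
  then have "eberlein_s g = h" by (intro eberlein_s_eqI)
  then show "SAP (eberlein_s g)" "WAP0 (\<lambda>x. g x - eberlein_s g x)"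
    "(\<And>y. norm (g y) \<le> B) \<Longrightarrow> norm (eberlein_s g x) \<le> B" using h by auto
qed

text \<open>Sums of decompositions are decompositions, so uniqueness gives additivity. Scalars and
  translations follow the same pattern.\<close>

lemma eberlein_s_add:
  assumes "WAP f" "WAP g"
  shows "eberlein_s (\<lambda>x. f x + g x) = (\<lambda>x. eberlein_s f x + eberlein_s g x)"
proof (rule eberlein_s_eqI)
  show "SAP (\<lambda>x. eberlein_s f x + eberlein_s g x)" by (intro SAP_add SAP_eberlein_s assms)
  show "WAP0 (\<lambda>x. f x + g x - (eberlein_s f x + eberlein_s g x))"
    using WAP0_add[OF WAP0_eberlein_0[OF assms(1)] WAP0_eberlein_0[OF assms(2)]]
    by (simp add: algebra_simps)
qed

lemma eberlein_s_cmul: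
  assumes "WAP f" shows "eberlein_s (\<lambda>x. c * f x) = (\<lambda>x. c * eberlein_s f x)"
proof (rule eberlein_s_eqI)
  show "SAP (\<lambda>x. c * eberlein_s f x)" by (intro SAP_cmul SAP_eberlein_s assms)
  show "WAP0 (\<lambda>x. c * f x - c * eberlein_s f x)"
    using WAP0_cmul[OF WAP0_eberlein_0[OF assms], of c] by (simp add: algebra_simps)
qed

lemma eberlein_s_translate:
  assumes "WAP f" shows "eberlein_s (\<lambda>x. f (x + t)) = (\<lambda>x. eberlein_s f (x + t))"
  by (intro eberlein_s_eqI SAP_translate SAP_eberlein_s WAP0_translate[OF WAP0_eberlein_0] assms)

text \<open>Evaluating \<open>dconv \<psi>\<close> of the reflected function at 0 recovers
  \<open>\<psi> f\<close>; the almost periodic part is taken before evaluating. The value 0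
  elsewhere is the normalisation required by \<open>tempered\<close>.\<close>

definition distribution_s ::
  "(('a::euclidean_space \<Rightarrow> complex) \<Rightarrow> complex) \<Rightarrow> ('a \<Rightarrow> complex) \<Rightarrow> complex" where
  "distribution_s \<psi> f = (if f \<in> schwartz then eberlein_s (dconv \<psi> (\<lambda>x. f (- x))) 0 else 0)"

lemma schwartz_uminus: "f \<in> schwartz \<Longrightarrow> (\<lambda>x. f (- x)) \<in> schwartz"
  using schwartz_reflect[of f 0] by simp

text \<open>Reflecting \<open>x \<mapsto> f (t - x)\<close> turns its convolution with \<psi> into
  the translate of \<open>dconv \<psi> f\<close> by \<open>t\<close>. Taking the almost periodic
  part commutes with translation, so evaluation at 0 becomes evaluation at \<open>t\<close>.\<close>

lemma dconv_distribution_s: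
  assumes \<psi>: "\<psi> \<in> WAP_S" and f: "f \<in> schwartz"
  shows "dconv (distribution_s \<psi>) f = eberlein_s (dconv \<psi> f)"
proof
  fix t
  have "dconv \<psi> (\<lambda>x. f (t - - x)) = (\<lambda>x. dconv \<psi> f (x + t))"
    by (auto simp: dconv_def algebra_simps)
  then show "dconv (distribution_s \<psi>) f t = eberlein_s (dconv \<psi> f) t"
    using \<psi> f unfolding dconv_def[of "distribution_s \<psi>"] distribution_s_def
    by (simp add: schwartz_reflect eberlein_s_translate WAP_S_def)
qed

lemma tempered_distribution_s:
  fixes \<psi> :: "('a::euclidean_space \<Rightarrow> complex) \<Rightarrow> complex"
  assumes "\<psi> \<in> WAP_S" shows "tempered (distribution_s \<psi>)"
proof -
  have \<psi>: "tempered \<psi>" and wap: "\<And>f. f \<in> schwartz \<Longrightarrow> WAP (dconv \<psi> f)"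
    using assms by (auto simp: WAP_S_def)
  \<comment> \<open>Weakly almost periodic functions are bounded, which is pointwise boundedness of
    the functionals indexed by \<open>t\<close>.\<close>
  have "\<exists>B. \<forall>t. norm (dconv \<psi> f t) \<le> B" if "f \<in> schwartz" for f
    using WAP_is_Cu[OF wap[OF that]] by (auto simp: is_Cu_def bounded_iff)
  then obtain C N where C: "\<And>t f. f \<in> schwartz \<Longrightarrow> norm (dconv \<psi> f t) \<le> C * schwartz_norm N f"
    using tempered_uniform_boundedness[of "\<lambda>t f. dconv \<psi> f t", OF tempered_dconv[OF \<psi>]] by blast
  let ?u = "\<lambda>f :: 'a \<Rightarrow> complex. \<lambda>x. f (- x)"
  have "norm (distribution_s \<psi> f) \<le> \<bar>C\<bar> * schwartz_norm N f" if f: "f \<in> schwartz" for f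
  proof -
    note uf = schwartz_uminus[OF f]
    have "norm (distribution_s \<psi> f) \<le> C * schwartz_norm N (?u f)"
      using f by (simp add: distribution_s_def eberlein_s_bound[OF wap[OF uf]] C[OF uf])
    also have "\<dots> \<le> \<bar>C\<bar> * schwartz_norm N (?u f)"
      by (intro mult_right_mono schwartz_norm_nonneg uf) simp
    also have "\<dots> \<le> \<bar>C\<bar> * schwartz_norm N f"
      using schwartz_norm_reflect[OF f, of N 0] by (intro mult_left_mono) auto
    finally show ?thesis .
  qed
  then have "\<exists>C N. \<forall>f\<in>schwartz. norm (distribution_s \<psi> f) \<le> C * schwartz_norm N f" by blast
  moreover have "distribution_s \<psi> (\<lambda>x. f x + g x) = distribution_s \<psi> f + distribution_s \<psi> g"
    if fg: "f \<in> schwartz" "g \<in> schwartz" for f g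
  proof -
    have "dconv \<psi> (?u (\<lambda>x. f x + g x)) = (\<lambda>t. dconv \<psi> (?u f) t + dconv \<psi> (?u g) t)"
      using tempered_add[OF tempered_dconv[OF \<psi>] schwartz_uminus[OF fg(1)] schwartz_uminus[OF fg(2)]]
      by auto
    then show ?thesis
      using fg by (simp add: distribution_s_def schwartz_add eberlein_s_add wap schwartz_uminus)
  qed
  moreover have "distribution_s \<psi> (\<lambda>x. c * f x) = c * distribution_s \<psi> f" if f: "f \<in> schwartz" for f c
  proof -
    have "dconv \<psi> (?u (\<lambda>x. c * f x)) = (\<lambda>t. c * dconv \<psi> (?u f) t)"
      using tempered_cmul[OF tempered_dconv[OF \<psi>] schwartz_uminus[OF f]] by auto
    then show ?thesis
      using f by (simp add: distribution_s_def schwartz_cmul eberlein_s_cmul wap schwartz_uminus)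
  qed
  ultimately show ?thesis unfolding tempered_iff by (simp add: distribution_s_def)
qed

text \<open>Convolving with the reflected function and evaluating at 0 returns the distribution
  itself; outside \<open>schwartz\<close> both vanish.\<close>

lemma tempered_eqI:
  assumes "tempered \<psi>" "tempered \<eta>" "\<And>f. f \<in> schwartz \<Longrightarrow> dconv \<psi> f = dconv \<eta> f"
  shows "\<psi> = \<eta>"
proof
  fix f
  show "\<psi> f = \<eta> f"
  proof (cases "f \<in> schwartz")
    case True
    from fun_cong[OF assms(3)[OF schwartz_uminus[OF True]], of 0] show ?thesis
      by (simp add: dconv_def)
  qed (simp add: assms tempered_outside)
qed

lemma SAP_S_plus_WAP0_S:
  assumes "\<psi>s \<in> SAP_S" "\<psi>0 \<in> WAP0_S" shows "(\<lambda>f. \<psi>s f + \<psi>0 f) \<in> WAP_S"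
proof -
  have "tempered (\<lambda>f. \<psi>s f + 1 * \<psi>0 f)"
    using assms by (intro tempered_linear_combination) (auto simp: SAP_S_def WAP0_S_def)
  moreover have "WAP (\<lambda>t. dconv \<psi>s f t + dconv \<psi>0 f t)" if "f \<in> schwartz" for f
  proof (rule WAP_add)
    show "WAP (dconv \<psi>s f)" using assms that by (auto simp: SAP_S_def intro: SAP_imp_WAP)
    show "WAP (dconv \<psi>0 f)" using assms that by (auto simp: WAP0_S_def WAP0_iff)
  qed
  moreover have "dconv (\<lambda>f. \<psi>s f + \<psi>0 f) f = (\<lambda>t. dconv \<psi>s f t + dconv \<psi>0 f t)" for f
    by (auto simp: dconv_def)
  ultimately show ?thesis by (simp add: WAP_S_def)
qed

text \<open>This concerns an arbitrary decomposition of a distribution, so it serves both the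
  uniqueness claim and the identities for convolutions.\<close>

lemma eberlein_s_dconv:
  assumes "\<psi>s \<in> SAP_S" "\<psi>0 \<in> WAP0_S" "f \<in> schwartz"
  shows "eberlein_s (dconv (\<lambda>f. \<psi>s f + \<psi>0 f) f) = dconv \<psi>s f"
proof (rule eberlein_s_eqI)
  show "SAP (dconv \<psi>s f)" using assms by (simp add: SAP_S_def)
  have "dconv (\<lambda>f. \<psi>s f + \<psi>0 f) f x - dconv \<psi>s f x = dconv \<psi>0 f x" for x
    by (simp add: dconv_def)
  then show "WAP0 (\<lambda>x. dconv (\<lambda>f. \<psi>s f + \<psi>0 f) f x - dconv \<psi>s f x)"
    using assms by (simp add: WAP0_S_def)
qed

lemma distribution_s_SAP_S:
  assumes "\<psi> \<in> WAP_S" shows "distribution_s \<psi> \<in> SAP_S"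
  using assms tempered_distribution_s[OF assms]
  by (auto simp: SAP_S_def dconv_distribution_s WAP_S_def SAP_eberlein_s)

lemma minus_distribution_s_WAP0_S:
  assumes "\<psi> \<in> WAP_S" shows "(\<lambda>f. \<psi> f - distribution_s \<psi> f) \<in> WAP0_S"
proof -
  have "tempered (\<lambda>f. \<psi> f + - 1 * distribution_s \<psi> f)"
    using assms by (intro tempered_linear_combination tempered_distribution_s) (auto simp: WAP_S_def)
  moreover have "dconv (\<lambda>f. \<psi> f - distribution_s \<psi> f) f = (\<lambda>t. dconv \<psi> f t - eberlein_s (dconv \<psi> f) t)"
    if "f \<in> schwartz" for f
    using dconv_distribution_s[OF assms that] by (auto simp: dconv_def fun_eq_iff)
  ultimately show ?thesis
    using assms by (simp add: WAP0_S_def WAP_S_def WAP0_eberlein_0)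
qed

text \<open>The first conjunct is the inclusion of the sum in \<open>WAP_S\<close>; existence gives
  the reverse inclusion. Uniqueness is stated for pairs, so that both summands are determined
  together.\<close>

theorem theorem5p8:
  fixes \<psi> :: "('a::euclidean_space \<Rightarrow> complex) \<Rightarrow> complex"
  shows "(\<forall>\<psi>s\<in>SAP_S. \<forall>\<psi>0\<in>WAP0_S. (\<lambda>f. \<psi>s f + \<psi>0 f) \<in> (WAP_S :: (('a \<Rightarrow> complex) \<Rightarrow> complex) set))
    \<and> (\<psi> \<in> WAP_S \<longrightarrow>
         (\<exists>!p. fst p \<in> SAP_S \<and> snd p \<in> WAP0_S \<and> \<psi> = (\<lambda>f. fst p f + snd p f))
       \<and> (\<forall>\<psi>s \<psi>0. \<psi>s \<in> SAP_S \<and> \<psi>0 \<in> WAP0_S \<and> \<psi> = (\<lambda>f. \<psi>s f + \<psi>0 f) \<longrightarrow>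
            (\<forall>f\<in>schwartz. eberlein_s (dconv \<psi> f) = dconv \<psi>s f
                         \<and> eberlein_0 (dconv \<psi> f) = dconv \<psi>0 f)))"
proof (intro conjI ballI impI)
  show "(\<lambda>f. \<psi>s f + \<psi>0 f) \<in> WAP_S" if "\<psi>s \<in> SAP_S" "\<psi>0 \<in> WAP0_S"
    for \<psi>s \<psi>0 :: "('a \<Rightarrow> complex) \<Rightarrow> complex"
    using that by (rule SAP_S_plus_WAP0_S)
next
  assume \<psi>: "\<psi> \<in> WAP_S"
  show "\<exists>!p. fst p \<in> SAP_S \<and> snd p \<in> WAP0_S \<and> \<psi> = (\<lambda>f. fst p f + snd p f)"
  proof (rule ex1I[of _ "(distribution_s \<psi>, \<lambda>f. \<psi> f - distribution_s \<psi> f)"])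
    show "fst (distribution_s \<psi>, \<lambda>f. \<psi> f - distribution_s \<psi> f) \<in> SAP_S
        \<and> snd (distribution_s \<psi>, \<lambda>f. \<psi> f - distribution_s \<psi> f) \<in> WAP0_S
        \<and> \<psi> = (\<lambda>f. fst (distribution_s \<psi>, \<lambda>f. \<psi> f - distribution_s \<psi> f) f
          + snd (distribution_s \<psi>, \<lambda>f. \<psi> f - distribution_s \<psi> f) f)"
      using distribution_s_SAP_S[OF \<psi>] minus_distribution_s_WAP0_S[OF \<psi>] by simp
  next
    fix p assume p: "fst p \<in> SAP_S \<and> snd p \<in> WAP0_S \<and> \<psi> = (\<lambda>f. fst p f + snd p f)"
    have s: "fst p = distribution_s \<psi>"
    proof (rule tempered_eqI)
      show "tempered (fst p)" using p by (auto simp: SAP_S_def)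
      show "tempered (distribution_s \<psi>)" by (rule tempered_distribution_s[OF \<psi>])
      show "dconv (fst p) f = dconv (distribution_s \<psi>) f" if f: "f \<in> schwartz" for f
      proof -
        have "eberlein_s (dconv \<psi> f) = dconv (fst p) f" using p eberlein_s_dconv f by blast
        then show ?thesis by (simp only: dconv_distribution_s[OF \<psi> f])
      qed
    qed
    moreover have "snd p = (\<lambda>f. \<psi> f - distribution_s \<psi> f)"
    proof
      fix f
      have "\<psi> f = fst p f + snd p f" using p by (metis (no_types))
      then show "snd p f = \<psi> f - distribution_s \<psi> f" by (simp add: s)
    qed
    ultimately show "p = (distribution_s \<psi>, \<lambda>f. \<psi> f - distribution_s \<psi> f)"
      by (simp add: prod_eq_iff)
  qed
next
  show "\<forall>\<psi>s \<psi>0. \<psi>s \<in> SAP_S \<and> \<psi>0 \<in> WAP0_S \<and> \<psi> = (\<lambda>f. \<psi>s f + \<psi>0 f) \<longrightarrow>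
      (\<forall>f\<in>schwartz. eberlein_s (dconv \<psi> f) = dconv \<psi>s f \<and> eberlein_0 (dconv \<psi> f) = dconv \<psi>0 f)"
  proof (intro allI impI ballI)
    fix \<psi>s \<psi>0 :: "('a \<Rightarrow> complex) \<Rightarrow> complex" and f :: "'a \<Rightarrow> complex"
    assume d: "\<psi>s \<in> SAP_S \<and> \<psi>0 \<in> WAP0_S \<and> \<psi> = (\<lambda>f. \<psi>s f + \<psi>0 f)" and f: "f \<in> schwartz"
    have e: "eberlein_s (dconv \<psi> f) = dconv \<psi>s f" using d eberlein_s_dconv f by blast
    moreover have "dconv \<psi> f t - dconv \<psi>s f t = dconv \<psi>0 f t" for t using d by (simp add: dconv_def)
    ultimately show "eberlein_s (dconv \<psi> f) = dconv \<psi>s f \<and> eberlein_0 (dconv \<psi> f) = dconv \<psi>0 f"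
      by (simp add: eberlein_0_def)
  qed
qed

end
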